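(* Let $R\in S(4)$. (a) If $|R|=3^t$ for some $t\geq 1$, then $R$ is isomorphic to $F_3[x,y]/(x^2,xy,y^2)$ or to $T_2(F_3)$. (b) If $|R|=2^t$ for some $t\geq 1$, then $R$ is isomorphic to $F_4\times F_4$ or to $M_2(F_2)$.
   Context: Rings are associative; subrings are not required to contain the multiplicative identity, nor any identity. The covering number $\sigma(R)$ of a ring $R$ is the minimal number of proper subrings whose union is $R$, with $\sigma(R)=\infty$ if $R$ is not a union of finitely many proper subrings. $S(4)$ is the collection of isomorphism classes of unital rings $R$ such that $\sigma(R)=4$ and $\sigma(R/I)>4$ for every nonzero two-sided ideal $I$ of $R$. $F_q$ denotes the field with $q$ elements, $M_2(F_2)$ the ring of $2\times 2$ matrices over $F_2$, and $T_2(F_3)$ the ring of upper triangular $2\times 2$ matrices over $F_3$. *)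

theory Defs
  imports "HOL-Algebra.UnivPoly" "HOL-Algebra.Chinese_Remainder" "HOL-Library.Extended_Nat"
begin

text \<open>
  The library's \<open>subring\<close> contains the identity of the ambient ring. Here a subring need not
  contain any identity.
\<close>

definition nonunital_subring :: "'a set \<Rightarrow> ('a, 'm) ring_scheme \<Rightarrow> bool" where
  "nonunital_subring S R \<longleftrightarrow>
     additive_subgroup S R \<and> (\<forall>x\<in>S. \<forall>y\<in>S. x \<otimes>\<^bsub>R\<^esub> y \<in> S)"

definition proper_subring :: "'a set \<Rightarrow> ('a, 'm) ring_scheme \<Rightarrow> bool" where
  "proper_subring S R \<longleftrightarrow> nonunital_subring S R \<and> S \<noteq> carrier R"

text \<open>In \<^typ>\<open>enat\<close> the infimum of the empty set is \<open>\<infinity>\<close>, the value for rings without a finite cover.\<close>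

definition covering_number :: "('a, 'm) ring_scheme \<Rightarrow> enat" where
  "covering_number R =
     Inf {enat (card C) | C. finite C \<and> (\<forall>S\<in>C. proper_subring S R) \<and> \<Union>C = carrier R}"

definition in_S :: "nat \<Rightarrow> ('a, 'm) ring_scheme \<Rightarrow> bool" where
  "in_S n R \<longleftrightarrow> ring R \<and> covering_number R = enat n \<and>
     (\<forall>I. ideal I R \<and> I \<noteq> {\<zero>\<^bsub>R\<^esub>} \<longrightarrow> covering_number (R Quot I) > enat n)"

text \<open>
  An \<open>n \<times> n\<close> matrix is a function on index pairs below \<open>n\<close>, \<open>undefined\<close> elsewhere, so that
  equality of functions is equality of matrices.
\<close>

definition matrix_ring :: "nat \<Rightarrow> ('a, 'm) ring_scheme \<Rightarrow> (nat \<times> nat \<Rightarrow> 'a) ring" where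
  "matrix_ring n F =
     \<lparr>carrier = ({..<n} \<times> {..<n}) \<rightarrow>\<^sub>E carrier F,
      mult = (\<lambda>A B. \<lambda>(i, j) \<in> {..<n} \<times> {..<n}. \<Oplus>\<^bsub>F\<^esub>k\<in>{..<n}. A (i, k) \<otimes>\<^bsub>F\<^esub> B (k, j)),
      one = (\<lambda>(i, j) \<in> {..<n} \<times> {..<n}. if i = j then \<one>\<^bsub>F\<^esub> else \<zero>\<^bsub>F\<^esub>),
      zero = (\<lambda>(i, j) \<in> {..<n} \<times> {..<n}. \<zero>\<^bsub>F\<^esub>),
      add = (\<lambda>A B. \<lambda>(i, j) \<in> {..<n} \<times> {..<n}. A (i, j) \<oplus>\<^bsub>F\<^esub> B (i, j))\<rparr>"

definition upper_triangular_ring ::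
    "nat \<Rightarrow> ('a, 'm) ring_scheme \<Rightarrow> (nat \<times> nat \<Rightarrow> 'a) ring" where
  "upper_triangular_ring n F = (matrix_ring n F)
     \<lparr>carrier := {A \<in> carrier (matrix_ring n F). \<forall>i<n. \<forall>j<i. A (i, j) = \<zero>\<^bsub>F\<^esub>}\<rparr>"

text \<open>\<open>F[x, y]\<close> is taken as \<open>(F[x])[y]\<close>.\<close>

definition poly2 :: "('a, 'm) ring_scheme \<Rightarrow> (nat \<Rightarrow> 'a, nat \<Rightarrow> nat \<Rightarrow> 'a) up_ring" where
  "poly2 F = UP (UP F)"

definition poly2_x :: "('a, 'm) ring_scheme \<Rightarrow> nat \<Rightarrow> nat \<Rightarrow> 'a" where
  "poly2_x F = monom (UP (UP F)) (monom (UP F) \<one>\<^bsub>F\<^esub> 1) 0"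

definition poly2_y :: "('a, 'm) ring_scheme \<Rightarrow> nat \<Rightarrow> nat \<Rightarrow> 'a" where
  "poly2_y F = monom (UP (UP F)) \<one>\<^bsub>UP F\<^esub> 1"

definition poly2_mod_squares :: "('a, 'm) ring_scheme \<Rightarrow> (nat \<Rightarrow> nat \<Rightarrow> 'a) set ring" where
  "poly2_mod_squares F = poly2 F Quot
     (Idl\<^bsub>poly2 F\<^esub> {poly2_x F [^]\<^bsub>poly2 F\<^esub> (2::nat),
                   poly2_x F \<otimes>\<^bsub>poly2 F\<^esub> poly2_y F,
                   poly2_y F [^]\<^bsub>poly2 F\<^esub> (2::nat)})"

definition is_GF :: "nat \<Rightarrow> ('a, 'm) ring_scheme \<Rightarrow> bool" where
  "is_GF q F \<longleftrightarrow> field F \<and> order F = q"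

text \<open>This field shows that \<open>is_GF 4\<close> is
  satisfiable. The pair \<open>(a, b)\<close> stands for \<open>a + b \<omega>\<close>, where \<open>\<omega>\<^sup>2 = \<omega> + 1\<close> and Booleans are the
  integers modulo 2.\<close>

definition GF4 :: "(bool \<times> bool) ring" where
  "GF4 = \<lparr>carrier = UNIV,
     mult = (\<lambda>(a, b) (c, d). ((a \<and> c) \<noteq> (b \<and> d), ((a \<and> d) \<noteq> (b \<and> c)) \<noteq> (b \<and> d))),
     one = (True, False), zero = (False, False),
     add = (\<lambda>(a, b) (c, d). (a \<noteq> c, b \<noteq> d))\<rparr>"

lemma is_GF_GF4: "is_GF 4 GF4"
proof -
  have cr: "cring GF4"
    by (intro cringI abelian_groupI comm_monoidI) (auto simp: GF4_def)
  have "field GF4"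
  proof (rule cring.cring_fieldI2[OF cr])
    show "\<zero>\<^bsub>GF4\<^esub> \<noteq> \<one>\<^bsub>GF4\<^esub>" by (simp add: GF4_def)
    show "\<exists>b\<in>carrier GF4. a \<otimes>\<^bsub>GF4\<^esub> b = \<one>\<^bsub>GF4\<^esub>" if "a \<in> carrier GF4" "a \<noteq> \<zero>\<^bsub>GF4\<^esub>" for a
      using that by (cases a) (auto simp: GF4_def)
  qed
  moreover have "order GF4 = 4"
    by (simp add: order_def GF4_def card_UNIV_bool flip: UNIV_Times_UNIV)
  ultimately show ?thesis by (simp add: is_GF_def)
qed

end

theory Submission
  imports Defs "HOL-Algebra.Multiplicative_Group" "HOL-Computational_Algebra.Primes"
begin

text \<open>
  Order \<open>3\<^sup>t\<close>: the four subrings of a cover all have index \<open>3\<close> and meet pairwise in the same subring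
  \<open>D\<close> of index \<open>9\<close>. Hence every line of the plane \<open>R/D\<close> comes from a subring, so \<open>D\<close> acts on \<open>R/D\<close> by
  scalars from either side. An element of \<open>D\<close> that annihilates \<open>R/D\<close> from both sides lies in an ideal
  contained in all four subrings, so it vanishes. If \<open>D\<close> consists of scalars, then \<open>R\<close> is a three-dimensional
  algebra over \<open>F\<^sub>3\<close> in which every element is quadratic, and a Peirce decomposition leaves only the two rings
  of (a). Otherwise \<open>D\<close> is \<open>F\<^sub>3 \<times> F\<^sub>3\<close>, and \<open>R\<close> has a nonzero ideal with quotient \<open>T\<^sub>2(F\<^sub>3)\<close>.

  Order \<open>2\<^sup>t\<close>: two of the four subrings have index \<open>2\<close>. Let \<open>R\<close> act on its quotient by the largest left
  ideal inside a unital subring \<open>S\<close> of index \<open>2\<close>. This maps \<open>R\<close> to \<open>M\<^sub>2(F\<^sub>2)\<close>, and \<open>S\<close> is the preimage of the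
  upper triangular matrices. Unless \<open>R\<close> maps onto \<open>M\<^sub>2(F\<^sub>2)\<close> or is covered by three subrings, \<open>S\<close> is therefore
  an ideal, the kernel of a derivation to \<open>F\<^sub>2\<close>, or the preimage of \<open>F\<^sub>2\<close> under a map onto \<open>F\<^sub>4\<close>. Two subrings
  of the same kind yield a cover by three subrings or a map onto \<open>F\<^sub>4 \<times> F\<^sub>4\<close>, while two subrings of different
  kinds force the other two to have index \<open>2\<close> as well, which is too many for three kinds.
\<close>

section \<open>Covers by subrings\<close>

text \<open>Minimality is used in two forms: an ideal inside every member of a cover by at most four
  subrings is zero, and a homomorphism onto a ring of covering number at most 4 is an isomorphism.
  In even order it therefore suffices to map R onto a target. In odd order R is rebuilt from a basis
  instead. The obstacle in odd order is that D need not be an ideal, so R/D is only a group; the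
  actions of D on it from both sides replace a module structure. Even the characteristic has to be
  derived: 3R lies in D because the members of the cover have index 3, and s(3x)t = 3(sxt) then
  places 3x in an ideal that minimality kills. One device recurs: a quadratic polynomial over F_3
  cannot have all three scalars as roots. It puts 1 into D and makes Peirce corners one-dimensional.
  The fields of the theorem are known only by their orders. For orders 2 and 4 the computations run
  in Boolean models, for order 3 in integer multiples, so that identities become propositional or
  questions of divisibility by 3.\<close>

lemma nonunital_subringD:
  assumes "nonunital_subring S R"
  shows "additive_subgroup S R" "\<And>x y. x \<in> S \<Longrightarrow> y \<in> S \<Longrightarrow> x \<otimes>\<^bsub>R\<^esub> y \<in> S"
  using assms by (auto simp: nonunital_subring_def)

lemma (in ring) nonunital_subringI:
  assumes "S \<subseteq> carrier R" "\<zero> \<in> S"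
    and "\<And>x y. x \<in> S \<Longrightarrow> y \<in> S \<Longrightarrow> x \<oplus> y \<in> S"
    and "\<And>x. x \<in> S \<Longrightarrow> \<ominus> x \<in> S"
    and "\<And>x y. x \<in> S \<Longrightarrow> y \<in> S \<Longrightarrow> x \<otimes> y \<in> S"
  shows "nonunital_subring S R"
  unfolding nonunital_subring_def
proof (intro conjI ballI additive_subgroup.intro add.subgroupI)
  show "a_inv R a \<in> S" if "a \<in> S" for a using that assms by simp
qed (use assms in auto)

lemma covering_number_le:
  assumes "finite C" "\<And>S. S \<in> C \<Longrightarrow> proper_subring S R" "\<Union>C = carrier R"
  shows "covering_number R \<le> enat (card C)"
  unfolding covering_number_def using assms by (intro Inf_lower) auto

text \<open>A nonempty set of extended naturals contains its infimum, and a finite infimum rules out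
  the empty set.\<close>

lemma covering_number_attained:
  assumes "covering_number R = enat n"
  obtains C where "finite C" "card C = n" "\<And>S. S \<in> C \<Longrightarrow> proper_subring S R" "\<Union>C = carrier R"
proof -
  define A where "A = {enat (card C) | C. finite C \<and> (\<forall>S\<in>C. proper_subring S R) \<and> \<Union>C = carrier R}"
  have Inf: "Inf A = enat n" using assms unfolding covering_number_def A_def .
  then have "A \<noteq> {}" unfolding Inf_enat_def by (cases "A = {}") simp_all
  then obtain k where "k \<in> A" by blast
  then have "(LEAST x. x \<in> A) \<in> A" by (rule LeastI)
  then have "enat n \<in> A" using Inf \<open>A \<noteq> {}\<close> unfolding Inf_enat_def by simp
  then obtain C where "finite C \<and> (\<forall>S\<in>C. proper_subring S R) \<and> \<Union>C = carrier R" "enat n = enat (card C)"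
    unfolding A_def by blast
  then show thesis using that[of C] by simp
qed

lemma proper_subring_vimage:
  assumes "ring R" "ring Q" "h \<in> ring_hom R Q" "h ` carrier R = carrier Q" "proper_subring S Q"
  shows "proper_subring {x \<in> carrier R. h x \<in> S} R"
proof -
  interpret R: ring R by fact
  interpret Q: ring Q by fact
  interpret h: ring_hom_ring R Q h using assms(1-3) by (intro ring_hom_ringI2) auto
  have S: "nonunital_subring S Q" "S \<noteq> carrier Q"
    using assms by (auto simp: proper_subring_def)
  interpret S: additive_subgroup S Q using S(1) nonunital_subringD by blast
  have "nonunital_subring {x \<in> carrier R. h x \<in> S} R"
    by (rule R.nonunital_subringI) (auto simp: S.a_closed nonunital_subringD[OF S(1)])
  moreover have "{x \<in> carrier R. h x \<in> S} \<noteq> carrier R"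
  proof
    assume eq: "{x \<in> carrier R. h x \<in> S} = carrier R"
    have "carrier Q \<subseteq> S" unfolding assms(4)[symmetric] using eq by blast
    then show False using S(2) S.a_subset by blast
  qed
  ultimately show ?thesis by (simp add: proper_subring_def)
qed

lemma covering_number_hom_le:
  assumes "ring R" "ring Q" "h \<in> ring_hom R Q" "h ` carrier R = carrier Q"
  shows "covering_number R \<le> covering_number Q"
proof (cases "covering_number Q")
  case (enat n)
  then obtain C where C: "finite C" "card C = n" "\<And>S. S \<in> C \<Longrightarrow> proper_subring S Q"
    "\<Union>C = carrier Q" using covering_number_attained by metis
  let ?f = "\<lambda>S. {x \<in> carrier R. h x \<in> S}"
  have "covering_number R \<le> enat (card (?f ` C))"
  proof (rule covering_number_le)
    show "\<Union> (?f ` C) = carrier R" 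
    proof (intro equalityI subsetI)
      fix x assume x: "x \<in> carrier R"
      then have "h x \<in> \<Union>C" using C(4) assms(4) by blast
      then show "x \<in> \<Union> (?f ` C)" using x by blast
    qed auto
  qed (use C proper_subring_vimage[OF assms] in auto)
  also have "\<dots> \<le> enat n" using C card_image_le by fastforce
  finally show ?thesis using enat by simp
qed simp

text \<open>Since \<open>I\<close> lies in each \<open>S\<close>, each \<open>S\<close> is a union
  of cosets of \<open>I\<close>, so its image in the quotient stays proper. The cover descends to
  \<open>R Quot I\<close> with at most \<open>n\<close> members, against minimality unless
  \<open>I\<close> is zero.\<close>

lemma in_S_common_ideal:
  fixes R (structure)
  assumes "in_S n R" "ideal I R" "finite C" "card C \<le> n"
    and C: "\<And>S. S \<in> C \<Longrightarrow> proper_subring S R" "\<Union>C = carrier R" "\<And>S. S \<in> C \<Longrightarrow> I \<subseteq> S"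
  shows "I = {\<zero>}"
proof (rule ccontr)
  assume "I \<noteq> {\<zero>}"
  then have lt: "enat n < covering_number (R Quot I)" using assms by (auto simp: in_S_def)
  interpret I: ideal I R by fact
  let ?h = "(+>) I"
  interpret h: ring_hom_ring R "R Quot I" ?h by (rule I.rcos_ring_hom_ring)
  have car: "carrier (R Quot I) = ?h ` carrier R"
    by (auto simp: FactRing_def A_RCOSETS_def' a_r_coset_def')
  have proper: "proper_subring (?h ` S) (R Quot I)" if "S \<in> C" for S
  proof -
    have S: "nonunital_subring S R" "S \<noteq> carrier R" using C(1)[OF that] by (auto simp: proper_subring_def)
    interpret S: additive_subgroup S R using S(1) nonunital_subringD by blast
    have "nonunital_subring (?h ` S) (R Quot I)"
    proof (rule h.S.nonunital_subringI)
      show "\<zero>\<^bsub>R Quot I\<^esub> \<in> ?h ` S" using h.hom_zero by (metis S.zero_closed imageI)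
    next
      fix x y assume "x \<in> ?h ` S" "y \<in> ?h ` S"
      then obtain a b where ab: "x = ?h a" "y = ?h b" "a \<in> S" "b \<in> S" by blast
      then have "x \<oplus>\<^bsub>R Quot I\<^esub> y = ?h (a \<oplus> b)" by simp
      then show "x \<oplus>\<^bsub>R Quot I\<^esub> y \<in> ?h ` S" using ab S.a_closed by blast
      have "x \<otimes>\<^bsub>R Quot I\<^esub> y = ?h (a \<otimes> b)" using ab by simp
      then show "x \<otimes>\<^bsub>R Quot I\<^esub> y \<in> ?h ` S" using ab nonunital_subringD(2)[OF S(1)] by blast
    next
      fix x assume "x \<in> ?h ` S"
      then obtain a where ab: "x = ?h a" "a \<in> S" by blast
      then have "\<ominus>\<^bsub>R Quot I\<^esub> x = ?h (\<ominus> a)" by simp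
      then show "\<ominus>\<^bsub>R Quot I\<^esub> x \<in> ?h ` S" using ab by blast
    qed (use car S.a_subset in auto)
    moreover have "?h ` S \<noteq> carrier (R Quot I)"
    proof
      assume eq: "?h ` S = carrier (R Quot I)"
      have "r \<in> S" if r: "r \<in> carrier R" for r
      proof -
        obtain s where s: "s \<in> S" "?h r = ?h s" using eq r car by (metis imageE imageI)
        then have "r \<ominus> s \<in> I" using r I.quotient_eq_iff_same_a_r_cos[OF I.is_ideal] by simp
        then have "(r \<ominus> s) \<oplus> s \<in> S" using s \<open>S \<in> C\<close> C(3) by blast
        moreover have "(r \<ominus> s) \<oplus> s = r" using r s
          by (simp add: I.minus_eq I.a_assoc I.l_neg)
        ultimately show ?thesis by simp
      qed
      then show False using S(2) S.a_subset by blast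
    qed
    ultimately show ?thesis by (simp add: proper_subring_def)
  qed
  have "covering_number (R Quot I) \<le> enat (card ((`) ?h ` C))"
  proof (rule covering_number_le)
    show "\<Union> ((`) ?h ` C) = carrier (R Quot I)" unfolding car C(2)[symmetric] by blast
  qed (use proper assms in auto)
  also have "\<dots> \<le> enat n" using assms(3,4) card_image_le[of C "(`) ?h"] by (simp add: order_trans)
  finally show False using lt by simp
qed

text \<open>The quotient by the kernel is isomorphic to \<open>Q\<close>, so its covering number is
  at most \<open>n\<close> and minimality leaves only the zero kernel. To identify \<open>R\<close>
  it is thus enough to find a surjection onto a candidate.\<close>

lemma in_S_hom_imp_iso:
  assumes "in_S n R" "ring Q" "h \<in> ring_hom R Q" "h ` carrier R = carrier Q"
    and "covering_number Q \<le> enat n"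
  shows "R \<simeq> Q"
proof -
  interpret R: ring R using assms by (simp add: in_S_def)
  interpret Q: ring Q by fact
  interpret h: ring_hom_ring R Q h using assms(3) by (intro ring_hom_ringI2) (auto simp: R.ring_axioms Q.ring_axioms)
  let ?I = "a_kernel R Q h"
  interpret I: ideal ?I R by (rule h.kernel_is_ideal)
  obtain g where "g \<in> ring_iso (R Quot ?I) Q"
    using h.FactRing_iso assms(4) by (auto simp: is_ring_iso_def)
  then have "covering_number (R Quot ?I) \<le> covering_number Q"
    by (intro covering_number_hom_le) (auto simp: ring_iso_def bij_betw_def I.quotient_is_ring Q.ring_axioms)
  then have "?I = {\<zero>\<^bsub>R\<^esub>}"
    using assms(1,5) I.is_ideal leD[of "covering_number (R Quot ?I)" "enat n"] order_trans
    unfolding in_S_def by blast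
  then have "inj_on h (carrier R)" using h.trivial_ker_imp_inj by simp
  then have "h \<in> ring_iso R Q" using assms by (simp add: ring_iso_def bij_betw_def)
  then show ?thesis by (auto simp: is_ring_iso_def)
qed

section \<open>Covers of finite groups by four subgroups\<close>

lemma mult_le_cancel_nat: "x \<le> k * y" if "a * x \<le> k * a * y" "0 < a" for a k x y :: nat
  using that by (simp add: mult.assoc mult.left_commute[of k a])

context group
begin

lemma card_subgroup_dvd:
  assumes "subgroup A G" "subgroup B G" "A \<subseteq> B"
  shows "card A dvd card B"
proof -
  interpret B: group "G\<lparr>carrier := B\<rparr>" using assms(2) by (simp add: subgroup_imp_group)
  have "subgroup A (G\<lparr>carrier := B\<rparr>)" using assms by (simp add: subgroup_incl)
  from B.lagrange[OF this] have "card (rcosets\<^bsub>G\<lparr>carrier := B\<rparr>\<^esub> A) * card A = card B"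
    by (simp add: order_def)
  from dvdI[of "card B" "card A", OF trans[OF this[symmetric] mult.commute]] show ?thesis .
qed

lemma double_card_le_of_psubset:
  assumes "subgroup A G" "subgroup B G" "A \<subset> B" "finite B"
  shows "2 * card A \<le> card B"
proof -
  obtain q where q: "card B = card A * q" using card_subgroup_dvd[of A B] assms by auto
  have "card A < card B" using assms psubset_card_mono by blast
  moreover have "q \<noteq> 0" "q \<noteq> 1" using q calculation by auto
  ultimately have "q \<ge> 2" by simp
  then show ?thesis using q by simp
qed

text \<open>Each coset of \<open>A\<close> that meets \<open>B\<close> meets it in a translate of
  \<open>A \<inter> B\<close>; summing over the cosets of \<open>A\<close> bounds
  \<open>B\<close>.\<close>

lemma card_mult_card_le:
  assumes "finite (carrier G)" "subgroup A G" "subgroup B G"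
  shows "card A * card B \<le> order G * card (A \<inter> B)"
proof -
  have fin: "finite A" "finite B" using assms finite_subset subgroup.subset by metis+
  have fr: "finite (rcosets A)" using assms by (simp add: rcosets_finite subgroup.subset RCOSETS_def)
  have "B = (\<Union>c\<in>rcosets A. B \<inter> c)"
    using rcosets_part_G[OF assms(2)] subgroup.subset[OF assms(3)] by blast
  then have "card B \<le> (\<Sum>c\<in>rcosets A. card (B \<inter> c))" using card_UN_le[OF fr] by metis
  also have "\<dots> \<le> (\<Sum>c\<in>rcosets A. card (A \<inter> B))"
  proof (rule sum_mono)
    fix c assume c: "c \<in> rcosets A"
    show "card (B \<inter> c) \<le> card (A \<inter> B)"
    proof (cases "B \<inter> c = {}")
      case False
      then obtain b where b: "b \<in> B" "b \<in> c" by blast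
      obtain g where g: "g \<in> carrier G" "c = A #> g" using c by (auto simp: RCOSETS_def)
      then have cb: "c = A #> b" using repr_independence[of b A g] b assms(2) by simp
      have "B \<inter> c \<subseteq> (\<lambda>a. a \<otimes> b) ` (A \<inter> B)"
      proof
        fix x assume "x \<in> B \<inter> c"
        then obtain a where a: "a \<in> A" "x = a \<otimes> b" "x \<in> B" using cb by (auto simp: r_coset_def)
        have "b \<in> carrier G" "a \<in> carrier G" using a b assms subgroup.mem_carrier by metis+
        then have "a = x \<otimes> inv b" using a by (simp add: m_assoc)
        moreover have "x \<otimes> inv b \<in> B"
          using \<open>x \<in> B\<close> b(1) subgroup.m_closed[OF assms(3)] subgroup.m_inv_closed[OF assms(3)] by blast
        ultimately have "a \<in> B" by simp
        then show "x \<in> (\<lambda>a. a \<otimes> b) ` (A \<inter> B)" using a by blast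
      qed
      then have "card (B \<inter> c) \<le> card ((\<lambda>a. a \<otimes> b) ` (A \<inter> B))" using fin by (intro card_mono) auto
      also have "\<dots> \<le> card (A \<inter> B)" using fin by (intro card_image_le) auto
      finally show ?thesis .
    qed simp
  qed
  finally have "card B \<le> card (rcosets A) * card (A \<inter> B)" by simp
  then have "card A * card B \<le> (card (rcosets A) * card A) * card (A \<inter> B)" by simp
  then show ?thesis using lagrange[OF assms(2)] by simp
qed

text \<open>The complement of \<open>A\<close> is a single coset, so membership in \<open>A\<close>
  behaves like parity. For rings this makes the indicator of the complement additive with values in
  F_2.\<close>

lemma index_two_mult_mem:
  assumes "finite (carrier G)" "subgroup A G" "2 * card A = order G"
    and "x \<in> carrier G" "y \<in> carrier G"
  shows "x \<otimes> y \<in> A \<longleftrightarrow> (x \<in> A \<longleftrightarrow> y \<in> A)"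
proof -
  interpret A: subgroup A G by fact
  have *: "x \<otimes> y \<in> A \<longleftrightarrow> y \<in> A" if "x \<in> A" "y \<in> carrier G" for x y
  proof
    assume "x \<otimes> y \<in> A"
    then have "inv x \<otimes> (x \<otimes> y) \<in> A" using that A.m_closed A.m_inv_closed by blast
    then show "y \<in> A" using that A.mem_carrier by (simp flip: m_assoc)
  qed (use that in \<open>simp add: A.m_closed\<close>)
  have **: "x \<otimes> y \<in> A" if x: "x \<in> carrier G - A" and y: "y \<in> carrier G - A" for x y
  proof -
    have "finite A" using assms finite_subset A.subset by metis
    \<comment> \<open>Translation embeds \<open>A\<close> in its complement, and both have the same
      size, so every element outside \<open>A\<close> is of the form
      \<open>inv x \<otimes> a\<close>.\<close>
    have "(\<lambda>a. inv x \<otimes> a) ` A \<subseteq> carrier G - A"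
    proof clarify
      fix a assume a: "a \<in> A"
      have "inv x \<notin> A" using x A.m_inv_closed[of "inv x"] by auto
      moreover have "inv x = (inv x \<otimes> a) \<otimes> inv a" using a x A.mem_carrier by (simp add: m_assoc)
      ultimately have "inv x \<otimes> a \<notin> A" using a A.m_closed[of "inv x \<otimes> a" "inv a"] by auto
      then show "inv x \<otimes> a \<in> carrier G - A" using a x by simp
    qed
    moreover have "card ((\<lambda>a. inv x \<otimes> a) ` A) = card A"
      using x by (intro card_image inj_onI) (simp add: A.mem_carrier)
    moreover have "card (carrier G - A) = card A"
      using assms A.subset \<open>finite A\<close> by (simp add: card_Diff_subset order_def)
    ultimately have "(\<lambda>a. inv x \<otimes> a) ` A = carrier G - A"
      using assms(1) by (intro card_subset_eq) auto
    then obtain a where "a \<in> A" "y = inv x \<otimes> a" using y by blast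
    then show ?thesis using x by (simp flip: m_assoc)
  qed
  show ?thesis
  proof (cases "x \<in> A")
    case True then show ?thesis using * assms by simp
  next
    case False
    show ?thesis
    proof (cases "y \<in> A")
      case True
      have "x = (x \<otimes> y) \<otimes> inv y" using assms by (simp add: m_assoc)
      then have "x \<otimes> y \<notin> A" using False True A.m_closed[of "x \<otimes> y" "inv y"] by auto
      then show ?thesis using False True by simp
    qed (use ** False assms in auto)
  qed
qed


text \<open>The order of a subgroup is again a power of \<open>p\<close>, so no index lies strictly
  between \<open>p\<close> and its square.\<close>

lemma card_proper_subgroup:
  assumes "subgroup A G" "A \<noteq> carrier G" "order G = p ^ t" "prime p" "finite (carrier G)"
  shows "p * card A = order G \<or> p\<^sup>2 * card A \<le> order G"
proof -
  have "card A dvd p ^ t"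
    using card_subgroup_dvd[OF assms(1) subgroup_self] subgroup.subset[OF assms(1)] assms(3)
    by (simp add: order_def)
  then obtain s where s: "card A = p ^ s" "s \<le> t" using assms(4) divides_primepow_nat[of p "card A" t] by blast
  have "A \<subset> carrier G" using assms(1,2) subgroup.subset by blast
  then have "card A < order G" using psubset_card_mono[OF assms(5)] by (simp add: order_def)
  then have "s \<noteq> t" using s assms(3) by auto
  then consider "Suc s = t" | "Suc (Suc s) \<le> t" using s(2) by linarith
  then show ?thesis
  proof cases
    case 1
    then show ?thesis using s assms(3) by auto
  next
    case 2
    have "p\<^sup>2 * card A = p ^ Suc (Suc s)" using s by (simp add: power2_eq_square)
    also have "\<dots> \<le> p ^ t" using 2 prime_gt_0_nat[OF assms(4)] by (intro power_increasing) auto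
    finally show ?thesis using assms(3) by simp
  qed
qed

text \<open>\<open>A\<close> leaves two thirds of the group. Each other member meets
  \<open>A\<close> in at least a third of itself and has at most a third of the group, so it covers
  at most two ninths outside \<open>A\<close>. Three such parts must fit exactly: all indices are 3,
  and the parts outside \<open>A\<close> are disjoint.\<close>

lemma four_subgroup_cover_index_three_aux:
  assumes fin: "finite (carrier G)" and t: "order G = 3 ^ t"
    and sub: "subgroup A G" "subgroup B G" "subgroup C G" "subgroup E G"
    and proper: "B \<noteq> carrier G" "C \<noteq> carrier G" "E \<noteq> carrier G"
    and cov: "A \<union> B \<union> C \<union> E = carrier G" and A: "3 * card A = order G"
  shows "3 * card B = order G" "3 * card C = order G" "3 * card E = order G" "B \<inter> C \<subseteq> A"
proof -
  have finite: "finite A" "finite B" "finite C" "finite E"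
    using finite_subset[OF subgroup.subset fin] sub by auto
  have n: "order G > 0" using t by simp
  have cA: "card A > 0" using A n by auto
  have diff: "3 * card (X - A) \<le> 2 * card X" if "subgroup X G" "finite X" for X
  proof -
    have "card A * card X \<le> (3 * card A) * card (A \<inter> X)"
      using card_mult_card_le[OF fin sub(1) that(1)] unfolding A .
    then have "card X \<le> 3 * card (A \<inter> X)" using mult_le_cancel_nat cA by blast
    moreover have "card (X - A) + card (A \<inter> X) = card X"
      using card_Int_Diff[OF that(2), of A] by (simp add: Int_commute)
    ultimately show ?thesis by simp
  qed
  have le: "3 * card X \<le> order G" if "subgroup X G" "X \<noteq> carrier G" for X
    using card_proper_subgroup[OF that t _ fin] by auto
  have "order G = card (A \<union> ((B - A) \<union> (C - A) \<union> (E - A)))"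
    using cov unfolding order_def by (intro arg_cong[where f = card]) blast
  also have "\<dots> \<le> card A + card ((B - A) \<union> (C - A) \<union> (E - A))" by (rule card_Un_le)
  finally have 1: "order G \<le> card A + card ((B - A) \<union> (C - A) \<union> (E - A))" .
  have 2: "card ((B - A) \<union> (C - A) \<union> (E - A)) \<le> card ((B - A) \<union> (C - A)) + card (E - A)"
    by (rule card_Un_le)
  have 3: "card ((B - A) \<union> (C - A)) + card ((B - A) \<inter> (C - A)) = card (B - A) + card (C - A)"
    using finite by (intro card_Un_Int[symmetric]) auto
  note d = diff[OF sub(2) finite(2)] diff[OF sub(3) finite(3)] diff[OF sub(4) finite(4)]
  note l = le[OF sub(2) proper(1)] le[OF sub(3) proper(2)] le[OF sub(4) proper(3)]
  have le2: "9 * card (B - A) \<le> 2 * order G" "9 * card (C - A) \<le> 2 * order G" "9 * card (E - A) \<le> 2 * order G"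
    using d(1) l(1) d(2) l(2) d(3) l(3) by linarith+
  have ge: "2 * order G + 3 * card ((B - A) \<inter> (C - A)) \<le> 3 * card (B - A) + 3 * card (C - A) + 3 * card (E - A)"
    using 1 2 3 A by linarith
  have eq: "9 * card (B - A) = 2 * order G" "9 * card (C - A) = 2 * order G" "9 * card (E - A) = 2 * order G"
    "card ((B - A) \<inter> (C - A)) = 0"
    using le2 ge by linarith+
  show "3 * card B = order G" using eq(1) d(1) l(1) by linarith
  show "3 * card C = order G" using eq(2) d(2) l(2) by linarith
  show "3 * card E = order G" using eq(3) d(3) l(3) by linarith
  have "card ((B - A) \<inter> (C - A)) = 0" by (rule eq(4))
  then show "B \<inter> C \<subseteq> A" using finite by auto
qed

text \<open>Without a member of index 3 the four members would cover at most four ninths of the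
  group. Once one has index 3, all of them do.\<close>

lemma four_subgroup_cover_order_three_power:
  assumes fin: "finite (carrier G)" and t: "order G = 3 ^ t"
    and sub: "subgroup A G" "subgroup B G" "subgroup C G" "subgroup E G"
    and proper: "A \<noteq> carrier G" "B \<noteq> carrier G" "C \<noteq> carrier G" "E \<noteq> carrier G"
    and cov: "A \<union> B \<union> C \<union> E = carrier G"
  shows "3 * card A = order G" "3 * card B = order G" "3 * card C = order G" "3 * card E = order G"
    and "A \<inter> B = A \<inter> C" "A \<inter> B = A \<inter> E" "A \<inter> B = B \<inter> C" "A \<inter> B = B \<inter> E" "A \<inter> B = C \<inter> E"
proof -
  note * = four_subgroup_cover_index_three_aux[OF fin t]
  have n: "order G > 0" using t by simp
  have "3 * card A = order G \<or> 3 * card B = order G \<or> 3 * card C = order G \<or> 3 * card E = order G"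
  proof (rule ccontr)
    assume neg: "\<not> ?thesis"
    have le: "9 * card X \<le> order G" if "subgroup X G" "X \<noteq> carrier G" "3 * card X \<noteq> order G" for X
      using card_proper_subgroup[OF that(1,2) t _ fin] that(3) by auto
    have "order G \<le> card A + card B + card C + card E"
      using card_Un_le[of "A \<union> B \<union> C" E] card_Un_le[of "A \<union> B" C] card_Un_le[of A B] cov
      unfolding order_def by simp
    moreover have "9 * card A \<le> order G" "9 * card B \<le> order G" "9 * card C \<le> order G" "9 * card E \<le> order G"
      using le sub proper neg by auto
    ultimately show False using n by linarith
  qed
  then have all: "3 * card A = order G \<and> 3 * card B = order G \<and> 3 * card C = order G \<and> 3 * card E = order G"
  proof (elim disjE)
    assume 1: "3 * card A = order G"
    show ?thesis using *(1-3)[OF sub proper(2-4) cov 1] 1 by simp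
  next
    assume 1: "3 * card B = order G"
    have "B \<union> A \<union> C \<union> E = carrier G" using cov by blast
    from *(1-3)[OF sub(2,1,3,4) proper(1,3,4) this 1] 1 show ?thesis by simp
  next
    assume 1: "3 * card C = order G"
    have "C \<union> A \<union> B \<union> E = carrier G" using cov by blast
    from *(1-3)[OF sub(3,1,2,4) proper(1,2,4) this 1] 1 show ?thesis by simp
  next
    assume 1: "3 * card E = order G"
    have "E \<union> A \<union> B \<union> C = carrier G" using cov by blast
    from *(1-3)[OF sub(4,1,2,3) proper(1,2,3) this 1] 1 show ?thesis by simp
  qed
  then show "3 * card A = order G" "3 * card B = order G" "3 * card C = order G" "3 * card E = order G"
    by auto
  \<comment> \<open>Any member may now serve as the base of the tight count, and any two others then
    meet inside it.\<close>
  have tri: "Y \<inter> Z \<subseteq> X"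
    if "{X, Y, Z, V} = {A, B, C, E}" for X Y Z V
  proof -
    have mem: "X \<in> {A, B, C, E}" "Y \<in> {A, B, C, E}" "Z \<in> {A, B, C, E}" "V \<in> {A, B, C, E}"
      using that by blast+
    have "X \<union> Y \<union> Z \<union> V = \<Union>{X, Y, Z, V}" by blast
    also have "\<dots> = carrier G" unfolding that using cov by blast
    finally have c: "X \<union> Y \<union> Z \<union> V = carrier G" .
    have s: "subgroup T G \<and> T \<noteq> carrier G \<and> 3 * card T = order G" if "T \<in> {A, B, C, E}" for T
      using that sub proper all by blast
    show ?thesis using *(4)[of X Y Z V] s[OF mem(1)] s[OF mem(2)] s[OF mem(3)] s[OF mem(4)] c by simp
  qed
  have perm: "{A, B, C, E} = {C, A, B, E}" "{A, B, C, E} = {E, A, B, C}" "{A, B, C, E} = {B, A, C, E}"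
     "{A, B, C, E} = {B, A, E, C}" "{A, B, C, E} = {A, B, E, C}" "{A, B, C, E} = {A, C, E, B}"
     "{A, B, C, E} = {B, C, E, A}" by blast+
  show "A \<inter> B = A \<inter> C" using tri[of C A B E] tri[of B A C E] perm by simp blast
  show "A \<inter> B = A \<inter> E" using tri[of E A B C] tri[of B A E C] perm by simp blast
  show "A \<inter> B = B \<inter> C" using tri[of C A B E] tri[of A B C E] perm by simp blast
  show "A \<inter> B = B \<inter> E" using tri[of E A B C] tri[of A B E C] perm by simp blast
  show "A \<inter> B = C \<inter> E" using tri[of C A B E] tri[of E A B C] tri[of A C E B] tri[of B C E A] perm by simp blast
qed

text \<open>Four members of index at least 4 just fail, since they all contain the identity and
  their orders add up to at most the order of the group. Next to an \<open>A\<close> of index 2,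
  three members of index at least 4 have at most half of themselves outside \<open>A\<close>, hence
  cover at most three eighths of the group there instead of one half.\<close>

lemma four_subgroup_cover_order_two_power:
  assumes fin: "finite (carrier G)" and t: "order G = 2 ^ t"
    and sub: "subgroup A G" "subgroup B G" "subgroup C G" "subgroup E G"
    and proper: "A \<noteq> carrier G" "B \<noteq> carrier G" "C \<noteq> carrier G" "E \<noteq> carrier G"
    and cov: "A \<union> B \<union> C \<union> E = carrier G"
  shows "2 * card A = order G \<or> 2 * card B = order G \<or> 2 * card C = order G \<or> 2 * card E = order G"
    and "2 * card A = order G \<Longrightarrow> 2 * card B = order G \<or> 2 * card C = order G \<or> 2 * card E = order G"
proof -
  have finite: "finite A" "finite B" "finite C" "finite E"
    using finite_subset[OF subgroup.subset fin] sub by auto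
  have n: "order G > 0" using t by simp
  have le: "4 * card X \<le> order G" if "subgroup X G" "X \<noteq> carrier G" "2 * card X \<noteq> order G" for X
    using card_proper_subgroup[OF that(1,2) t _ fin] that(3) by auto
  show "2 * card A = order G \<or> 2 * card B = order G \<or> 2 * card C = order G \<or> 2 * card E = order G"
  proof (rule ccontr)
    assume neg: "\<not> ?thesis"
    have "order G \<le> card (A \<union> B) + card C + card E"
      using card_Un_le[of "A \<union> B \<union> C" E] card_Un_le[of "A \<union> B" C] cov
      unfolding order_def by simp
    moreover have "card (A \<union> B) + card (A \<inter> B) = card A + card B"
      using finite by (intro card_Un_Int[symmetric]) auto
    moreover have "card (A \<inter> B) > 0"
      using finite subgroup.one_closed[OF sub(1)] subgroup.one_closed[OF sub(2)] by (auto simp: card_gt_0_iff)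
    moreover have "4 * card A \<le> order G" "4 * card B \<le> order G" "4 * card C \<le> order G" "4 * card E \<le> order G"
      using le sub proper neg by auto
    ultimately show False by linarith
  qed
  show "2 * card B = order G \<or> 2 * card C = order G \<or> 2 * card E = order G" if A: "2 * card A = order G"
  proof (rule ccontr)
    assume neg: "\<not> ?thesis"
    have cA: "card A > 0" using A n by auto
    have diff: "2 * card (X - A) \<le> card X" if "subgroup X G" "finite X" for X
    proof -
      have "card A * card X \<le> (2 * card A) * card (A \<inter> X)"
      using card_mult_card_le[OF fin sub(1) that(1)] unfolding A .
      then have "card X \<le> 2 * card (A \<inter> X)" using mult_le_cancel_nat cA by blast
      moreover have "card (X - A) + card (A \<inter> X) = card X"
        using card_Int_Diff[OF that(2), of A] by (simp add: Int_commute)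
      ultimately show ?thesis by simp
    qed
    have "order G = card (A \<union> (B - A) \<union> (C - A) \<union> (E - A))"
      using cov unfolding order_def by (intro arg_cong[where f = card]) blast
    also have "\<dots> \<le> card A + card (B - A) + card (C - A) + card (E - A)"
      using card_Un_le[of "A \<union> (B - A) \<union> (C - A)" "E - A"] card_Un_le[of "A \<union> (B - A)" "C - A"]
        card_Un_le[of A "B - A"] by linarith
    finally have "order G \<le> card A + card (B - A) + card (C - A) + card (E - A)" .
    moreover have "4 * card B \<le> order G" "4 * card C \<le> order G" "4 * card E \<le> order G"
      using le sub proper neg by auto
    ultimately show False using diff[OF sub(2) finite(2)] diff[OF sub(3) finite(3)] diff[OF sub(4) finite(4)] A n
      by linarith
  qed
qed

text \<open>The set missed by \<open>A\<close> and \<open>B\<close> is one coset of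
  \<open>A \<inter> B\<close>. \<open>C\<close> and \<open>E\<close> cover it, but by
  \<open>ne\<close> neither does so alone. Each then covers at most half of it, so both cover
  exactly half and the halves are disjoint.\<close>

lemma two_index_two_subgroups_cover:
  assumes fin: "finite (carrier G)"
    and sub: "subgroup A G" "subgroup B G" "subgroup C G" "subgroup E G"
    and A: "2 * card A = order G" and B: "2 * card B = order G" and "A \<noteq> B"
    and cov: "A \<union> B \<union> C \<union> E = carrier G"
    and ne: "A \<union> B \<union> C \<noteq> carrier G" "A \<union> B \<union> E \<noteq> carrier G"
  shows "4 * card (A \<inter> B) = order G" "2 * card (A \<inter> B \<inter> C) = card (A \<inter> B)"
    "A \<inter> B \<inter> C = A \<inter> B \<inter> E"
proof -
  note mem = index_two_mult_mem[OF fin sub(1) A] index_two_mult_mem[OF fin sub(2) B]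
  have finite: "finite A" "finite B" "finite C" "finite E"
    using finite_subset[OF subgroup.subset fin] sub by auto
  let ?W = "A \<inter> B" and ?T = "carrier G - (A \<union> B)"
  have n: "order G > 0" using fin by (simp add: order_gt_0_iff_finite)
  have cA: "card A > 0" using A n by auto
  have W: "subgroup ?W G" using sub subgroups_Inter_pair by blast
  have "?W \<noteq> A"
  proof
    assume "?W = A"
    then have "A \<subseteq> B" by blast
    then show False using A B \<open>A \<noteq> B\<close> finite card_subset_eq[of B A] by simp
  qed
  then have "?W \<subset> A" by blast
  then have "2 * card ?W \<le> card A" using double_card_le_of_psubset[OF W sub(1)] finite by blast
  moreover have "card A * card B \<le> (2 * card A) * card ?W"
    using card_mult_card_le[OF fin sub(1,2)] unfolding A .
  then have "card B \<le> 2 * card ?W" using mult_le_cancel_nat cA by blast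
  ultimately show W4: "4 * card ?W = order G" using A B by linarith
  have "card (A \<union> B) + card ?W = card A + card B" using finite by (intro card_Un_Int[symmetric]) auto
  moreover have "card ?T + card (A \<union> B) = order G"
  proof -
    have "A \<union> B \<subseteq> carrier G" using sub subgroup.subset by blast
    then show ?thesis
      using card_Diff_subset[of "A \<union> B" "carrier G"] card_mono[OF fin, of "A \<union> B"] finite
      by (simp add: order_def)
  qed
  ultimately have T: "card ?T = card ?W" using W4 A B by linarith
  have coset: "inv s \<otimes> u \<in> ?W" if "s \<in> ?T" "u \<in> ?T" for s u
  proof -
    have "s \<otimes> (inv s \<otimes> u) = u" using that by (simp flip: m_assoc)
    then show ?thesis using mem(1)[of s "inv s \<otimes> u"] mem(2)[of s "inv s \<otimes> u"] that by auto
  qed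
  have shift: "s \<otimes> w \<in> ?T" if "s \<in> ?T" "w \<in> ?W" for s w
    using mem(1)[of s w] mem(2)[of s w] that subgroup.mem_carrier[OF sub(1)] by auto
  \<comment> \<open>A nonempty \<open>X \<inter> ?T\<close> lies in a coset of
    \<open>?W \<inter> X\<close>. If \<open>?W \<inter> X\<close> were all of \<open>?W\<close>,
    then \<open>X\<close> would contain \<open>?T\<close> and complete \<open>A \<union> B\<close>
    to a cover.\<close>
  have part: "card (X \<inter> ?T) \<le> card (?W \<inter> X) \<and> 2 * card (?W \<inter> X) \<le> card ?W"
    if X: "subgroup X G" "X \<inter> ?T \<noteq> {}" "A \<union> B \<union> X \<noteq> carrier G" "finite X" for X
  proof
    obtain s where s: "s \<in> X" "s \<in> ?T" using X by blast
    have "X \<inter> ?T \<subseteq> (\<lambda>w. s \<otimes> w) ` (?W \<inter> X)"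
    proof
      fix u assume u: "u \<in> X \<inter> ?T"
      have "inv s \<otimes> u \<in> ?W \<inter> X"
        using coset[of s u] s u subgroup.m_closed[OF X(1)] subgroup.m_inv_closed[OF X(1)] by blast
      moreover have "u = s \<otimes> (inv s \<otimes> u)" using s u by (simp flip: m_assoc)
      ultimately show "u \<in> (\<lambda>w. s \<otimes> w) ` (?W \<inter> X)" by blast
    qed
    then have "card (X \<inter> ?T) \<le> card ((\<lambda>w. s \<otimes> w) ` (?W \<inter> X))" using finite by (intro card_mono) auto
    also have "\<dots> \<le> card (?W \<inter> X)" using finite by (intro card_image_le) auto
    finally show "card (X \<inter> ?T) \<le> card (?W \<inter> X)" .
    have "?W \<inter> X \<noteq> ?W"
    proof
      assume "?W \<inter> X = ?W"
      then have WX: "?W \<subseteq> X" by blast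
      have "?T \<subseteq> X"
      proof
        fix u assume u: "u \<in> ?T"
        have "s \<otimes> (inv s \<otimes> u) \<in> X" using coset[OF s(2) u] WX s subgroup.m_closed[OF X(1)] by blast
        then show "u \<in> X" using s u by (simp flip: m_assoc)
      qed
      then show False using X(3) subgroup.subset[OF X(1)] subgroup.subset[OF sub(1)] subgroup.subset[OF sub(2)] by blast
    qed
    then show "2 * card (?W \<inter> X) \<le> card ?W"
      using double_card_le_of_psubset[of "?W \<inter> X" ?W] W X(1) subgroups_Inter_pair finite by blast
  qed
  have neC: "C \<inter> ?T \<noteq> {}" and neE: "E \<inter> ?T \<noteq> {}"
    using cov ne subgroup.subset[OF sub(1)] subgroup.subset[OF sub(2)]
      subgroup.subset[OF sub(3)] subgroup.subset[OF sub(4)] by blast+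
  note pC = part[OF sub(3) neC ne(1) finite(3)] and pE = part[OF sub(4) neE ne(2) finite(4)]
  have TCE: "?T = (C \<inter> ?T) \<union> (E \<inter> ?T)" using cov by blast
  have "card ((C \<inter> ?T) \<union> (E \<inter> ?T)) + card ((C \<inter> ?T) \<inter> (E \<inter> ?T)) = card (C \<inter> ?T) + card (E \<inter> ?T)"
    using finite by (intro card_Un_Int[symmetric]) auto
  then have eq: "card ?T + card ((C \<inter> ?T) \<inter> (E \<inter> ?T)) = card (C \<inter> ?T) + card (E \<inter> ?T)"
    using TCE by simp
  show "2 * card (?W \<inter> C) = card ?W" using eq pC pE T by linarith
  have "card ((C \<inter> ?T) \<inter> (E \<inter> ?T)) = 0" using eq pC pE T by linarith
  then have disj: "C \<inter> E \<inter> ?T = {}" using finite by (simp add: Int_ac) 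
  \<comment> \<open>Translating a point \<open>s\<close> of \<open>Y\<close> in \<open>?T\<close> by
    \<open>a\<close> stays in \<open>?T\<close> and avoids \<open>X\<close>, since otherwise
    \<open>s\<close> itself would lie in both \<open>X\<close> and \<open>Y\<close>. So the
    translate is in \<open>Y\<close>, and with it \<open>a\<close>.\<close>
  have half: "?W \<inter> X \<subseteq> Y" if h: "subgroup X G" "subgroup Y G" "A \<union> B \<union> X \<union> Y = carrier G"
    "Y \<inter> ?T \<noteq> {}" "X \<inter> Y \<inter> ?T = {}" for X Y
  proof
    fix a assume a: "a \<in> ?W \<inter> X"
    obtain s where s: "s \<in> Y" "s \<in> ?T" using h(4) by blast
    have ac: "a \<in> carrier G" using a subgroup.mem_carrier[OF h(1)] by blast
    have "s \<otimes> a \<in> ?T" using shift s a by blast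
    moreover have "s \<otimes> a \<notin> X"
    proof
      assume "s \<otimes> a \<in> X"
      then have "(s \<otimes> a) \<otimes> inv a \<in> X" using a subgroup.m_closed[OF h(1)] subgroup.m_inv_closed[OF h(1)] by blast
      then have "s \<in> X" using s ac by (simp add: m_assoc)
      then show False using h(5) s by blast
    qed
    ultimately have "s \<otimes> a \<in> Y" using h(3) by blast
    then have "inv s \<otimes> (s \<otimes> a) \<in> Y" using s subgroup.m_closed[OF h(2)] subgroup.m_inv_closed[OF h(2)] by blast
    then show "a \<in> Y" using s ac by (simp flip: m_assoc)
  qed
  have "?W \<inter> C \<subseteq> E" using half[OF sub(3,4) cov neE disj] .
  moreover have "?W \<inter> E \<subseteq> C" using half[OF sub(4,3) _ neC] cov disj by (simp add: Int_ac Un_ac)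
  ultimately show "?W \<inter> C = ?W \<inter> E" by blast
qed

end

section \<open>Subrings of index two\<close>

text \<open>A unital homomorphism to F_2 with truth values as elements, \<open>\<noteq>\<close> as
  addition and conjunction as product, so that identities become propositional.\<close>

definition bool_hom :: "('a, 'm) ring_scheme \<Rightarrow> ('a \<Rightarrow> bool) \<Rightarrow> bool" where
  "bool_hom R \<phi> \<longleftrightarrow> \<phi> \<one>\<^bsub>R\<^esub> \<and> (\<forall>x\<in>carrier R. \<forall>y\<in>carrier R.
     \<phi> (x \<oplus>\<^bsub>R\<^esub> y) = (\<phi> x \<noteq> \<phi> y) \<and> \<phi> (x \<otimes>\<^bsub>R\<^esub> y) = (\<phi> x \<and> \<phi> y))"

text \<open>The tuple \<open>(a, b, c, d)\<close> is the matrix with rows \<open>(a, b)\<close> and \<open>(c, d)\<close>.\<close>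

definition M2_bool :: "(bool \<times> bool \<times> bool \<times> bool) ring" where
  "M2_bool = \<lparr>carrier = UNIV,
     monoid.mult = (\<lambda>(a, b, c, d) (a', b', c', d').
       ((a \<and> a') \<noteq> (b \<and> c'), (a \<and> b') \<noteq> (b \<and> d'), (c \<and> a') \<noteq> (d \<and> c'), (c \<and> b') \<noteq> (d \<and> d'))),
     one = (True, False, False, True), zero = (False, False, False, False),
     add = (\<lambda>(a, b, c, d) (a', b', c', d'). (a \<noteq> a', b \<noteq> b', c \<noteq> c', d \<noteq> d'))\<rparr>"

lemma ring_M2_bool: "ring M2_bool"
  by (intro ringI abelian_groupI monoidI) (auto simp: M2_bool_def)

text \<open>\<open>\<delta>\<close> is the indicator of the complement of a unital subring of index
  2; the index is expressed by \<open>add_bool\<close> together with \<open>w\<close>, which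
  represents the other coset.\<close>

locale index_two_subring = ring +
  fixes \<delta> :: "'a \<Rightarrow> bool" and w
  assumes add_bool: "\<lbrakk>x \<in> carrier R; y \<in> carrier R\<rbrakk> \<Longrightarrow> \<delta> (x \<oplus> y) = (\<delta> x \<noteq> \<delta> y)"
    and mult_bool: "\<lbrakk>x \<in> carrier R; y \<in> carrier R; \<not> \<delta> x; \<not> \<delta> y\<rbrakk> \<Longrightarrow> \<not> \<delta> (x \<otimes> y)"
    and one_bool: "\<not> \<delta> \<one>" and w [simp]: "w \<in> carrier R" "\<delta> w"
begin

lemma zero_bool [simp]: "\<not> \<delta> \<zero>"
  using add_bool[of \<zero> \<zero>] by simp

lemma uminus_bool [simp]: "x \<in> carrier R \<Longrightarrow> \<delta> (\<ominus> x) = \<delta> x"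
  using add_bool[of x "\<ominus> x"] by (simp add: r_neg)

text \<open>The \<open>s\<close> for which \<open>s\<close> and \<open>w \<otimes> s\<close> are
  both in \<open>\<delta> = 0\<close> form the largest left ideal there: for \<open>r\<close>
  outside, \<open>r \<ominus> w\<close> lies inside, so \<open>r \<otimes> s\<close> differs from
  \<open>w \<otimes> s\<close> by a product of two elements of \<open>\<delta> = 0\<close>.\<close>

lemma left_ideal_bool:
  assumes "r \<in> carrier R" "s \<in> carrier R" "\<not> \<delta> s" "\<not> \<delta> (w \<otimes> s)"
  shows "\<not> \<delta> (r \<otimes> s)"
proof (cases "\<delta> r")
  case True
  have "r \<otimes> s = w \<otimes> s \<oplus> (r \<ominus> w) \<otimes> s" using assms by (simp add: l_distr minus_eq a_ac r_neg2 r_neg l_minus)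
  moreover have "\<not> \<delta> (r \<ominus> w)" using True assms by (simp add: minus_eq add_bool)
  ultimately show ?thesis using assms by (simp add: add_bool mult_bool)
qed (use assms in \<open>simp add: mult_bool\<close>)

text \<open>Modulo that left ideal every \<open>s\<close> is a combination of \<open>\<one>\<close>
  and \<open>w\<close>. The remainder \<open>s'\<close> lies in the ideal, and expanding the
  vanishing of \<open>\<delta> (r \<otimes> s')\<close> gives the formula.\<close>

lemma mult_formula:
  assumes "r \<in> carrier R" "s \<in> carrier R"
  shows "\<delta> (r \<otimes> s) = (((\<delta> r \<and> \<delta> (w \<otimes> s)) \<noteq> (\<delta> (r \<otimes> w) \<and> \<delta> s)) \<noteq> (\<delta> (w \<otimes> w) \<and> \<delta> r \<and> \<delta> s))"
proof -
  \<comment> \<open>The coefficient of \<open>\<one>\<close>: adding \<open>w\<close> clears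
    \<open>\<delta> s\<close>, and as \<open>\<delta> w\<close> holds, adding \<open>\<one>\<close>
    can then clear \<open>\<delta> (w \<otimes> s)\<close> without disturbing
    \<open>\<delta> s\<close>.\<close>
  define u where "u = (\<delta> (w \<otimes> s) \<noteq> (\<delta> (w \<otimes> w) \<and> \<delta> s))"
  define s' where "s' = s \<oplus> ((if \<delta> s then w else \<zero>) \<oplus> (if u then \<one> else \<zero>))"
  have "s' \<in> carrier R" using assms by (simp add: s'_def)
  moreover have "\<not> \<delta> s'" using assms by (simp add: s'_def add_bool one_bool)
  moreover have "\<not> \<delta> (w \<otimes> s')" using assms by (simp add: s'_def add_bool one_bool r_distr u_def)
  ultimately have "\<not> \<delta> (r \<otimes> s')" using left_ideal_bool assms by blast
  then show ?thesis using assms by (auto simp: s'_def add_bool one_bool r_distr u_def split: if_splits)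
qed

text \<open>The action of \<open>r\<close> on the quotient of \<open>R\<close> by the largest left ideal inside \<open>\<delta> = 0\<close>,
  in the basis \<open>1, w\<close>.\<close>

definition "m11 r = (\<delta> (w \<otimes> r) \<noteq> (\<delta> (w \<otimes> w) \<and> \<delta> r))"
definition "m12 r = (\<delta> (w \<otimes> r \<otimes> w) \<noteq> (\<delta> (w \<otimes> w) \<and> \<delta> (r \<otimes> w)))"
definition "m22 r = \<delta> (r \<otimes> w)"

lemma m_zero: "\<not> m11 \<zero>" "\<not> m12 \<zero>" "\<not> m22 \<zero>"
  by (simp_all add: m11_def m12_def m22_def)

lemma m_one: "m11 \<one>" "\<not> m12 \<one>" "m22 \<one>"
  by (auto simp: m11_def m12_def m22_def one_bool)

lemma m_w: "\<not> m11 w" "m22 w = \<delta> (w \<otimes> w)"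
  by (auto simp: m11_def m22_def)

lemma m_add:
  assumes "r \<in> carrier R" "s \<in> carrier R"
  shows "m11 (r \<oplus> s) = (m11 r \<noteq> m11 s)" "m12 (r \<oplus> s) = (m12 r \<noteq> m12 s)" "m22 (r \<oplus> s) = (m22 r \<noteq> m22 s)"
  using assms by (auto simp: m11_def m12_def m22_def add_bool r_distr l_distr)

text \<open>Matrix multiplication for the rows \<open>(m11, m12)\<close> and
  \<open>(\<delta>, m22)\<close>. The columns are the coordinates of \<open>r\<close> and of
  \<open>r \<otimes> w\<close> in the basis \<open>1\<close>, \<open>w\<close>, which is why
  \<open>\<delta>\<close> itself is the lower left entry.\<close>

lemma m_mult:
  assumes "r \<in> carrier R" "s \<in> carrier R"
  shows "m11 (r \<otimes> s) = ((m11 r \<and> m11 s) \<noteq> (m12 r \<and> \<delta> s))"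
    "m12 (r \<otimes> s) = ((m11 r \<and> m12 s) \<noteq> (m12 r \<and> m22 s))"
    "\<delta> (r \<otimes> s) = ((\<delta> r \<and> m11 s) \<noteq> (m22 r \<and> \<delta> s))"
    "m22 (r \<otimes> s) = ((\<delta> r \<and> m12 s) \<noteq> (m22 r \<and> m22 s))"
  using mult_formula[of r s] mult_formula[of "w \<otimes> r" s] mult_formula[of r "s \<otimes> w"]
    mult_formula[of "w \<otimes> r" "s \<otimes> w"] assms
  unfolding m11_def m12_def m22_def by (simp_all add: m_assoc) argo+

text \<open>Adding multiples of \<open>\<one>\<close> and \<open>w\<close> clears the first column.
  The image of the ring is therefore spanned by the images of \<open>\<one>\<close> and
  \<open>w\<close> and by matrices with only a second column.\<close>

lemma reduce:
  assumes "r \<in> carrier R"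
  obtains l where "l \<in> carrier R" "\<not> \<delta> l" "\<not> m11 l" "m12 l = (m12 r \<noteq> (\<delta> r \<and> m12 w))"
    "m22 l = ((m22 r \<noteq> m11 r) \<noteq> (\<delta> r \<and> m22 w))"
proof
  let ?l = "r \<oplus> ((if m11 r then \<one> else \<zero>) \<oplus> (if \<delta> r then w else \<zero>))"
  show "?l \<in> carrier R" using assms by simp
  show "\<not> \<delta> ?l" "\<not> m11 ?l" "m12 ?l = (m12 r \<noteq> (\<delta> r \<and> m12 w))" "m22 ?l = ((m22 r \<noteq> m11 r) \<noteq> (\<delta> r \<and> m22 w))"
    using assms by (auto simp: add_bool one_bool m_add m_one m_w(1) m_zero)
qed

text \<open>The second columns of matrices with zero first column form a subspace V of the plane
  over F_2, stable under \<open>w\<close>. If V contains (1,0), applying \<open>w\<close> yields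
  (0,1) and the image is everything. If V is a line, it is a common eigenline, and the eigenvalues
  on it and on the quotient are homomorphisms. If V is zero, the image is the algebra generated by
  \<open>w\<close>.\<close>

theorem index_two_subring_cases:
  obtains
    (matrix) h where "h \<in> ring_hom R M2_bool" "h ` carrier R = carrier M2_bool"
  | (two_homs) \<phi> \<psi> r where "bool_hom R \<phi>" "bool_hom R \<psi>" "r \<in> carrier R" "\<phi> r \<noteq> \<psi> r"
  | (derivation) \<phi> where "bool_hom R \<phi>"
      "\<And>r s. r \<in> carrier R \<Longrightarrow> s \<in> carrier R \<Longrightarrow> \<delta> (r \<otimes> s) = ((\<phi> r \<and> \<delta> s) \<noteq> (\<delta> r \<and> \<phi> s))"
  | (GF4) h where "h \<in> ring_hom R GF4" "h ` carrier R = carrier GF4"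
      "\<And>r. r \<in> carrier R \<Longrightarrow> snd (h r) = \<delta> r"
proof -
  let ?L = "\<lambda>l p q. l \<in> carrier R \<and> \<not> \<delta> l \<and> \<not> m11 l \<and> m12 l = p \<and> m22 l = q"
  have add: "?L (l \<oplus> l') (p \<noteq> p') (q \<noteq> q')" if "?L l p q" "?L l' p' q'" for l l' p q p' q'
    using that by (auto simp: add_bool m_add)
  have wL: "?L (w \<otimes> l) (m12 w \<and> q) (p \<noteq> (m22 w \<and> q))" if "?L l p q" for l p q
    using that by (auto simp: m_mult m_w(1))
  consider l where "?L l True False"
    | l where "?L l False True" "\<And>l. \<not> ?L l True False"
    | l where "?L l True True" "\<And>l. \<not> ?L l True False" "\<And>l. \<not> ?L l False True"
    | "\<And>l p q. ?L l p q \<Longrightarrow> \<not> p \<and> \<not> q"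
    by (metis (full_types))
  then show thesis
  proof cases
    case (1 l)
    define h where "h r = (m11 r, m12 r, \<delta> r, m22 r)" for r
    have "h \<in> ring_hom R M2_bool"
      by (rule ring_hom_memI)
        (auto simp: h_def M2_bool_def m_add m_mult add_bool one_bool m_one)
    moreover have "(a, b, c, d) \<in> h ` carrier R" for a b c d
    proof -
      define p where "p = (b \<noteq> (c \<and> m12 w))"
      define q where "q = ((d \<noteq> a) \<noteq> (c \<and> m22 w))"
      let ?r = "((if a then \<one> else \<zero>) \<oplus> (if c then w else \<zero>)) \<oplus> ((if p then l else \<zero>) \<oplus> (if q then w \<otimes> l else \<zero>))"
      have "?r \<in> carrier R" using 1 by simp
      moreover have "h ?r = (a, b, c, d)"
        using 1 wL[OF 1] by (auto simp: h_def m_add m_one m_zero m_w(1) add_bool one_bool p_def q_def)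
      ultimately show ?thesis by (metis imageI)
    qed
    then have "h ` carrier R = carrier M2_bool" by (auto simp: M2_bool_def)
    ultimately show thesis by (rule matrix)
  next
    case (2 l)
    have "?L (l \<oplus> w \<otimes> l) (m12 w) (\<not> m22 w)" "?L (w \<otimes> l) (m12 w) (m22 w)"
      using add[OF 2(1) wL[OF 2(1)]] wL[OF 2(1)] by simp_all
    then have u: "\<not> m12 w" using 2(2) by (metis (full_types))
    have m12: "\<not> m12 r" if r: "r \<in> carrier R" for r
    proof
      assume "m12 r"
      with reduce[OF r] u obtain l' where l': "?L l' True (m22 l')" by (metis (full_types))
      show False
      proof (cases "m22 l'")
        case True
        then have "?L (l \<oplus> l') True False" using add[OF 2(1) l'] by simp
        then show False using 2(2) by blast
      next
        case False
        then show False using 2(2)[of l'] l' by simp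
      qed
    qed
    \<comment> \<open>The image is lower triangular, so its diagonal entries are
      multiplicative.\<close>
    have "bool_hom R m11" "bool_hom R m22"
      by (auto simp: bool_hom_def m_add m_one m_mult m12)
    moreover have "m11 l \<noteq> m22 l" "l \<in> carrier R" using 2 by auto
    ultimately show thesis using two_homs by blast
  next
    case (3 l)
    have "?L (w \<otimes> l) (m12 w) (\<not> m22 w)" using wL[OF 3(1)] by simp
    then have u: "m12 w = (\<not> m22 w)" using 3(2,3) by (metis (full_types))
    have m: "m22 r = ((m11 r \<noteq> m12 r) \<noteq> \<delta> r)" if r: "r \<in> carrier R" for r
    proof (rule reduce[OF r])
      fix l' assume "l' \<in> carrier R" "\<not> \<delta> l'" "\<not> m11 l'" "m12 l' = (m12 r \<noteq> (\<delta> r \<and> m12 w))"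
        "m22 l' = ((m22 r \<noteq> m11 r) \<noteq> (\<delta> r \<and> m22 w))"
      moreover from this have "m12 l' = m22 l'" using 3(2,3) by (metis (full_types))
      ultimately show ?thesis using u by (metis (full_types))
    qed
    \<comment> \<open>The column (1,1) is a common eigenvector with eigenvalue
      \<open>\<phi>\<close>; the trace minus \<open>\<phi>\<close> is \<open>\<psi>\<close>, the
      eigenvalue on the quotient.\<close>
    define \<phi> where "\<phi> r = (m11 r \<noteq> m12 r)" for r
    define \<psi> where "\<psi> r = (m22 r \<noteq> m12 r)" for r
    have "bool_hom R \<phi>" "bool_hom R \<psi>"
      by (auto simp: bool_hom_def \<phi>_def \<psi>_def m_add m_one m_mult add_bool one_bool m)
    moreover have "\<phi> l \<noteq> \<psi> l" "l \<in> carrier R" using 3 by (auto simp: \<phi>_def \<psi>_def)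
    ultimately show thesis using two_homs by blast
  next
    case 4
    have "m12 r = (\<delta> r \<and> m12 w) \<and> m22 r = (m11 r \<noteq> (\<delta> r \<and> m22 w))" if r: "r \<in> carrier R" for r
      using reduce[OF r] 4 by (smt (verit))
    then obtain u v where m: "\<And>r. r \<in> carrier R \<Longrightarrow> m12 r = (\<delta> r \<and> u)"
      "\<And>r. r \<in> carrier R \<Longrightarrow> m22 r = (m11 r \<noteq> (\<delta> r \<and> v))" by blast
    \<comment> \<open>The image of \<open>w\<close> satisfies \<open>w^2 = v w + u\<close>. Over F_2
      this equation has a double root if \<open>v\<close> fails, two roots if only \<open>v\<close>
      holds and none if both hold; the image is then the dual numbers, F_2 x F_2 or F_4.\<close>
    show thesis
    proof (cases "v")
      case False
      \<comment> \<open>In the image \<open>w + u\<close> squares to zero, and \<open>r\<close> is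
        \<open>\<phi> r\<close> plus \<open>\<delta> r\<close> times this nilpotent element.\<close>
      define \<phi> where "\<phi> r = (m11 r \<noteq> (\<delta> r \<and> u))" for r
      have "bool_hom R \<phi>"
        using False by (auto simp: bool_hom_def \<phi>_def m_add m_one m_mult add_bool one_bool m)
      moreover have "\<delta> (r \<otimes> s) = ((\<phi> r \<and> \<delta> s) \<noteq> (\<delta> r \<and> \<phi> s))" if "r \<in> carrier R" "s \<in> carrier R" for r s
        using that False by (auto simp: \<phi>_def m_mult m)
      ultimately show thesis by (rule derivation)
    next
      case t: True
      show thesis
      proof (cases "u")
        case False
        define \<psi> where "\<psi> r = (m11 r \<noteq> \<delta> r)" for r
        have "bool_hom R m11" "bool_hom R \<psi>"
          using False t by (auto simp: bool_hom_def \<psi>_def m_add m_one m_mult add_bool one_bool m)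
        moreover have "m11 w \<noteq> \<psi> w" by (simp add: \<psi>_def)
        ultimately show thesis using two_homs w(1) by blast
      next
        case True
        define h where "h r = (m11 r, \<delta> r)" for r
        have "h \<in> ring_hom R GF4"
          by (rule ring_hom_memI)
            (use t True in \<open>auto simp: h_def GF4_def m_add m_one m_mult add_bool one_bool m\<close>)
        moreover have "(a, b) \<in> h ` carrier R" for a b
        proof -
          let ?r = "(if a then \<one> else \<zero>) \<oplus> (if b then w else \<zero>)"
          have "?r \<in> carrier R" by simp
          moreover have "h ?r = (a, b)"
            by (auto simp: h_def m_add m_one m_zero m_w(1) add_bool one_bool)
          ultimately show ?thesis by (metis imageI)
        qed
        then have "h ` carrier R = carrier GF4" by (auto simp: GF4_def)
        ultimately show thesis by (rule GF4) (simp add: h_def)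
      qed
    qed
  qed
qed

end

section \<open>Covers by three or four subrings\<close>

lemma covering_number_le_3:
  assumes "proper_subring A R" "proper_subring B R" "proper_subring C R" "A \<union> B \<union> C = carrier R"
  shows "covering_number R \<le> enat 3"
proof -
  have "covering_number R \<le> enat (card {A, B, C})"
    using assms by (intro covering_number_le) auto
  also have "\<dots> \<le> enat 3" by (simp add: card_insert_if)
  finally show ?thesis .
qed

lemma covering_number_le_4:
  assumes "proper_subring A R" "proper_subring B R" "proper_subring C R" "proper_subring E R"
    "A \<union> B \<union> C \<union> E = carrier R"
  shows "covering_number R \<le> enat 4"
proof -
  have "covering_number R \<le> enat (card {A, B, C, E})"
    using assms by (intro covering_number_le) auto
  also have "\<dots> \<le> enat 4" by (simp add: card_insert_if)
  finally show ?thesis .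
qed

lemma (in ring) proper_subring_CollectI:
  assumes add: "\<And>x y. x \<in> carrier R \<Longrightarrow> y \<in> carrier R \<Longrightarrow> \<delta> (x \<oplus> y) = (\<delta> x \<noteq> \<delta> y)"
    and mult: "\<And>x y. x \<in> carrier R \<Longrightarrow> y \<in> carrier R \<Longrightarrow> \<not> \<delta> x \<Longrightarrow> \<not> \<delta> y \<Longrightarrow> \<not> \<delta> (x \<otimes> y)"
    and w: "w \<in> carrier R" "\<delta> w"
  shows "proper_subring {x \<in> carrier R. \<not> \<delta> x} R"
proof -
  have zero: "\<not> \<delta> \<zero>" using add[of \<zero> \<zero>] by simp
  moreover have "\<delta> (\<ominus> x) = \<delta> x" if "x \<in> carrier R" for x
    using add[of x "\<ominus> x"] that zero by (simp add: r_neg)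
  ultimately have "nonunital_subring {x \<in> carrier R. \<not> \<delta> x} R"
    by (intro nonunital_subringI) (auto simp: add mult)
  then show ?thesis using w by (auto simp: proper_subring_def)
qed

text \<open>In F_2 one of \<open>\<phi> x\<close>, \<open>\<psi> x\<close> and their sum always
  vanishes, so the two kernels and the set where the homomorphisms agree cover the ring.\<close>

lemma (in ring) covering_number_le_3_two_homs:
  assumes "bool_hom R \<phi>" "bool_hom R \<psi>" "r \<in> carrier R" "\<phi> r \<noteq> \<psi> r"
  shows "covering_number R \<le> enat 3"
proof (rule covering_number_le_3)
  show "proper_subring {x \<in> carrier R. \<not> \<phi> x} R" "proper_subring {x \<in> carrier R. \<not> \<psi> x} R"
    by (rule proper_subring_CollectI[where w = \<one>]; use assms in \<open>simp add: bool_hom_def\<close>)+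
  show "proper_subring {x \<in> carrier R. \<not> (\<phi> x \<noteq> \<psi> x)} R"
    by (rule proper_subring_CollectI[where w = r]; use assms in \<open>auto simp: bool_hom_def\<close>)
qed auto

definition bool_derivation :: "('a, 'm) ring_scheme \<Rightarrow> ('a \<Rightarrow> bool) \<Rightarrow> ('a \<Rightarrow> bool) \<Rightarrow> bool" where
  "bool_derivation R \<phi> \<delta> \<longleftrightarrow> (\<forall>x\<in>carrier R. \<forall>y\<in>carrier R.
     \<delta> (x \<oplus>\<^bsub>R\<^esub> y) = (\<delta> x \<noteq> \<delta> y) \<and> \<delta> (x \<otimes>\<^bsub>R\<^esub> y) = ((\<phi> x \<and> \<delta> y) \<noteq> (\<delta> x \<and> \<phi> y)))"

text \<open>Derivations over the same \<open>\<phi>\<close> can be added, so the argument for two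
  homomorphisms applies to \<open>\<delta>\<close>, \<open>\<delta>'\<close> and their sum.\<close>

lemma (in ring) covering_number_le_3_two_derivations:
  assumes "bool_derivation R \<phi> \<delta>" "bool_derivation R \<phi> \<delta>'"
    and "u \<in> carrier R" "\<delta> u" "v \<in> carrier R" "\<delta>' v" "r \<in> carrier R" "\<delta> r \<noteq> \<delta>' r"
  shows "covering_number R \<le> enat 3"
proof (rule covering_number_le_3)
  show "proper_subring {x \<in> carrier R. \<not> \<delta> x} R"
    by (rule proper_subring_CollectI[where w = u]; use assms in \<open>simp add: bool_derivation_def\<close>)
  show "proper_subring {x \<in> carrier R. \<not> \<delta>' x} R"
    by (rule proper_subring_CollectI[where w = v]; use assms in \<open>simp add: bool_derivation_def\<close>)
  show "proper_subring {x \<in> carrier R. \<not> (\<delta> x \<noteq> \<delta>' x)} R"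
    by (rule proper_subring_CollectI[where w = r]; use assms in \<open>auto simp: bool_derivation_def\<close>)
qed auto

text \<open>The cover consists of the stabilizers of the three lines of the plane over F_2 and the
  copy of F_4 spanned by the identity and the matrix with rows (0,1) and (1,1). A matrix without an
  eigenline is one of the two roots of \<open>x^2 + x + 1\<close>, and both lie in that
  copy.\<close>

lemma covering_number_M2_bool: "covering_number M2_bool \<le> enat 4"
proof -
  interpret ring M2_bool by (rule ring_M2_bool)
  have neg: "\<ominus>\<^bsub>M2_bool\<^esub> x = x" for x
    by (rule minus_equality) (auto simp: M2_bool_def split: prod.splits)
  show ?thesis
  proof (rule covering_number_le_4)
    show "proper_subring {(a, b, c, d). \<not> c} M2_bool"
      unfolding proper_subring_def by (intro conjI nonunital_subringI; (unfold neg)?; auto simp: set_eq_iff M2_bool_def)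
    show "proper_subring {(a, b, c, d). \<not> b} M2_bool"
      unfolding proper_subring_def by (intro conjI nonunital_subringI; (unfold neg)?; auto simp: set_eq_iff M2_bool_def)
    show "proper_subring {(a, b, c, d). (a \<noteq> b) = (c \<noteq> d)} M2_bool"
      unfolding proper_subring_def by (intro conjI nonunital_subringI; (unfold neg)?; auto simp: set_eq_iff M2_bool_def)
    show "proper_subring {(a, b, c, d). c = b \<and> d = (a \<noteq> b)} M2_bool"
      unfolding proper_subring_def by (intro conjI nonunital_subringI; (unfold neg)?; auto simp: set_eq_iff M2_bool_def)
  qed (auto simp: M2_bool_def)
qed

lemma ring_GF4: "ring GF4"
  using is_GF_GF4 unfolding is_GF_def field_def domain_def cring_def by blast

text \<open>A pair with a component in F_2 lies in one of the first two subrings. Otherwise both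
  components are among the two elements outside F_2, and the pair lies on the graph of the identity
  or of the Frobenius map.\<close>

lemma covering_number_GF4_GF4: "covering_number (RDirProd GF4 GF4) \<le> enat 4"
proof -
  interpret ring "RDirProd GF4 GF4" using RDirProd_ring[OF ring_GF4 ring_GF4] .
  let ?Q = "RDirProd GF4 GF4"
  have ops: "carrier ?Q = UNIV" "\<zero>\<^bsub>?Q\<^esub> = ((False, False), (False, False))"
    "((a, b), (c, d)) \<oplus>\<^bsub>?Q\<^esub> ((a', b'), (c', d')) = ((a \<noteq> a', b \<noteq> b'), (c \<noteq> c', d \<noteq> d'))"
    "((a, b), (c, d)) \<otimes>\<^bsub>?Q\<^esub> ((a', b'), (c', d')) =
       (((a \<and> a') \<noteq> (b \<and> b'), ((a \<and> b') \<noteq> (b \<and> a')) \<noteq> (b \<and> b')),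
        ((c \<and> c') \<noteq> (d \<and> d'), ((c \<and> d') \<noteq> (d \<and> c')) \<noteq> (d \<and> d')))" for a b c d a' b' c' d'
    by (simp_all add: RDirProd_def DirProd_def monoid.defs GF4_def)
  have neg: "\<ominus>\<^bsub>RDirProd GF4 GF4\<^esub> x = x" for x
    by (rule minus_equality; cases x; cases "fst x"; cases "snd x") (auto simp: ops)
  show ?thesis
  proof (rule covering_number_le_4)
    show "proper_subring {((a, b), c, d). \<not> b} (RDirProd GF4 GF4)"
      unfolding proper_subring_def by (intro conjI nonunital_subringI; (unfold neg)?; auto simp: set_eq_iff ops)
    show "proper_subring {((a, b), c, d). \<not> d} (RDirProd GF4 GF4)"
      unfolding proper_subring_def by (intro conjI nonunital_subringI; (unfold neg)?; auto simp: set_eq_iff ops)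
    show "proper_subring {((a, b), c, d). a = c \<and> b = d} (RDirProd GF4 GF4)"
      unfolding proper_subring_def by (intro conjI nonunital_subringI; (unfold neg)?; auto simp: set_eq_iff ops)
    show "proper_subring {((a, b), c, d). c = (a \<noteq> b) \<and> b = d} (RDirProd GF4 GF4)"
      unfolding proper_subring_def by (intro conjI nonunital_subringI; (unfold neg)?; auto simp: set_eq_iff ops)
  qed (auto simp: ops)
qed

text \<open>\<open>h'\<close> factors through \<open>h\<close> by an automorphism of F_4. Both
  automorphisms preserve the second coordinate.\<close>

lemma ring_hom_GF4_factor:
  fixes R (structure)
  assumes "ring R" and h: "h \<in> ring_hom R GF4" "h ` carrier R = carrier GF4"
    and h': "h' \<in> ring_hom R GF4"
    and ker: "\<And>k. k \<in> carrier R \<Longrightarrow> h k = (False, False) \<Longrightarrow> h' k = (False, False)"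
    and r: "r \<in> carrier R"
  shows "snd (h' r) = snd (h r)"
proof -
  interpret R: ring R by fact
  interpret G: ring GF4 by (rule ring_GF4)
  have GF4: "(a, b) \<oplus>\<^bsub>GF4\<^esub> (c, d) = (a \<noteq> c, b \<noteq> d)"
    "(a, b) \<otimes>\<^bsub>GF4\<^esub> (c, d) = ((a \<and> c) \<noteq> (b \<and> d), ((a \<and> d) \<noteq> (b \<and> c)) \<noteq> (b \<and> d))"
    "\<one>\<^bsub>GF4\<^esub> = (True, False)" "\<zero>\<^bsub>GF4\<^esub> = (False, False)" for a b c d
    by (simp_all add: GF4_def)
  note hs = ring_hom_add[OF h(1)] ring_hom_mult[OF h(1)] ring_hom_one[OF h(1)] GF4
  note hs' = ring_hom_add[OF h'] ring_hom_mult[OF h'] ring_hom_one[OF h'] GF4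
  have "(False, True) \<in> h ` carrier R" unfolding h(2) by (simp add: GF4_def)
  then obtain w where w: "w \<in> carrier R" "h w = (False, True)" by auto
  let ?b = "\<lambda>p x. if p then x else \<zero>"
  have z: "h \<zero> = (False, False)" "h' \<zero> = (False, False)"
    using ring_hom_zero[OF h(1) R.ring_axioms G.ring_axioms] ring_hom_zero[OF h' R.ring_axioms G.ring_axioms] by (simp_all only: GF4)
  \<comment> \<open>\<open>h w\<close> is a root of \<open>x^2 + x + 1\<close>, so by the hypothesis
    on kernels \<open>h' w\<close> is one too, and F_2 contains none.\<close>
  have "h (w \<otimes> w \<oplus> w \<oplus> \<one>) = (False, False)"
    using w by (simp add: hs)
  then have "h' (w \<otimes> w \<oplus> w \<oplus> \<one>) = (False, False)"
    using w ker by simp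
  then have w': "snd (h' w)" using w by (cases "h' w") (auto simp: hs')
  obtain a b where ab: "h r = (a, b)" by fastforce
  let ?k = "r \<oplus> (?b a \<one> \<oplus> ?b b w)"
  have "h ?k = (False, False)" using w r ab by (cases a; cases b) (simp_all add: hs z)
  then have "h' ?k = (False, False)" using w r ker by simp
  then have "snd (h' r) = b" using w r w' by (cases a; cases b; cases "h' r"; cases "h' w") (auto simp: hs' z)
  then show ?thesis using ab by simp
qed

text \<open>Different second coordinates mean that neither kernel contains the other. An element
  killed by one map but not by the other can be multiplied to reach any value, because F_4 is a
  field; two such elements give any pair.\<close>

lemma ring_hom_GF4_pair_surj:
  fixes R (structure)
  assumes "ring R" and h: "h \<in> ring_hom R GF4" "h ` carrier R = carrier GF4"
    and h': "h' \<in> ring_hom R GF4" "h' ` carrier R = carrier GF4"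
    and ne: "r \<in> carrier R" "snd (h r) \<noteq> snd (h' r)"
  shows "(\<lambda>r. (h r, h' r)) \<in> ring_hom R (RDirProd GF4 GF4)"
    "(\<lambda>r. (h r, h' r)) ` carrier R = carrier (RDirProd GF4 GF4)"
proof -
  interpret R: ring R by fact
  interpret G: field GF4 using is_GF_GF4 by (simp add: is_GF_def)
  show "(\<lambda>r. (h r, h' r)) \<in> ring_hom R (RDirProd GF4 GF4)"
    using h h' by (intro ring_hom_memI)
      (auto simp: RDirProd_def DirProd_def monoid.defs ring_hom_add ring_hom_mult ring_hom_one intro: ring_hom_closed)
  have z: "\<zero>\<^bsub>GF4\<^esub> = (False, False)" by (simp add: GF4_def)
  have one_sided: "\<exists>k\<in>carrier R. g k = \<zero>\<^bsub>GF4\<^esub> \<and> g' k = c"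
    if g: "g \<in> ring_hom R GF4" "g ` carrier R = carrier GF4"
      "g' \<in> ring_hom R GF4" "g' ` carrier R = carrier GF4" "snd (g r) \<noteq> snd (g' r)" for g g' c
  proof -
    obtain k where k: "k \<in> carrier R" "g k = \<zero>\<^bsub>GF4\<^esub>" "g' k \<noteq> \<zero>\<^bsub>GF4\<^esub>"
      using ring_hom_GF4_factor[OF assms(1) g(1-3) _ ne(1)] g(5) unfolding z by blast
    have gk: "g' k \<in> Units GF4" using k g ring_hom_closed[OF g(3)] by (simp add: G.field_Units)
    have "c \<otimes>\<^bsub>GF4\<^esub> inv\<^bsub>GF4\<^esub> g' k \<in> carrier GF4" by (simp add: GF4_def)
    then obtain s where s: "s \<in> carrier R" "g' s = c \<otimes>\<^bsub>GF4\<^esub> inv\<^bsub>GF4\<^esub> g' k" unfolding g(4)[symmetric] by auto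
    have "c \<in> carrier GF4" by (simp add: GF4_def)
    then have "g' (s \<otimes> k) = c"
      using s k g gk by (simp add: ring_hom_mult G.m_assoc G.Units_closed)
    moreover have "g (s \<otimes> k) = \<zero>\<^bsub>GF4\<^esub>"
      using s k g ring_hom_closed[OF g(1)] by (simp add: ring_hom_mult)
    ultimately show ?thesis using s k by blast
  qed
  have pair: "(a, b) \<in> (\<lambda>r. (h r, h' r)) ` carrier R" for a b
  proof -
    obtain k where k: "k \<in> carrier R" "h k = \<zero>\<^bsub>GF4\<^esub>" "h' k = b" using one_sided[OF h h' ne(2)] by blast
    obtain l where l: "l \<in> carrier R" "h' l = \<zero>\<^bsub>GF4\<^esub>" "h l = a" using one_sided[OF h' h] ne(2) by blast
    have "a \<in> carrier GF4" "b \<in> carrier GF4" by (simp_all add: GF4_def)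
    then have "h (k \<oplus> l) = a" "h' (k \<oplus> l) = b" using k l h h' by (simp_all add: ring_hom_add)
    then show ?thesis using k l by (intro image_eqI[where x = "k \<oplus> l"]) auto
  qed
  have "UNIV = (\<lambda>r. (h r, h' r)) ` carrier R"
    by (rule UNIV_eq_I) (use pair prod.collapse in metis)
  moreover have "UNIV = carrier (RDirProd GF4 GF4)"
    by (simp add: RDirProd_def DirProd_def monoid.defs GF4_def)
  ultimately show "(\<lambda>r. (h r, h' r)) ` carrier R = carrier (RDirProd GF4 GF4)" by (rule trans[OF sym])
qed

section \<open>The kinds of index two subrings and the case of even order\<close>

lemma in_S_4_coverE:
  assumes "in_S 4 R"
  obtains A B C E where "distinct [A, B, C, E]"
    "proper_subring A R" "proper_subring B R" "proper_subring C R" "proper_subring E R"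
    "A \<union> B \<union> C \<union> E = carrier R"
proof -
  have "covering_number R = enat 4" using assms by (simp add: in_S_def)
  then obtain Y where Y: "finite Y" "card Y = 4" "\<And>S. S \<in> Y \<Longrightarrow> proper_subring S R" "\<Union>Y = carrier R"
    using covering_number_attained by metis
  obtain xs where xs: "set xs = Y" "distinct xs" using finite_distinct_list[OF Y(1)] by blast
  then have "length xs = 4" using Y(2) distinct_card by metis
  then obtain A B C E where "xs = [A, B, C, E]"
    by (auto simp: numeral_eq_Suc length_Suc_conv)
  then show thesis using that[of A B C E] xs Y(3,4) by (auto simp: Un_ac)
qed

lemma additive_subgroup_imp_subgroup: "additive_subgroup A R \<Longrightarrow> subgroup A (add_monoid R)"
  by (simp add: additive_subgroup.a_subgroup)

context ring
begin

definition "hom_type S \<longleftrightarrow> (\<exists>\<phi>. bool_hom R \<phi> \<and> S = {x \<in> carrier R. \<not> \<phi> x})"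
definition "derivation_type S \<longleftrightarrow> (\<exists>\<phi> \<delta>. bool_hom R \<phi> \<and> bool_derivation R \<phi> \<delta> \<and> S = {x \<in> carrier R. \<not> \<delta> x})"
definition "GF4_type S \<longleftrightarrow> (\<exists>h. h \<in> ring_hom R GF4 \<and> h ` carrier R = carrier GF4 \<and>
  S = {x \<in> carrier R. \<not> snd (h x)})"

text \<open>A unital \<open>S\<close> falls under the case analysis above, two of whose outcomes are
  excluded by hypothesis. If \<open>S\<close> misses \<open>\<one>\<close>, closure of
  \<open>S\<close> under products of \<open>x\<close> or \<open>x \<oplus> \<one>\<close> with
  \<open>y\<close> or \<open>y \<oplus> \<one>\<close> makes \<open>\<delta>\<close>
  multiplicative.\<close>

lemma index_two_subring_types:
  assumes fin: "finite (carrier R)" and S: "proper_subring S R" "2 * card S = order R"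
    and no3: "\<not> covering_number R \<le> enat 3"
    and noM2: "\<And>h. h \<in> ring_hom R M2_bool \<Longrightarrow> h ` carrier R \<noteq> carrier M2_bool"
  shows "hom_type S \<or> derivation_type S \<or> GF4_type S"
proof -
  define \<delta> where "\<delta> = (\<lambda>x. x \<notin> S)"
  have nS: "nonunital_subring S R" "S \<noteq> carrier R" using S by (auto simp: proper_subring_def)
  interpret S: additive_subgroup S R using nS(1) nonunital_subringD by blast
  have add: "\<delta> (x \<oplus> y) = (\<delta> x \<noteq> \<delta> y)" if "x \<in> carrier R" "y \<in> carrier R" for x y
    using add.index_two_mult_mem[OF _ S.a_subgroup, of x y] that fin S(2) by (auto simp: \<delta>_def order_def)
  have mult: "\<not> \<delta> (x \<otimes> y)" if "\<not> \<delta> x" "\<not> \<delta> y" for x y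
    using that nonunital_subringD(2)[OF nS(1)] by (simp add: \<delta>_def)
  have Sd: "S = {x \<in> carrier R. \<not> \<delta> x}" using S.a_subset by (auto simp: \<delta>_def)
  show ?thesis
  proof (cases "\<one> \<in> S")
    case False
    then have one: "\<delta> \<one>" by (simp add: \<delta>_def)
    have l: "\<delta> (x \<otimes> y) = (\<delta> x \<and> \<delta> y)" if "x \<in> carrier R" "y \<in> carrier R" for x y
    proof -
      have 1: "\<delta> ((x \<oplus> \<one>) \<otimes> y) = (\<delta> (x \<otimes> y) \<noteq> \<delta> y)" "\<delta> (x \<otimes> (y \<oplus> \<one>)) = (\<delta> (x \<otimes> y) \<noteq> \<delta> x)"
        "\<delta> ((x \<oplus> \<one>) \<otimes> (y \<oplus> \<one>)) = ((\<delta> (x \<otimes> y) \<noteq> \<delta> x) \<noteq> (\<delta> y \<noteq> True))"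
        using that one by (auto simp: l_distr r_distr add)
      have 2: "\<delta> (x \<oplus> \<one>) = (\<not> \<delta> x)" "\<delta> (y \<oplus> \<one>) = (\<not> \<delta> y)" using that one by (simp_all add: add)
      show ?thesis
        using 1 2 mult[of x y] mult[of "x \<oplus> \<one>" y] mult[of x "y \<oplus> \<one>"] mult[of "x \<oplus> \<one>" "y \<oplus> \<one>"] by argo
    qed
    have "bool_hom R \<delta>" using one add l by (simp add: bool_hom_def)
    then show ?thesis using Sd unfolding hom_type_def by blast
  next
    case True
    obtain w where w: "w \<in> carrier R" "\<delta> w" using nS(2) S.a_subset by (auto simp: \<delta>_def)
    interpret index_two_subring R \<delta> w
      by unfold_locales (use add mult w True in \<open>auto simp: \<delta>_def\<close>)
    show ?thesis
    proof (rule index_two_subring_cases)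
      fix \<phi> assume "bool_hom R \<phi>"
        "\<And>r s. r \<in> carrier R \<Longrightarrow> s \<in> carrier R \<Longrightarrow> \<delta> (r \<otimes> s) = ((\<phi> r \<and> \<delta> s) \<noteq> (\<delta> r \<and> \<phi> s))"
      then have "bool_hom R \<phi> \<and> bool_derivation R \<phi> \<delta>" by (simp add: bool_derivation_def add)
      then show ?thesis using Sd unfolding derivation_type_def by blast
    next
      fix h assume "h \<in> ring_hom R GF4" "h ` carrier R = carrier GF4"
        and h: "\<And>r. r \<in> carrier R \<Longrightarrow> snd (h r) = \<delta> r"
      moreover have "S = {x \<in> carrier R. \<not> snd (h x)}" unfolding Sd using h by blast
      ultimately show ?thesis unfolding GF4_type_def by blast
    next
      fix h assume "h \<in> ring_hom R M2_bool" "h ` carrier R = carrier M2_bool"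
      then show ?thesis using noM2 by blast
    next
      fix \<phi> \<psi> r assume "bool_hom R \<phi>" "bool_hom R \<psi>" "r \<in> carrier R" "\<phi> r \<noteq> \<psi> r"
      then show ?thesis using covering_number_le_3_two_homs no3 by blast
    qed
  qed
qed

lemma hom_type_unique:
  assumes "hom_type S" "hom_type T" "\<not> covering_number R \<le> enat 3"
  shows "S = T"
proof -
  obtain \<phi> \<psi> where *: "bool_hom R \<phi>" "S = {x \<in> carrier R. \<not> \<phi> x}" "bool_hom R \<psi>" "T = {x \<in> carrier R. \<not> \<psi> x}"
    using assms unfolding hom_type_def by blast
  then have "\<phi> r = \<psi> r" if "r \<in> carrier R" for r
    using covering_number_le_3_two_homs[of \<phi> \<psi> r] assms(3) that by blast
  then show ?thesis using * by blast
qed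

text \<open>The two homomorphisms must coincide first, since different ones already give a cover by
  three; only then can the derivations be added.\<close>

lemma derivation_type_unique:
  assumes "derivation_type S" "derivation_type T" "\<not> covering_number R \<le> enat 3"
    and "S \<noteq> carrier R" "T \<noteq> carrier R"
  shows "S = T"
proof -
  obtain \<phi> \<psi> \<delta> \<epsilon> where *: "bool_hom R \<phi>" "bool_derivation R \<phi> \<delta>" "S = {x \<in> carrier R. \<not> \<delta> x}"
    "bool_hom R \<psi>" "bool_derivation R \<psi> \<epsilon>" "T = {x \<in> carrier R. \<not> \<epsilon> x}"
    using assms unfolding derivation_type_def by blast
  then have "\<phi> r = \<psi> r" if "r \<in> carrier R" for r
    using covering_number_le_3_two_homs[of \<phi> \<psi> r] assms(3) that by blast
  then have "bool_derivation R \<phi> \<epsilon>" using *(5) by (simp add: bool_derivation_def)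
  moreover obtain u v where "u \<in> carrier R" "\<delta> u" "v \<in> carrier R" "\<epsilon> v" using * assms(4,5) by blast
  ultimately have "\<delta> r = \<epsilon> r" if "r \<in> carrier R" for r
    using covering_number_le_3_two_derivations[of \<phi> \<delta> \<epsilon> u v r] *(2) assms(3) that by blast
  then show ?thesis using * by blast
qed

lemma GF4_type_unique:
  assumes "GF4_type S" "GF4_type T"
    and no: "\<And>h. h \<in> ring_hom R (RDirProd GF4 GF4) \<Longrightarrow> h ` carrier R \<noteq> carrier (RDirProd GF4 GF4)"
  shows "S = T"
proof -
  obtain h g where *: "h \<in> ring_hom R GF4" "h ` carrier R = carrier GF4" "S = {x \<in> carrier R. \<not> snd (h x)}"
    "g \<in> ring_hom R GF4" "g ` carrier R = carrier GF4" "T = {x \<in> carrier R. \<not> snd (g x)}"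
    using assms(1,2) unfolding GF4_type_def by blast
  then have "snd (h r) = snd (g r)" if "r \<in> carrier R" for r
    using ring_hom_GF4_pair_surj[OF ring_axioms *(1,2,4,5) that] no by blast
  then show ?thesis using * by blast
qed

text \<open>The element \<open>e\<close> is a polynomial in \<open>s\<close> without constant term,
  so it lies in every subring that contains \<open>s\<close>.\<close>

lemma separating_element:
  assumes X: "hom_type X \<and> derivation_type Y \<or> hom_type X \<and> GF4_type Y \<or> derivation_type X \<and> GF4_type Y"
    and no3: "\<not> covering_number R \<le> enat 3"
    and s: "s \<in> carrier R" "s \<notin> X" "s \<notin> Y"
  shows "\<exists>e \<in> {s \<otimes> s, s \<otimes> s \<oplus> s, (s \<otimes> s \<oplus> s) \<otimes> s}. (e \<in> X) \<noteq> (e \<in> Y)"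
proof -
  note GF = ring_hom_add ring_hom_mult
  have GF4: "(a, b) \<oplus>\<^bsub>GF4\<^esub> (c, d) = (a \<noteq> c, b \<noteq> d)"
    "(a, b) \<otimes>\<^bsub>GF4\<^esub> (c, d) = ((a \<and> c) \<noteq> (b \<and> d), ((a \<and> d) \<noteq> (b \<and> c)) \<noteq> (b \<and> d))" for a b c d
    by (simp_all add: GF4_def)
  consider "hom_type X" "derivation_type Y" | "hom_type X" "GF4_type Y" | "derivation_type X" "GF4_type Y"
    using X by blast
  then show ?thesis
  proof cases
    case 1
    then obtain \<phi> \<psi> \<delta> where *: "bool_hom R \<phi>" "X = {x \<in> carrier R. \<not> \<phi> x}"
      "bool_hom R \<psi>" "bool_derivation R \<psi> \<delta>" "Y = {x \<in> carrier R. \<not> \<delta> x}"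
      unfolding hom_type_def derivation_type_def by blast
    then have "s \<otimes> s \<notin> X" "s \<otimes> s \<in> Y" using s by (auto simp: bool_hom_def bool_derivation_def)
    then show ?thesis by blast
  next
    case 2
    then obtain \<phi> h where *: "bool_hom R \<phi>" "X = {x \<in> carrier R. \<not> \<phi> x}"
      "h \<in> ring_hom R GF4" "Y = {x \<in> carrier R. \<not> snd (h x)}"
      unfolding hom_type_def GF4_type_def by blast
    obtain a b where ab: "h s = (a, b)" by fastforce
    \<comment> \<open>A homomorphism to F_2 sends \<open>s\<close> to 1 and the product to
      \<open>(1 + 1) 1 = 0\<close>. An element of F_4 outside F_2 satisfies
      \<open>x^2 + x = 1\<close>, so \<open>h\<close> sends the product to
      \<open>h s\<close>.\<close>
    then have "(s \<otimes> s \<oplus> s) \<otimes> s \<in> X" "(s \<otimes> s \<oplus> s) \<otimes> s \<notin> Y"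
      using s * by (auto simp: bool_hom_def GF GF4)
    then show ?thesis by blast
  next
    case 3
    then obtain \<phi> \<delta> h where *: "bool_hom R \<phi>" "bool_derivation R \<phi> \<delta>" "X = {x \<in> carrier R. \<not> \<delta> x}"
      "h \<in> ring_hom R GF4" "Y = {x \<in> carrier R. \<not> snd (h x)}"
      unfolding derivation_type_def GF4_type_def by blast
    obtain a b where ab: "h s = (a, b)" by fastforce
    show ?thesis
    proof (cases "\<phi> s")
      case True
      then have "s \<otimes> s \<oplus> s \<notin> X" "s \<otimes> s \<oplus> s \<in> Y"
        using s * ab by (auto simp: bool_derivation_def GF GF4)
      then show ?thesis by blast
    next
      case False
      then have "s \<otimes> s \<in> X" "s \<otimes> s \<notin> Y"
        using s * ab by (auto simp: bool_derivation_def GF GF4)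
      then show ?thesis by blast
    qed
  qed
qed

end

text \<open>\<open>\<one>\<close>, \<open>s\<close>, \<open>e\<close> and
  \<open>s \<otimes> e\<close> lie in \<open>U\<close> and in four different cosets of
  \<open>X \<inter> Y\<close>, so \<open>U\<close> contains four disjoint translates of
  \<open>X \<inter> Y \<inter> U\<close>.\<close>

lemma (in group) four_card_le_of_separating:
  assumes fin: "finite (carrier G)"
    and X: "subgroup X G" "2 * card X = order G" and Y: "subgroup Y G" "2 * card Y = order G"
    and U: "subgroup U G" and s: "s \<in> U" "s \<notin> X" "s \<notin> Y" and e: "e \<in> U" "(e \<in> X) \<noteq> (e \<in> Y)"
  shows "4 * card (X \<inter> Y \<inter> U) \<le> card U"
proof -
  note mem = index_two_mult_mem[OF fin X] index_two_mult_mem[OF fin Y]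
  have Uc: "\<And>x. x \<in> U \<Longrightarrow> x \<in> carrier G" using subgroup.mem_carrier[OF U] .
  let ?D = "X \<inter> Y \<inter> U" and ?g = "{\<one>, s, e, s \<otimes> e}" and ?f = "\<lambda>(g, d). g \<otimes> d"
  have g: "?g \<subseteq> U" using s e subgroup.m_closed[OF U] subgroup.one_closed[OF U] by blast
  have ones: "\<one> \<in> X" "\<one> \<in> Y" using X(1) Y(1) subgroup.one_closed by auto
  have se: "s \<otimes> e \<in> X \<longleftrightarrow> e \<notin> X" "s \<otimes> e \<in> Y \<longleftrightarrow> e \<notin> Y"
    using mem s e Uc by auto
  have inj_g: "inj_on (\<lambda>x. (x \<in> X, x \<in> Y)) ?g" and "card ?g = 4"
    using ones s e se by (auto simp: inj_on_def card_insert_if)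
  have "inj_on ?f (?g \<times> ?D)"
  proof (rule inj_onI, clarify)
    fix a b c d
    assume a: "a \<in> ?g" "b \<in> ?g" and d: "c \<in> X" "c \<in> Y" "c \<in> U" "d \<in> X" "d \<in> Y" "d \<in> U"
      and eq: "a \<otimes> c = b \<otimes> d"
    have car: "a \<in> carrier G" "b \<in> carrier G" "c \<in> carrier G" "d \<in> carrier G" using a d g Uc by blast+
    have "(a \<in> X, a \<in> Y) = (b \<in> X, b \<in> Y)"
      using mem(1)[of a c] mem(1)[of b d] mem(2)[of a c] mem(2)[of b d] eq d car by simp
    then have "a = b" using inj_onD[OF inj_g _ a] by blast
    then show "a = b \<and> c = d" using eq car by simp
  qed
  then have "card (?g \<times> ?D) = card (?f ` (?g \<times> ?D))" by (simp add: card_image)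
  also have "\<dots> \<le> card U"
    using g subgroup.m_closed[OF U] finite_subset[OF subgroup.subset[OF U] fin] by (intro card_mono) auto
  finally show ?thesis unfolding card_cartesian_product \<open>card ?g = 4\<close> .
qed

theorem in_S_4_order_two_power:
  fixes R (structure)
  assumes S4: "in_S 4 R" and t: "order R = 2 ^ t"
  shows "R \<simeq> RDirProd GF4 GF4 \<or> R \<simeq> M2_bool"
proof (rule ccontr)
  assume "\<not> ?thesis"
  then have no: "\<not> R \<simeq> RDirProd GF4 GF4" "\<not> R \<simeq> M2_bool" by auto
  interpret ring R using S4 by (simp add: in_S_def)
  have fin: "finite (carrier R)" using t by (metis card.infinite order_def power_not_zero zero_neq_numeral)
  have ord: "order (add_monoid R) = order R" by (simp add: order_def)
  note fin' = fin and t' = t[folded ord]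
  have no3: "\<not> covering_number R \<le> enat 3" using S4 by (simp add: in_S_def)
  have noM2: "h ` carrier R \<noteq> carrier M2_bool" if "h \<in> ring_hom R M2_bool" for h
    using in_S_hom_imp_iso[OF S4 ring_M2_bool that _ covering_number_M2_bool] no by blast
  have noG: "h ` carrier R \<noteq> carrier (RDirProd GF4 GF4)" if "h \<in> ring_hom R (RDirProd GF4 GF4)" for h
    using in_S_hom_imp_iso[OF S4 RDirProd_ring[OF ring_GF4 ring_GF4] that _ covering_number_GF4_GF4] no by blast
  note types = index_two_subring_types[OF fin _ _ no3 noM2]
  obtain A B C E where dist: "distinct [A, B, C, E]"
    and proper: "proper_subring A R" "proper_subring B R" "proper_subring C R" "proper_subring E R"
    and cov: "A \<union> B \<union> C \<union> E = carrier R"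
    using in_S_4_coverE[OF S4] .
  have sg: "subgroup S (add_monoid R)" "S \<noteq> carrier R" if "proper_subring S R" for S
    using that additive_subgroup_imp_subgroup nonunital_subringD(1) by (auto simp: proper_subring_def)
  \<comment> \<open>\<open>Q\<close> ranges over the orderings of the cover, so that any members can
    be moved into the leading positions.\<close>
  define Q where "Q X Y U V \<longleftrightarrow> {X, Y, U, V} = {A, B, C, E} \<and> distinct [X, Y, U, V]" for X Y U V
  have perm: "proper_subring X R \<and> proper_subring Y R \<and> proper_subring U R \<and> proper_subring V R \<and>
      X \<union> Y \<union> U \<union> V = carrier R" if "Q X Y U V" for X Y U V
  proof -
    note that = that[unfolded Q_def]
    have "X \<in> {A, B, C, E}" "Y \<in> {A, B, C, E}" "U \<in> {A, B, C, E}" "V \<in> {A, B, C, E}" using that by blast+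
    moreover have "\<forall>Z\<in>{A, B, C, E}. proper_subring Z R" using proper by blast
    moreover have "X \<union> Y \<union> U \<union> V = \<Union>{X, Y, U, V}" "A \<union> B \<union> C \<union> E = \<Union>{A, B, C, E}" by blast+
    ultimately show ?thesis using that cov by (metis (no_types, lifting))
  qed
  have swap: "Q X U Y V" "Q X V Y U" "Q X Y V U" if "Q X Y U V" for X Y U V
  proof -
    have *: "{X, U, Y, V} = {X, Y, U, V}" "{X, V, Y, U} = {X, Y, U, V}" "{X, Y, V, U} = {X, Y, U, V}"
      by (simp_all only: insert_commute)
    from that show "Q X U Y V" "Q X V Y U" "Q X Y V U"
      unfolding Q_def * by (auto simp only: distinct.simps list.set insert_iff empty_iff)
  qed
  \<comment> \<open>\<open>X\<close> and \<open>Y\<close> are of different kinds, so a point of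
    \<open>U\<close> outside both yields a separating element in \<open>U\<close>. Then
    \<open>U\<close> has at least four times the order of \<open>X \<inter> Y \<inter> U\<close>,
    which is an eighth of the order of \<open>R\<close>.\<close>
  have step: "2 * card U = order R"
    if Q: "Q X Y U V" and X: "2 * card X = order R" and Y: "2 * card Y = order R" for X Y U V
  proof -
    note p = perm[OF Q]
    have ne: "X \<noteq> Y" using Q by (auto simp: Q_def)
    have ne3: "X \<union> Y \<union> T \<noteq> carrier R" if "proper_subring T R" for T
      using covering_number_le_3[of X R Y T] p that no3 by blast
    have tX: "hom_type X \<or> derivation_type X \<or> GF4_type X" and tY: "hom_type Y \<or> derivation_type Y \<or> GF4_type Y"
      using types p X Y by blast+
    obtain s where s: "s \<in> U" "s \<notin> X" "s \<notin> Y"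
    proof -
      have "\<not> carrier R \<subseteq> X \<union> Y \<union> V"
        using ne3[of V] p sg(1)[THEN subgroup.subset] by (metis (no_types, lifting) Un_least partial_object.select_convs(1) subset_antisym)
      then obtain s where "s \<in> carrier R" "s \<notin> X \<union> Y \<union> V" by blast
      then show thesis using that p by blast
    qed
    interpret U: additive_subgroup U R using p by (simp add: proper_subring_def nonunital_subringD)
    have U: "nonunital_subring U R" using p by (simp add: proper_subring_def)
    have "hom_type X \<and> derivation_type Y \<or> hom_type X \<and> GF4_type Y \<or> derivation_type X \<and> GF4_type Y \<or>
        hom_type Y \<and> derivation_type X \<or> hom_type Y \<and> GF4_type X \<or> derivation_type Y \<and> GF4_type X"
      using tX tY ne hom_type_unique[of X Y] derivation_type_unique[of X Y] GF4_type_unique[of X Y] no3 noG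
        p unfolding proper_subring_def by blast
    then obtain e where e: "e \<in> {s \<otimes> s, s \<otimes> s \<oplus> s, (s \<otimes> s \<oplus> s) \<otimes> s}" "(e \<in> X) \<noteq> (e \<in> Y)"
      using separating_element[of X Y s] separating_element[of Y X s] no3 s U.a_subset by blast
    then have "e \<in> U" using s nonunital_subringD(2)[OF U] U.a_closed by auto
    then have "4 * card (X \<inter> Y \<inter> U) \<le> card U"
      using add.four_card_le_of_separating[of X Y U s e] fin sg p X Y s e ord by simp
    moreover have "4 * card (X \<inter> Y) = order R" "2 * card (X \<inter> Y \<inter> U) = card (X \<inter> Y)"
      using add.two_index_two_subgroups_cover[of X Y U V] fin sg p X Y ne ne3 ord by simp_all
    ultimately have "order R \<le> 2 * card U" by linarith
    moreover have "2 * card U \<le> order R"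
      using add.card_proper_subgroup[of U 2 t] sg p t' ord fin by auto
    ultimately show ?thesis by simp
  qed
  have some: "2 * card A = order R \<or> 2 * card B = order R \<or> 2 * card C = order R \<or> 2 * card E = order R"
    using add.four_subgroup_cover_order_two_power(1)[of t A B C E] fin t' ord sg proper cov by simp
  have second: "2 * card Y = order R \<or> 2 * card U = order R \<or> 2 * card V = order R"
    if "Q X Y U V" "2 * card X = order R" for X Y U V
    using add.four_subgroup_cover_order_two_power(2)[of t X Y U V] fin t' ord sg perm[OF that(1)] that(2) by simp
  have "\<exists>X Y U V. Q X Y U V \<and> 2 * card X = order R"
  proof -
    have "Q A B C E" "Q B A C E" "Q C A B E" "Q E A B C" using dist unfolding Q_def by auto
    then show ?thesis using some by blast
  qed
  then obtain X Y U V where 1: "Q X Y U V" "2 * card X = order R" by blast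
  have "Q X U Y V" "Q X V Y U" using swap[OF 1(1)] by simp_all
  with second[OF 1] 1(1) have "\<exists>Y U V. Q X Y U V \<and> 2 * card Y = order R" by blast
  then obtain Y U V where Q: "Q X Y U V" and Y: "2 * card Y = order R" by blast
  note X = 1(2)
  note QU = swap(3)[OF Q]
  have "2 * card U = order R" "2 * card V = order R" using step[OF Q X Y] step[OF QU X Y] by auto
  then have types: "hom_type Z \<or> derivation_type Z \<or> GF4_type Z" if "Z \<in> {X, Y, U, V}" for Z
    using that types perm[OF Q] X Y by auto
  have proper': "Z \<noteq> carrier R" if "Z \<in> {X, Y, U, V}" for Z
    using that perm[OF Q] by (auto simp: proper_subring_def)
  \<comment> \<open>Each of the three kinds occurs at most once, whereas all four distinct members
    now have index 2.\<close>
  have unique: "\<not> (hom_type Z \<and> hom_type Z') \<and> \<not> (derivation_type Z \<and> derivation_type Z') \<and>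
      \<not> (GF4_type Z \<and> GF4_type Z')" if "Z \<noteq> Z'" "Z \<in> {X, Y, U, V}" "Z' \<in> {X, Y, U, V}" for Z Z'
    using hom_type_unique[of Z Z', OF _ _ no3] derivation_type_unique[of Z Z', OF _ _ no3 proper' proper']
      GF4_type_unique[of Z Z', OF _ _ noG] that by blast
  have d: "X \<noteq> Y" "X \<noteq> U" "X \<noteq> V" "Y \<noteq> U" "Y \<noteq> V" "U \<noteq> V"
    using Q unfolding Q_def by simp_all
  have m: "X \<in> {X, Y, U, V}" "Y \<in> {X, Y, U, V}" "U \<in> {X, Y, U, V}" "V \<in> {X, Y, U, V}" by simp_all
  show False
    using unique[OF d(1) m(1,2)] unique[OF d(2) m(1,3)] unique[OF d(3) m(1,4)] unique[OF d(4) m(2,3)]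
      unique[OF d(5) m(2,4)] unique[OF d(6) m(3,4)] types[OF m(1)] types[OF m(2)] types[OF m(3)] types[OF m(4)]
    by argo
qed

section \<open>From the Boolean models to arbitrary fields of order two and four\<close>

lemma (in cring) finsum_lessThan_two:
  fixes f :: "nat \<Rightarrow> 'a"
  assumes "f 0 \<in> carrier R" "f 1 \<in> carrier R"
  shows "(\<Oplus>k\<in>{..<2}. f k) = f 0 \<oplus> f 1"
proof -
  have "{..<2::nat} = {1, 0}" by auto
  then show ?thesis using assms by (simp add: Pi_def a_comm)
qed

lemma M2_bool_iso_matrix_ring:
  fixes F (structure)
  assumes "is_GF 2 F"
  shows "M2_bool \<simeq> matrix_ring 2 F"
proof -
  interpret field F using assms by (simp add: is_GF_def)
  have "card (carrier F) = 2" using assms by (simp add: is_GF_def order_def)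
  moreover have "{\<zero>, \<one>} \<subseteq> carrier F" "card {\<zero>, \<one>} = 2" by simp_all
  ultimately have car: "carrier F = {\<zero>, \<one>}"
    by (metis card.infinite card_subset_eq zero_neq_numeral)
  have two: "\<one> \<oplus> \<one> = \<zero>"
  proof -
    have "\<one> \<oplus> \<one> \<in> {\<zero>, \<one>}" unfolding car[symmetric] by simp
    moreover have "\<one> \<oplus> \<one> \<noteq> \<one>" by simp
    ultimately show ?thesis by blast
  qed
  define \<iota> where "\<iota> p = (if p then \<one> else \<zero>)" for p :: bool
  have \<iota>: "\<iota> p \<in> carrier F" "\<iota> True = \<one>" "\<iota> False = \<zero>" "\<iota> p \<oplus> \<iota> q = \<iota> (p \<noteq> q)" "\<iota> p \<otimes> \<iota> q = \<iota> (p \<and> q)" for p q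
    using two by (auto simp: \<iota>_def)
  have inj: "\<iota> p = \<iota> q \<longleftrightarrow> p = q" for p q by (simp add: \<iota>_def)
  define h where "h = (\<lambda>(a, b, c, d). \<lambda>(i, j) \<in> {..<2::nat} \<times> {..<2::nat}.
    \<iota> (if i = 0 then if j = 0 then a else b else if j = 0 then c else d))"
  have lt: "i < 2 \<longleftrightarrow> i = 0 \<or> i = 1" for i :: nat by auto
  have "h \<in> ring_iso M2_bool (matrix_ring 2 F)"
  proof (rule ring_iso_memI)
    show "h x \<in> carrier (matrix_ring 2 F)" for x
      by (auto simp: h_def matrix_ring_def \<iota>(1) split: prod.splits)
    show "h (x \<otimes>\<^bsub>M2_bool\<^esub> y) = h x \<otimes>\<^bsub>matrix_ring 2 F\<^esub> h y" for x y
    proof (rule ext, clarify)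
      fix i j :: nat
      obtain a b c d a' b' c' d' where [simp]: "x = (a, b, c, d)" "y = (a', b', c', d')"
        by (metis prod.collapse)
      show "h (x \<otimes>\<^bsub>M2_bool\<^esub> y) (i, j) = (h x \<otimes>\<^bsub>matrix_ring 2 F\<^esub> h y) (i, j)"
      proof (cases "i < 2 \<and> j < 2")
        case True
        then consider "i = 0" "j = 0" | "i = 0" "j = 1" | "i = 1" "j = 0" | "i = 1" "j = 1" by (auto simp: lt)
        then show ?thesis
          by cases (simp_all add: h_def matrix_ring_def M2_bool_def finsum_lessThan_two \<iota>)
      qed (auto simp: h_def matrix_ring_def M2_bool_def)
    qed
    show "h (x \<oplus>\<^bsub>M2_bool\<^esub> y) = h x \<oplus>\<^bsub>matrix_ring 2 F\<^esub> h y" for x y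
      by (rule ext) (auto simp: h_def matrix_ring_def M2_bool_def \<iota> split: prod.splits)
    show "h \<one>\<^bsub>M2_bool\<^esub> = \<one>\<^bsub>matrix_ring 2 F\<^esub>"
      by (rule ext) (auto simp: h_def matrix_ring_def M2_bool_def \<iota> lt split: prod.splits)
    show "bij_betw h (carrier M2_bool) (carrier (matrix_ring 2 F))"
    proof (rule bij_betwI')
      show "h x = h y \<longleftrightarrow> x = y" for x y
      proof
        assume eq: "h x = h y"
        have "h x (0, 0) = h y (0, 0)" "h x (0, 1) = h y (0, 1)" "h x (1, 0) = h y (1, 0)" "h x (1, 1) = h y (1, 1)"
          by (simp_all add: eq)
        then show "x = y" by (simp add: h_def inj split: prod.splits)
      qed simp
      show "h x \<in> carrier (matrix_ring 2 F)" for x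
        by (auto simp: h_def matrix_ring_def \<iota>(1) split: prod.splits)
      fix A assume A: "A \<in> carrier (matrix_ring 2 F)"
      have ex: "\<exists>p. A (i, j) = \<iota> p" if "i < 2" "j < 2" for i j
      proof -
        have "A (i, j) \<in> carrier F" using A that by (auto simp: matrix_ring_def)
        then have "A (i, j) = \<iota> False \<or> A (i, j) = \<iota> True" unfolding car \<iota>(2,3) by blast
        then show ?thesis by blast
      qed
      obtain a b c d where abcd: "A (0, 0) = \<iota> a" "A (0, 1) = \<iota> b" "A (1, 0) = \<iota> c" "A (1, 1) = \<iota> d"
        using ex[of 0 0] ex[of 0 1] ex[of 1 0] ex[of 1 1] by auto
      have "A = h (a, b, c, d)"
      proof (rule ext, clarify)
        fix i j :: nat
        show "A (i, j) = h (a, b, c, d) (i, j)"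
        proof (cases "i < 2 \<and> j < 2")
          case True
          then show ?thesis using abcd by (auto simp: h_def lt)
        next
          case False
          then have "A (i, j) = undefined" using A by (auto simp: matrix_ring_def PiE_def extensional_def)
          then show ?thesis using False by (auto simp: h_def)
        qed
      qed
      then show "\<exists>x\<in>carrier M2_bool. A = h x" by (auto simp: M2_bool_def)
    qed
  qed
  then show ?thesis by (auto simp: is_ring_iso_def)
qed

text \<open>Four times 1 is \<open>(1 + 1)^2\<close> and vanishes by Lagrange, so the characteristic
  is 2. Any \<open>a\<close> other than 0 and 1 then satisfies \<open>a^2 = a + 1\<close>: the value
  \<open>a\<close> is excluded by cancellation, 0 and 1 by the absence of nilpotents.\<close>

lemma GF4_iso:
  fixes F (structure)
  assumes "is_GF 4 F"
  shows "GF4 \<simeq> F"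
proof -
  interpret field F using assms by (simp add: is_GF_def)
  have card: "card (carrier F) = 4" using assms by (simp add: is_GF_def order_def)
  then have fin: "finite (carrier F)" by (metis card.infinite zero_neq_numeral)
  have two: "\<one> \<oplus> \<one> = \<zero>"
  proof -
    have "add_pow F (4::nat) \<one> = \<zero>"
      using add.pow_order_eq_1[of \<one>] card by (simp add: order_def)
    then have "(\<one> \<oplus> \<one>) \<otimes> (\<one> \<oplus> \<one>) = \<zero>"
      by (simp add: numeral_eq_Suc l_distr r_distr a_assoc)
    then show ?thesis using integral[of "\<one> \<oplus> \<one>" "\<one> \<oplus> \<one>"] by simp
  qed
  have twice: "x \<oplus> x = \<zero>" if "x \<in> carrier F" for x
    using l_distr[of \<one> \<one> x] that two by simp
  have "\<not> carrier F \<subseteq> {\<zero>, \<one>}"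
    using card_mono[of "{\<zero>, \<one>}" "carrier F"] card by auto
  then obtain a where a: "a \<in> carrier F" "a \<noteq> \<zero>" "a \<noteq> \<one>" by blast
  have twice': "x \<oplus> (x \<oplus> y) = y" if "x \<in> carrier F" "y \<in> carrier F" for x y
    using that twice by (simp flip: a_assoc)
  have cancel: "x \<oplus> y = \<zero> \<longleftrightarrow> x = y" if "x \<in> carrier F" "y \<in> carrier F" for x y
    using that twice twice'[of x y] by (metis r_zero)
  have neq: "a \<oplus> \<one> \<noteq> \<zero>" "a \<oplus> \<one> \<noteq> \<one>" "a \<oplus> \<one> \<noteq> a"
    using a cancel[of a \<one>] by simp_all
  have car: "carrier F = {\<zero>, \<one>, a, a \<oplus> \<one>}"
  proof (rule card_subset_eq[symmetric])
    show "card {\<zero>, \<one>, a, a \<oplus> \<one>} = card (carrier F)"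
      using a a(2,3)[symmetric] neq neq[symmetric] card by simp
  qed (use a fin in auto)
  have sq: "a \<otimes> a = a \<oplus> \<one>"
  proof -
    have "a \<otimes> a \<in> {\<zero>, \<one>, a, a \<oplus> \<one>}" unfolding car[symmetric] using a by simp
    moreover have "a \<otimes> a \<noteq> \<zero>" using a integral by blast
    moreover have "a \<otimes> a \<noteq> a" using a m_lcancel[of a a \<one>] by simp
    moreover have "a \<otimes> a \<noteq> \<one>"
    proof
      assume "a \<otimes> a = \<one>"
      then have "(a \<oplus> \<one>) \<otimes> (a \<oplus> \<one>) = \<zero>"
        using a twice twice' by (simp add: l_distr r_distr a_ac)
      then show False using neq(1) integral a by blast
    qed
    ultimately show ?thesis by blast
  qed
  define h where "h = (\<lambda>(p, q). (if p then \<one> else \<zero>) \<oplus> (if q then a else \<zero>))"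
  have hv: "h (False, False) = \<zero>" "h (True, False) = \<one>" "h (False, True) = a" "h (True, True) = a \<oplus> \<one>"
    using a by (simp_all add: h_def a_comm)
  have "h \<in> ring_iso GF4 F"
  proof (rule ring_iso_memI)
    show "h x \<in> carrier F" for x using a by (auto simp: h_def split: prod.splits)
    show "h \<one>\<^bsub>GF4\<^esub> = \<one>" by (simp add: GF4_def hv)
    show "h (x \<oplus>\<^bsub>GF4\<^esub> y) = h x \<oplus> h y" for x y
    proof -
      obtain p q p' q' where [simp]: "x = (p, q)" "y = (p', q')" by (metis prod.collapse)
      show ?thesis using a
        by (cases p; cases q; cases p'; cases q') (simp_all add: GF4_def hv twice twice' a_ac)
    qed
    show "h (x \<otimes>\<^bsub>GF4\<^esub> y) = h x \<otimes> h y" for x y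
    proof -
      obtain p q p' q' where [simp]: "x = (p, q)" "y = (p', q')" by (metis prod.collapse)
      show ?thesis using a
        by (cases p; cases q; cases p'; cases q') (simp_all add: GF4_def hv twice twice' a_ac l_distr r_distr sq)
    qed
    have "inj h"
    proof (rule injI)
      fix x y assume eq: "h x = h y"
      obtain p q p' q' where [simp]: "x = (p, q)" "y = (p', q')" by (metis prod.collapse)
      show "x = y" using eq a neq neq[symmetric]
        by (cases p; cases q; cases p'; cases q') (simp_all add: hv)
    qed
    moreover have "h ` UNIV = carrier F"
      unfolding car using hv by (auto simp: image_iff) (metis)+
    ultimately show "bij_betw h (carrier GF4) (carrier F)"
      by (simp add: bij_betw_def GF4_def)
  qed
  then show ?thesis by (auto simp: is_ring_iso_def)
qed

lemma RDirProd_GF4_iso: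
  assumes "is_GF 4 F"
  shows "RDirProd GF4 GF4 \<simeq> RDirProd F F"
  using GF4_iso[OF assms] RDirProd_iso6 unfolding is_ring_iso_def by blast

text \<open>The isomorphism is the inverse of \<open>h\<close>; closure of the operations of
  \<open>Q\<close> is what makes the inverse respect them.\<close>

lemma ring_iso_flip:
  assumes "bij_betw h (carrier Q) (carrier R)"
    and closed: "\<And>x y. x \<in> carrier Q \<Longrightarrow> y \<in> carrier Q \<Longrightarrow> x \<otimes>\<^bsub>Q\<^esub> y \<in> carrier Q"
      "\<And>x y. x \<in> carrier Q \<Longrightarrow> y \<in> carrier Q \<Longrightarrow> x \<oplus>\<^bsub>Q\<^esub> y \<in> carrier Q" "\<one>\<^bsub>Q\<^esub> \<in> carrier Q"
    and hom: "\<And>x y. x \<in> carrier Q \<Longrightarrow> y \<in> carrier Q \<Longrightarrow> h (x \<otimes>\<^bsub>Q\<^esub> y) = h x \<otimes>\<^bsub>R\<^esub> h y"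
      "\<And>x y. x \<in> carrier Q \<Longrightarrow> y \<in> carrier Q \<Longrightarrow> h (x \<oplus>\<^bsub>Q\<^esub> y) = h x \<oplus>\<^bsub>R\<^esub> h y" "h \<one>\<^bsub>Q\<^esub> = \<one>\<^bsub>R\<^esub>"
  shows "R \<simeq> Q"
proof -
  let ?g = "inv_into (carrier Q) h"
  have inj: "inj_on h (carrier Q)" using assms(1) by (simp add: bij_betw_def)
  have g: "?g x \<in> carrier Q" "h (?g x) = x" if "x \<in> carrier R" for x
    using assms(1) that bij_betw_inv_into_right inv_into_into[of x h "carrier Q"] by (auto simp: bij_betw_def f_inv_into_f)
  have eq: "?g x = y" if "y \<in> carrier Q" "h y = x" for x y using that inj by (simp add: inv_into_f_eq)
  have "?g \<in> ring_iso R Q"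
    by (rule ring_iso_memI)
      (use g bij_betw_inv_into[OF assms(1)] in \<open>auto intro!: eq simp: closed hom\<close>)
  then show ?thesis by (auto simp: is_ring_iso_def)
qed

section \<open>Rings covered by the lines of a plane\<close>

context ring
begin

text \<open>Integer multiples play the role of scalars from F_3. Equality of coefficients then
  becomes divisibility of a difference by 3, which linear arithmetic can handle.\<close>

definition smul :: "int \<Rightarrow> 'a \<Rightarrow> 'a" (infixr \<open>\<star>\<close> 75) where
  "n \<star> x = [n] \<cdot> x"

lemma smul_closed [simp, intro]: "x \<in> carrier R \<Longrightarrow> n \<star> x \<in> carrier R"
  unfolding smul_def by simp

lemma smul_add: "x \<in> carrier R \<Longrightarrow> (m + n) \<star> x = m \<star> x \<oplus> n \<star> x"
  unfolding smul_def using add.int_pow_mult by simp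

lemma smul_smul: "x \<in> carrier R \<Longrightarrow> m \<star> n \<star> x = (m * n) \<star> x"
  unfolding smul_def using add.int_pow_pow[of x m n] by (simp add: mult.commute)

lemma smul_distrib: "x \<in> carrier R \<Longrightarrow> y \<in> carrier R \<Longrightarrow> n \<star> (x \<oplus> y) = n \<star> x \<oplus> n \<star> y"
  unfolding smul_def using add.int_pow_mult_distrib[of x y n] a_comm by simp

lemma smul_1 [simp]: "x \<in> carrier R \<Longrightarrow> 1 \<star> x = x"
  unfolding smul_def using add.int_pow_1 by simp

lemma smul_0 [simp]: "0 \<star> x = \<zero>"
  unfolding smul_def add_pow_def by simp

lemma smul_zero [simp]: "n \<star> \<zero> = \<zero>"
  unfolding smul_def by simp

lemma smul_uminus: "x \<in> carrier R \<Longrightarrow> (- n) \<star> x = \<ominus> (n \<star> x)"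
  unfolding smul_def using add.int_pow_neg by simp

lemma uminus_smul: "x \<in> carrier R \<Longrightarrow> \<ominus> x = (- 1) \<star> x"
  using smul_uminus[of x 1] by simp

lemma minus_smul: "x \<in> carrier R \<Longrightarrow> y \<in> carrier R \<Longrightarrow> x \<ominus> y = x \<oplus> (- 1) \<star> y"
  using uminus_smul minus_eq by simp

lemma l_smul: "x \<in> carrier R \<Longrightarrow> y \<in> carrier R \<Longrightarrow> (n \<star> x) \<otimes> y = n \<star> (x \<otimes> y)"
  unfolding smul_def by (simp add: add_pow_ldistr_int)

lemma r_smul: "x \<in> carrier R \<Longrightarrow> y \<in> carrier R \<Longrightarrow> x \<otimes> (n \<star> y) = n \<star> (x \<otimes> y)"
  unfolding smul_def by (simp add: add_pow_rdistr_int)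

end

locale ring_char_three = ring +
  assumes three: "x \<in> carrier R \<Longrightarrow> 3 \<star> x = \<zero>"
begin

lemma smul_dvd:
  assumes "x \<in> carrier R" "3 dvd n"
  shows "n \<star> x = \<zero>"
proof -
  obtain k where "n = 3 * k" using assms(2) by (rule dvdE)
  then show ?thesis using smul_smul[of x 3 k] three[of "k \<star> x"] assms(1) by simp
qed

lemma smul_cong: "x \<in> carrier R \<Longrightarrow> 3 dvd m - n \<Longrightarrow> m \<star> x = n \<star> x"
  using smul_add[of x "m - n" n] by (simp add: smul_dvd)

text \<open>An integer prime to 3 has square 1 modulo 3, so multiplying by it again replaces
  division.\<close>

lemma smul_invertible:
  assumes "\<not> 3 dvd n" "x \<in> carrier R"
  shows "n \<star> n \<star> x = x"
proof -
  have "\<exists>q. n = 3 * q + 1 \<or> n = 3 * q - 1" using assms(1) by presburger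
  then obtain q where "n = 3 * q + 1 \<or> n = 3 * q - 1" by blast
  then have "3 dvd n * n - 1"
  proof
    assume "n = 3 * q + 1"
    then have "n * n - 1 = 3 * (3 * q * q + 2 * q)" by (simp only:) (simp add: algebra_simps)
    then show ?thesis by (rule dvdI)
  next
    assume "n = 3 * q - 1"
    then have "n * n - 1 = 3 * (3 * q * q - 2 * q)" by (simp only:) (simp add: algebra_simps)
    then show ?thesis by (rule dvdI)
  qed
  then show ?thesis using smul_cong[of x "n * n" 1] assms by (simp add: smul_smul)
qed

end

text \<open>The conditions say that \<open>R/D\<close> is a plane over the field of three elements, and that \<open>D\<close> together with
  any line of the plane forms a subring.\<close>

locale plane_cover_ring = ring_char_three +
  fixes D
  assumes D: "nonunital_subring D R"
    and square: "x \<in> carrier R \<Longrightarrow> \<exists>c. x \<otimes> x \<ominus> c \<star> x \<in> D"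
    and left_scalar: "d \<in> D \<Longrightarrow> x \<in> carrier R \<Longrightarrow> \<exists>c. d \<otimes> x \<ominus> c \<star> x \<in> D"
    and right_scalar: "d \<in> D \<Longrightarrow> x \<in> carrier R \<Longrightarrow> \<exists>c. x \<otimes> d \<ominus> c \<star> x \<in> D"
    and indep: "s \<in> carrier R \<Longrightarrow> \<exists>t\<in>carrier R. \<forall>c. t \<ominus> c \<star> s \<notin> D"
    and span: "\<lbrakk>s \<in> carrier R; s \<notin> D; t \<in> carrier R; \<And>c. t \<ominus> c \<star> s \<notin> D; r \<in> carrier R\<rbrakk>
      \<Longrightarrow> \<exists>a b. r \<ominus> (a \<star> s \<oplus> b \<star> t) \<in> D"
    and core: "\<lbrakk>d \<in> D; \<And>s t. s \<in> carrier R \<Longrightarrow> t \<in> carrier R \<Longrightarrow> s \<otimes> d \<otimes> t \<in> D\<rbrakk> \<Longrightarrow> d = \<zero>"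
begin

sublocale D: additive_subgroup D R
  by (rule nonunital_subringD(1)[OF D])

lemma D_mult: "d \<in> D \<Longrightarrow> d' \<in> D \<Longrightarrow> d \<otimes> d' \<in> D"
  by (rule nonunital_subringD(2)[OF D])

lemma D_car [simp]: "d \<in> D \<Longrightarrow> d \<in> carrier R"
  using D.a_subset by blast

lemma D_minus: "d \<in> D \<Longrightarrow> d' \<in> D \<Longrightarrow> d \<ominus> d' \<in> D"
  by (simp add: minus_eq)

lemma D_smul: assumes "d \<in> D" shows "n \<star> d \<in> D"
proof -
  have "\<zero> \<in> D" "d \<in> D" "d \<oplus> d \<in> D" using assms by simp_all
  moreover have "n \<star> d = 0 \<star> d \<or> n \<star> d = 1 \<star> d \<or> n \<star> d = 2 \<star> d"
  proof -
    have "3 dvd n - 0 \<or> 3 dvd n - 1 \<or> 3 dvd n - 2" by presburger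
    then show ?thesis using assms smul_cong D_car by blast
  qed
  moreover have "2 \<star> d = d \<oplus> d" using assms smul_add[of d 1 1] by simp
  ultimately show ?thesis using assms by auto
qed

text \<open>Congruence modulo an additive group: as \<open>D\<close> need not be an ideal, products
  of congruent elements need not be congruent.\<close>

definition cong_D :: "'a \<Rightarrow> 'a \<Rightarrow> bool" (infix \<open>\<approx>\<close> 50) where
  "x \<approx> y \<longleftrightarrow> x \<ominus> y \<in> D"

lemma cong_refl [simp]: "x \<in> carrier R \<Longrightarrow> x \<approx> x"
  by (simp add: cong_D_def minus_eq r_neg)

lemma cong_sym:
  assumes "x \<approx> y" "x \<in> carrier R" "y \<in> carrier R" shows "y \<approx> x"
proof -
  have "y \<ominus> x = \<ominus> (x \<ominus> y)" using assms by (simp add: minus_eq minus_add a_comm)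
  then show ?thesis using assms by (simp add: cong_D_def)
qed

lemma cong_trans:
  assumes "x \<approx> y" "y \<approx> z" "x \<in> carrier R" "y \<in> carrier R" "z \<in> carrier R" shows "x \<approx> z"
proof -
  have "x \<ominus> z = (x \<ominus> y) \<oplus> (y \<ominus> z)" using assms by (simp add: minus_eq a_assoc r_neg1)
  then show ?thesis using assms by (simp add: cong_D_def)
qed

lemma cong_add:
  assumes "x \<approx> y" "x' \<approx> y'" "x \<in> carrier R" "y \<in> carrier R" "x' \<in> carrier R" "y' \<in> carrier R"
  shows "x \<oplus> x' \<approx> y \<oplus> y'"
proof -
  have "(x \<oplus> x') \<ominus> (y \<oplus> y') = (x \<ominus> y) \<oplus> (x' \<ominus> y')" using assms by (simp add: minus_eq minus_add a_ac)
  then show ?thesis using assms by (simp add: cong_D_def)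
qed

lemma cong_smul:
  assumes "x \<approx> y" "x \<in> carrier R" "y \<in> carrier R" shows "n \<star> x \<approx> n \<star> y"
proof -
  have "n \<star> x \<ominus> n \<star> y = n \<star> (x \<ominus> y)"
    using assms by (simp add: minus_smul smul_distrib smul_smul mult.commute)
  then show ?thesis using assms D_smul by (simp add: cong_D_def)
qed

lemma cong_zero: "x \<in> carrier R \<Longrightarrow> x \<approx> \<zero> \<longleftrightarrow> x \<in> D"
  by (simp add: cong_D_def minus_eq)

lemma cong_mem: assumes "x \<approx> y" "x \<in> carrier R" "y \<in> carrier R" shows "x \<in> D \<longleftrightarrow> y \<in> D"
  using cong_trans[of x y \<zero>] cong_trans[of y x \<zero>] cong_sym assms cong_zero by blast

text \<open>\<open>s\<close> and \<open>t\<close> represent a basis of the plane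
  \<open>R/D\<close>.\<close>

definition independent where
  "independent s t \<longleftrightarrow> s \<in> carrier R \<and> t \<in> carrier R \<and> s \<notin> D \<and> (\<forall>c. \<not> t \<approx> c \<star> s)"

lemma exists_independent:
  assumes "s \<in> carrier R" "s \<notin> D"
  obtains t where "independent s t"
  using indep[OF assms(1)] assms unfolding independent_def cong_D_def by blast

lemma independentD:
  assumes "independent s t" "a \<star> s \<oplus> b \<star> t \<in> D"
  shows "3 dvd a" "3 dvd b"
proof -
  have c: "s \<in> carrier R" "t \<in> carrier R" using assms by (auto simp: independent_def)
  show b: "3 dvd b"
  proof (rule ccontr)
    assume b: "\<not> 3 dvd b"
    have "b \<star> (a \<star> s \<oplus> b \<star> t) = t \<ominus> (- (b * a)) \<star> s"
      using c smul_invertible[OF b c(2)] by (simp add: smul_distrib smul_smul minus_smul a_comm)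
    then have "t \<approx> (- (b * a)) \<star> s" using D_smul[OF assms(2), of b] by (simp add: cong_D_def)
    then show False using assms(1) by (simp add: independent_def)
  qed
  show "3 dvd a"
  proof (rule ccontr)
    assume a: "\<not> 3 dvd a"
    have "a \<star> s \<in> D" using assms(2) b c by (simp add: smul_dvd)
    then have "a \<star> a \<star> s \<in> D" by (rule D_smul)
    then show False using smul_invertible[OF a c(1)] assms(1) by (simp add: independent_def)
  qed
qed

lemma independent_coeffs:
  assumes "independent s t" "a \<star> s \<oplus> b \<star> t \<approx> a' \<star> s \<oplus> b' \<star> t"
  shows "3 dvd a - a'" "3 dvd b - b'"
proof -
  have c: "s \<in> carrier R" "t \<in> carrier R" using assms by (auto simp: independent_def)
  have "(a \<star> s \<oplus> b \<star> t) \<ominus> (a' \<star> s \<oplus> b' \<star> t) = (a - a') \<star> s \<oplus> (b - b') \<star> t"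
    using c smul_add[of s a "- a'"] smul_add[of t b "- b'"]
    by (simp add: minus_eq minus_add smul_uminus a_ac)
  then have "(a - a') \<star> s \<oplus> (b - b') \<star> t \<in> D" using assms(2) by (simp add: cong_D_def)
  from independentD[OF assms(1) this] show "3 dvd a - a'" "3 dvd b - b'" by auto
qed

lemma independent_span:
  assumes "independent s t" "r \<in> carrier R"
  obtains a b where "r \<approx> a \<star> s \<oplus> b \<star> t"
  using span[of s t r] assms unfolding independent_def cong_D_def by blast

lemma exists_basis: obtains s t where "independent s t"
proof -
  obtain s where "s \<in> carrier R" "\<forall>c. s \<ominus> c \<star> \<zero> \<notin> D" using indep[of \<zero>] by auto
  then have "s \<in> carrier R" "s \<notin> D" by (simp_all add: minus_eq)
  then show thesis using exists_independent that by blast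
qed

text \<open>A linear map of a plane for which every vector is an eigenvector is a scalar: the
  eigenvalues at \<open>s\<close>, \<open>t\<close> and \<open>s \<oplus> t\<close> must
  agree.\<close>

lemma additive_eigen:
  assumes f: "\<And>x. x \<in> carrier R \<Longrightarrow> f x \<in> carrier R" "\<And>x. x \<in> D \<Longrightarrow> f x \<in> D"
    and add: "\<And>x y. x \<in> carrier R \<Longrightarrow> y \<in> carrier R \<Longrightarrow> f (x \<oplus> y) = f x \<oplus> f y"
    and smul: "\<And>n x. x \<in> carrier R \<Longrightarrow> f (n \<star> x) = n \<star> f x"
    and eigen: "\<And>x. x \<in> carrier R \<Longrightarrow> \<exists>c. f x \<approx> c \<star> x"
  shows "\<exists>c. \<forall>x\<in>carrier R. f x \<approx> c \<star> x"
proof -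
  obtain s t where st: "independent s t" by (rule exists_basis)
  then have c: "s \<in> carrier R" "t \<in> carrier R" by (auto simp: independent_def)
  obtain a where a: "f s \<approx> a \<star> s" using eigen c by blast
  obtain b where b: "f t \<approx> b \<star> t" using eigen c by blast
  obtain e where e: "f (s \<oplus> t) \<approx> e \<star> (s \<oplus> t)" using eigen c by blast
  have "a \<star> s \<oplus> b \<star> t \<approx> f s \<oplus> f t" using cong_add[OF cong_sym[OF a] cong_sym[OF b]] c f(1) by simp
  moreover have "f s \<oplus> f t \<approx> e \<star> s \<oplus> e \<star> t" using e c by (simp add: add smul_distrib)
  ultimately have "a \<star> s \<oplus> b \<star> t \<approx> e \<star> s \<oplus> e \<star> t"
    using c f(1) cong_trans[of "a \<star> s \<oplus> b \<star> t" "f s \<oplus> f t" "e \<star> s \<oplus> e \<star> t"] by simp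
  from independent_coeffs[OF st this] have ab: "3 dvd a - e" "3 dvd b - e" by auto
  then have a': "f s \<approx> e \<star> s" and b': "f t \<approx> e \<star> t" using a b smul_cong c by metis+
  have "f x \<approx> e \<star> x" if x: "x \<in> carrier R" for x
  proof -
    obtain p q where pq: "x \<approx> p \<star> s \<oplus> q \<star> t" using independent_span[OF st x] .
    define d where "d = x \<ominus> (p \<star> s \<oplus> q \<star> t)"
    have d: "d \<in> D" using pq by (simp add: d_def cong_D_def)
    have xd: "x = d \<oplus> (p \<star> s \<oplus> q \<star> t)" using x c by (simp add: d_def minus_eq a_assoc l_neg)
    have "f x = f d \<oplus> (p \<star> f s \<oplus> q \<star> f t)" unfolding xd using d c by (simp add: add smul)
    moreover have "f d \<approx> e \<star> d"
      using f(2)[OF d] D_smul[OF d] D_minus unfolding cong_D_def by blast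
    moreover have "p \<star> f s \<approx> p \<star> e \<star> s" "q \<star> f t \<approx> q \<star> e \<star> t" using a' b' c f by (auto intro: cong_smul)
    ultimately have "f x \<approx> e \<star> d \<oplus> (p \<star> e \<star> s \<oplus> q \<star> e \<star> t)" using c f d by (simp add: cong_add)
    also have "e \<star> d \<oplus> (p \<star> e \<star> s \<oplus> q \<star> e \<star> t) = e \<star> x"
      unfolding xd using c d by (simp add: smul_distrib smul_smul mult.commute)
    finally show ?thesis .
  qed
  then show ?thesis by blast
qed

lemma left_eigen: assumes "d \<in> D" shows "\<exists>c. \<forall>x\<in>carrier R. d \<otimes> x \<approx> c \<star> x"
  by (rule additive_eigen) (use assms left_scalar in \<open>auto simp: D_mult r_distr r_smul cong_D_def\<close>)

lemma right_eigen: assumes "d \<in> D" shows "\<exists>c. \<forall>x\<in>carrier R. x \<otimes> d \<approx> c \<star> x"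
  by (rule additive_eigen[where f = "\<lambda>x. x \<otimes> d"])
    (use assms right_scalar in \<open>auto simp: D_mult l_distr l_smul cong_D_def\<close>)

text \<open>\<open>s \<otimes> d \<otimes> u\<close> can be bracketed in two ways. Since
  \<open>s \<otimes> d\<close> is in \<open>D\<close>, it is congruent to a multiple of
  \<open>u\<close>; since \<open>d \<otimes> u\<close> is in \<open>D\<close>, to a multiple of
  \<open>s\<close>. For independent \<open>s\<close> and \<open>u\<close> the scalar is zero, so
  \<open>s \<otimes> d\<close> kills the plane from the left and \<open>core\<close>
  applies.\<close>

lemma annihilator_trivial:
  assumes d: "d \<in> D" "\<And>x. x \<in> carrier R \<Longrightarrow> d \<otimes> x \<in> D" "\<And>x. x \<in> carrier R \<Longrightarrow> x \<otimes> d \<in> D"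
  shows "d = \<zero>"
proof (rule core[OF d(1)])
  fix s t assume st: "s \<in> carrier R" "t \<in> carrier R"
  show "s \<otimes> d \<otimes> t \<in> D"
  proof (cases "s \<in> D")
    case True
    then show ?thesis using d st D_mult by (simp add: m_assoc)
  next
    case False
    then obtain u where u: "independent s u" using exists_independent st by blast
    then have uc: "u \<in> carrier R" by (simp add: independent_def)
    obtain c where c: "\<And>x. x \<in> carrier R \<Longrightarrow> s \<otimes> d \<otimes> x \<approx> c \<star> x" using left_eigen[of "s \<otimes> d"] d st by blast
    obtain b where "s \<otimes> (d \<otimes> u) \<approx> b \<star> s" using right_eigen[of "d \<otimes> u"] d st uc by blast
    then have "b \<star> s \<approx> c \<star> u"
      using c[OF uc] cong_trans[of "b \<star> s" "s \<otimes> d \<otimes> u" "c \<star> u"] cong_sym st uc d by (simp add: m_assoc)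
    then have "b \<star> s \<oplus> 0 \<star> u \<approx> 0 \<star> s \<oplus> c \<star> u" using st uc by simp
    then have "3 dvd 0 - c" by (rule independent_coeffs(2)[OF u])
    then have "c \<star> t = \<zero>" using smul_dvd st by simp
    then show ?thesis using c[OF st(2)] cong_zero st d by simp
  qed
qed

text \<open>If \<open>\<one>\<close> were outside \<open>D\<close>, applying \<open>d\<close> in
  \<open>D\<close> to it would show both eigenvalues of \<open>d\<close> to be zero. Then
  \<open>D\<close> would vanish and \<open>R\<close> would be spanned by \<open>\<one>\<close> and
  some \<open>t\<close>. The squares of \<open>t\<close>, \<open>t + 1\<close> and
  \<open>t + 2\<close> are multiples of these elements, so the quadratic polynomial of
  \<open>t\<close> would have three roots in F_3.\<close>

lemma one_mem: "\<one> \<in> D"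
proof (rule ccontr)
  assume one: "\<one> \<notin> D"
  have c0: "3 dvd c" if "c \<star> \<one> \<in> D" for c
    using that one D_smul[of "c \<star> \<one>" c] smul_invertible[of c \<one>] by (metis one_closed)
  have D0: "d = \<zero>" if d: "d \<in> D" for d
  proof (rule annihilator_trivial[OF d])
    obtain c where c: "\<And>x. x \<in> carrier R \<Longrightarrow> d \<otimes> x \<approx> c \<star> x" using left_eigen[OF d] by blast
    have "c \<star> \<one> \<in> D" using c[of \<one>] cong_mem[of d "c \<star> \<one>"] d by simp
    then show "d \<otimes> x \<in> D" if "x \<in> carrier R" for x
      using c[OF that] c0 smul_dvd that cong_zero d by simp
    obtain b where b: "\<And>x. x \<in> carrier R \<Longrightarrow> x \<otimes> d \<approx> b \<star> x" using right_eigen[OF d] by blast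
    have "b \<star> \<one> \<in> D" using b[of \<one>] cong_mem[of d "b \<star> \<one>"] d by simp
    then show "x \<otimes> d \<in> D" if "x \<in> carrier R" for x
      using b[OF that] c0 smul_dvd that cong_zero d by simp
  qed
  obtain t where ind: "independent \<one> t" using exists_independent[OF one_closed one] .
  then have t: "t \<in> carrier R" by (simp add: independent_def)
  have sq: "\<exists>c. x \<otimes> x \<oplus> c \<star> x = \<zero>" if x: "x \<in> carrier R" for x
  proof -
    obtain c where "x \<otimes> x \<ominus> c \<star> x = \<zero>" using square[OF x] D0 by blast
    then have "x \<otimes> x \<oplus> (- c) \<star> x = \<zero>" using x by (simp add: minus_eq smul_uminus)
    then show ?thesis by blast
  qed
  obtain a where a: "t \<otimes> t \<oplus> a \<star> t = \<zero>" using sq[OF t] by blast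
  then have tt: "t \<otimes> t = (- a) \<star> t" using t minus_unique smul_uminus by (metis smul_closed add.inv_equality m_closed)
  obtain b where b: "(t \<oplus> \<one>) \<otimes> (t \<oplus> \<one>) \<oplus> b \<star> (t \<oplus> \<one>) = \<zero>" using sq[of "t \<oplus> \<one>"] t by auto
  obtain c where c: "(t \<oplus> 2 \<star> \<one>) \<otimes> (t \<oplus> 2 \<star> \<one>) \<oplus> c \<star> (t \<oplus> 2 \<star> \<one>) = \<zero>" using sq[of "t \<oplus> 2 \<star> \<one>"] t by auto
  have "(t \<oplus> n \<star> \<one>) \<otimes> (t \<oplus> n \<star> \<one>) \<oplus> b \<star> (t \<oplus> n \<star> \<one>) = (n * n + b * n) \<star> \<one> \<oplus> (2 * n - a + b) \<star> t" for n b
  proof -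
    have "(2 * n - a + b) \<star> t = (- a) \<star> t \<oplus> (n \<star> t \<oplus> (n \<star> t \<oplus> b \<star> t))"
    proof -
      have "2 * n - a + b = - a + (n + (n + b))" by simp
      then show ?thesis by (simp only: smul_add[OF t])
    qed
    moreover have "(n * n + b * n) \<star> \<one> = (n * n) \<star> \<one> \<oplus> (b * n) \<star> \<one>" by (simp add: smul_add)
    ultimately show ?thesis
      using t by (simp add: tt l_distr r_distr l_smul r_smul smul_smul smul_distrib a_ac)
  qed
  note eq = this
  have "\<zero> = (1 + b) \<star> \<one> \<oplus> (2 - a + b) \<star> t" using b eq[of 1 b] t by simp
  then have "(1 + b) \<star> \<one> \<oplus> (2 - a + b) \<star> t \<in> D" using D.zero_closed by simp
  from independentD[OF ind this] have 1: "3 dvd 1 + b" "3 dvd 2 - a + b" .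
  have "\<zero> = (4 + c * 2) \<star> \<one> \<oplus> (4 - a + c) \<star> t" using c eq[of 2 c] by simp
  then have "(4 + c * 2) \<star> \<one> \<oplus> (4 - a + c) \<star> t \<in> D" using D.zero_closed by simp
  from independentD[OF ind this] have 2: "3 dvd 4 + c * 2" "3 dvd 4 - a + c" .
  show False using 1 2 by presburger
qed

end

section \<open>Scalars or two idempotents in D\<close>

lemma (in ring) span3_subring:
  assumes car: "u \<in> carrier R" "x \<in> carrier R"
    and prods: "u \<otimes> u = j \<star> u" "x \<otimes> u = \<zero>" "u \<otimes> x = l \<star> x" "x \<otimes> x = \<zero>"
  shows "nonunital_subring {a \<star> \<one> \<oplus> (b \<star> u \<oplus> c \<star> x) | a b c. True} R"
proof (rule nonunital_subringI)
  let ?S = "{a \<star> \<one> \<oplus> (b \<star> u \<oplus> c \<star> x) | a b c. True}"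
  show "?S \<subseteq> carrier R" using car by auto
  have mem: "a \<star> \<one> \<oplus> (b \<star> u \<oplus> c \<star> x) \<in> ?S" for a b c by blast
  show "\<zero> \<in> ?S" using mem[of 0 0 0] by simp
  fix r assume "r \<in> ?S"
  then obtain a b c where r: "r = a \<star> \<one> \<oplus> (b \<star> u \<oplus> c \<star> x)" by blast
  have "\<ominus> r = (- a) \<star> \<one> \<oplus> ((- b) \<star> u \<oplus> (- c) \<star> x)"
    using car by (simp add: r smul_uminus minus_add)
  then show "\<ominus> r \<in> ?S" using mem by simp
  fix s assume "s \<in> ?S"
  then obtain a' b' c' where s: "s = a' \<star> \<one> \<oplus> (b' \<star> u \<oplus> c' \<star> x)" by blast
  have "r \<oplus> s = (a + a') \<star> \<one> \<oplus> ((b + b') \<star> u \<oplus> (c + c') \<star> x)"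
    using car by (simp add: r s smul_add a_ac)
  then show "r \<oplus> s \<in> ?S" using mem by simp
  have "r \<otimes> s = (a * a') \<star> \<one> \<oplus> ((a * b' + b * a' + b * b' * j) \<star> u \<oplus> (a * c' + c * a' + b * c' * l) \<star> x)"
    using car by (simp add: r s l_distr r_distr l_smul r_smul smul_smul smul_distrib prods smul_add a_ac mult_ac)
  then show "r \<otimes> s \<in> ?S" using mem by simp
qed

lemma (in ring) add_eq_imp_minus_eq:
  assumes "a \<oplus> b = c \<oplus> d" "a \<in> carrier R" "b \<in> carrier R" "c \<in> carrier R" "d \<in> carrier R"
  shows "a \<ominus> c = d \<ominus> b"
proof -
  have "a \<ominus> c = (a \<oplus> b) \<oplus> (\<ominus> b \<oplus> \<ominus> c)" using assms(2-) by (simp add: minus_eq a_assoc r_neg2)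
  also have "\<dots> = (d \<oplus> c) \<oplus> (\<ominus> c \<oplus> \<ominus> b)" using assms by (simp add: a_comm)
  also have "\<dots> = d \<ominus> b" using assms(2-) by (simp add: minus_eq a_assoc r_neg2)
  finally show ?thesis .
qed

lemma (in ring_char_three) smul_eq_zeroD:
  assumes "n \<star> x = \<zero>" "x \<in> carrier R" "x \<noteq> \<zero>"
  shows "3 dvd n"
  using smul_invertible[of n x] assms by (metis smul_zero)

lemma square_mod_three: "3 dvd g * g \<or> 3 dvd g * g - 1" for g :: int
proof -
  have "3 dvd g \<or> 3 dvd g - 1 \<or> 3 dvd g + 1" by presburger
  moreover have "g * g - 1 = (g - 1) * (g + 1)" by (simp add: algebra_simps)
  ultimately show ?thesis by (metis dvd_mult dvd_mult2)
qed

context plane_cover_ring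
begin

text \<open>An element of \<open>D\<close> is determined by its left and right eigenvalues: the
  difference of two elements with the same eigenvalues annihilates the plane.\<close>

lemma eigen_unique:
  assumes d: "d \<in> D" "d' \<in> D" and l: "\<And>x. x \<in> carrier R \<Longrightarrow> d \<otimes> x \<approx> d' \<otimes> x"
    and r: "\<And>x. x \<in> carrier R \<Longrightarrow> x \<otimes> d \<approx> x \<otimes> d'"
  shows "d = d'"
proof -
  have "d \<ominus> d' = \<zero>"
  proof (rule annihilator_trivial)
    show "d \<ominus> d' \<in> D" using d D_minus by blast
    fix x assume x: "x \<in> carrier R"
    have "(d \<ominus> d') \<otimes> x = d \<otimes> x \<ominus> d' \<otimes> x" "x \<otimes> (d \<ominus> d') = x \<otimes> d \<ominus> x \<otimes> d'"
      using d x by (simp_all add: minus_eq l_distr r_distr l_minus r_minus)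
    then show "(d \<ominus> d') \<otimes> x \<in> D" "x \<otimes> (d \<ominus> d') \<in> D" using l[OF x] r[OF x] by (simp_all add: cong_D_def)
  qed
  then show ?thesis using d by simp
qed

lemma mem_cong: "x \<in> D \<Longrightarrow> y \<in> D \<Longrightarrow> x \<approx> y"
  by (simp add: cong_D_def D_minus)

lemma shifted_eigen:
  assumes d: "d \<in> D"
  obtains l m where "d \<oplus> (- l) \<star> \<one> \<in> D"
    "\<And>x. x \<in> carrier R \<Longrightarrow> (d \<oplus> (- l) \<star> \<one>) \<otimes> x \<in> D"
    "\<And>x. x \<in> carrier R \<Longrightarrow> x \<otimes> (d \<oplus> (- l) \<star> \<one>) \<approx> m \<star> x"
proof -
  obtain l where l: "\<And>x. x \<in> carrier R \<Longrightarrow> d \<otimes> x \<approx> l \<star> x" using left_eigen[OF d] by blast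
  obtain r where r: "\<And>x. x \<in> carrier R \<Longrightarrow> x \<otimes> d \<approx> r \<star> x" using right_eigen[OF d] by blast
  show thesis
  proof (rule that[of l "r - l"])
    show "d \<oplus> (- l) \<star> \<one> \<in> D" using d one_mem D_smul D.a_closed by blast
    fix x assume x: "x \<in> carrier R"
    have "(d \<oplus> (- l) \<star> \<one>) \<otimes> x = d \<otimes> x \<ominus> l \<star> x"
      using x d by (simp add: l_distr l_smul minus_eq smul_uminus l_minus)
    then show "(d \<oplus> (- l) \<star> \<one>) \<otimes> x \<in> D" using l[OF x] by (simp add: cong_D_def)
    have "x \<otimes> d \<oplus> (- l) \<star> x \<approx> r \<star> x \<oplus> (- l) \<star> x" using x d r[OF x] by (intro cong_add) auto
    moreover have "x \<otimes> (d \<oplus> (- l) \<star> \<one>) = x \<otimes> d \<oplus> (- l) \<star> x" using x d by (simp add: r_distr r_smul)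
    moreover have "(r - l) \<star> x = r \<star> x \<oplus> (- l) \<star> x" using smul_add[OF x, of r "- l"] by simp
    ultimately show "x \<otimes> (d \<oplus> (- l) \<star> \<one>) \<approx> (r - l) \<star> x" by simp
  qed
qed

text \<open>The two eigenvalues embed \<open>D\<close> in F_3 x F_3. If they agree for every
  element, \<open>D\<close> is scalar; otherwise shifting makes the left one 0 and rescaling makes
  the right one 1.\<close>

lemma scalar_or_idempotent:
  "(\<forall>d\<in>D. \<exists>c. d = c \<star> \<one>) \<or> (\<exists>f\<in>D. \<forall>x\<in>carrier R. f \<otimes> x \<in> D \<and> x \<otimes> f \<approx> x)"
proof (rule disjCI)
  assume no: "\<not> (\<exists>f\<in>D. \<forall>x\<in>carrier R. f \<otimes> x \<in> D \<and> x \<otimes> f \<approx> x)"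
  show "\<forall>d\<in>D. \<exists>c. d = c \<star> \<one>"
  proof
    fix d assume d: "d \<in> D"
    obtain l m where lm: "d \<oplus> (- l) \<star> \<one> \<in> D" "\<And>x. x \<in> carrier R \<Longrightarrow> (d \<oplus> (- l) \<star> \<one>) \<otimes> x \<in> D"
      "\<And>x. x \<in> carrier R \<Longrightarrow> x \<otimes> (d \<oplus> (- l) \<star> \<one>) \<approx> m \<star> x"
      by (rule shifted_eigen[OF d]) (rule that)
    define d' where "d' = d \<oplus> (- l) \<star> \<one>"
    note d' = lm[folded d'_def]
    have "3 dvd m"
    proof (rule ccontr)
      assume n: "\<not> 3 dvd m"
      have "m \<star> d' \<otimes> x \<in> D \<and> x \<otimes> (m \<star> d') \<approx> x" if x: "x \<in> carrier R" for x
      proof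
        show "m \<star> d' \<otimes> x \<in> D" using D_smul[OF d'(2)[OF x]] d'(1) x by (simp add: l_smul)
        have "m \<star> (x \<otimes> d') \<approx> m \<star> m \<star> x" using d' x by (intro cong_smul) auto
        then show "x \<otimes> (m \<star> d') \<approx> x" using smul_invertible[OF n x] x d'(1) by (simp add: r_smul)
      qed
      then show False using no D_smul[OF d'(1)] by blast
    qed
    then have "x \<otimes> d' \<in> D" if "x \<in> carrier R" for x
      using d'(1) d'(3)[OF that] that by (simp add: smul_dvd cong_zero)
    then have "d' = \<zero>" using annihilator_trivial[OF d'(1,2)] by blast
    then have "d = l \<star> \<one>" using d by (simp add: d'_def smul_uminus flip: minus_eq)
    then show "\<exists>c. d = c \<star> \<one>" by blast
  qed
qed

lemma independent_carrier: "independent s t \<Longrightarrow> s \<in> carrier R \<and> t \<in> carrier R \<and> s \<notin> D"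
  by (simp add: independent_def)

lemma independent_cong:
  assumes "independent s t" "s' \<approx> s" "t' \<approx> t" "s' \<in> carrier R" "t' \<in> carrier R"
  shows "independent s' t'"
proof -
  have c: "s \<in> carrier R" "t \<in> carrier R" "s \<notin> D" using independent_carrier[OF assms(1)] by auto
  have "\<not> t' \<approx> n \<star> s'" for n
  proof
    assume 1: "t' \<approx> n \<star> s'"
    have 2: "n \<star> s' \<approx> n \<star> s" using assms c by (intro cong_smul)
    have 3: "t \<approx> t'" using cong_sym assms c by blast
    have "t \<approx> n \<star> s"
      using cong_trans[OF cong_trans[OF 3 1] 2] assms c by simp
    then show False using assms(1) by (simp add: independent_def)
  qed
  moreover have "s' \<notin> D" using cong_mem[of s' s] assms c by simp
  ultimately show ?thesis using assms by (simp add: independent_def)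
qed

lemma independent_sym:
  assumes "independent s t" shows "independent t s"
proof -
  have c: "s \<in> carrier R" "t \<in> carrier R" "s \<notin> D" using independent_carrier[OF assms(1)] by auto
  have "t \<notin> D"
    using assms c cong_zero[of t] unfolding independent_def by (metis smul_0)
  moreover have "\<not> s \<approx> n \<star> t" for n
  proof
    assume "s \<approx> n \<star> t"
    then have "1 \<star> s \<oplus> 0 \<star> t \<approx> 0 \<star> s \<oplus> n \<star> t" using c by simp
    from independent_coeffs(1)[OF assms this] show False by simp
  qed
  ultimately show ?thesis using c by (simp add: independent_def)
qed

text \<open>\<open>R\<close> is spanned by \<open>e\<close>, \<open>f\<close>, \<open>x\<close>,
  \<open>y\<close>, where \<open>x\<close> and \<open>y\<close> lie in the corner
  \<open>e R f\<close> and have zero products. Dividing by the multiples of \<open>x\<close> leaves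
  triangular matrices, and \<open>S1\<close> to \<open>S4\<close> are the preimages of a cover of
  these by four subrings.\<close>

lemma idempotent_case:
  assumes f: "f \<in> D" "\<And>x. x \<in> carrier R \<Longrightarrow> f \<otimes> x \<in> D" "\<And>x. x \<in> carrier R \<Longrightarrow> x \<otimes> f \<approx> x"
  obtains x S1 S2 S3 S4 where "ideal {n \<star> x | n. True} R" "x \<in> carrier R" "x \<noteq> \<zero>"
    "\<And>S. S \<in> {S1, S2, S3, S4} \<Longrightarrow> proper_subring S R \<and> {n \<star> x | n. True} \<subseteq> S"
    "S1 \<union> S2 \<union> S3 \<union> S4 = carrier R"
proof -
  have fc [simp]: "f \<in> carrier R" using f by simp
  define e where "e = \<one> \<ominus> f"
  have ec [simp]: "e \<in> carrier R" by (simp add: e_def)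
  have eD: "e \<in> D" unfolding e_def using D_minus one_mem f by blast
  \<comment> \<open>Both sides have left eigenvalue 0 and right eigenvalue 1.\<close>
  have ff: "f \<otimes> f = f"
  proof (rule eigen_unique)
    fix x assume x: "x \<in> carrier R"
    show "(f \<otimes> f) \<otimes> x \<approx> f \<otimes> x" using f x by (intro mem_cong) (auto simp: m_assoc)
    show "x \<otimes> (f \<otimes> f) \<approx> x \<otimes> f" using f(3)[of "x \<otimes> f"] x by (simp add: m_assoc)
  qed (use f D_mult in auto)
  have fe: "f \<otimes> e = \<zero>" and ef: "e \<otimes> f = \<zero>" and ee: "e \<otimes> e = e" and one: "\<one> = e \<oplus> f"
    using ff by (simp_all add: e_def minus_eq r_distr l_distr r_minus l_minus r_neg l_neg a_assoc r_neg1)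
  \<comment> \<open>The eigenvalues of \<open>e\<close> are 1 and 0, those of \<open>f\<close> are 0
    and 1, so these two span \<open>D\<close>.\<close>
  have D_form: "\<exists>a b. d = a \<star> e \<oplus> b \<star> f" if d: "d \<in> D" for d
  proof -
    obtain l m where lm: "d \<oplus> (- l) \<star> \<one> \<in> D" "\<And>x. x \<in> carrier R \<Longrightarrow> (d \<oplus> (- l) \<star> \<one>) \<otimes> x \<in> D"
      "\<And>x. x \<in> carrier R \<Longrightarrow> x \<otimes> (d \<oplus> (- l) \<star> \<one>) \<approx> m \<star> x"
      by (rule shifted_eigen[OF d]) (rule that)
    have "d \<oplus> (- l) \<star> \<one> = m \<star> f"
    proof (rule eigen_unique[OF lm(1)])
      show "m \<star> f \<in> D" using f D_smul by blast
      fix x assume x: "x \<in> carrier R"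
      show "(d \<oplus> (- l) \<star> \<one>) \<otimes> x \<approx> (m \<star> f) \<otimes> x"
        using lm(2)[OF x] f(2)[OF x] D_smul x by (intro mem_cong) (simp_all add: l_smul)
      have "m \<star> (x \<otimes> f) \<approx> m \<star> x" using f(3)[OF x] x by (intro cong_smul) auto
      then have "m \<star> x \<approx> x \<otimes> (m \<star> f)" using x by (simp add: r_smul cong_sym)
      then show "x \<otimes> (d \<oplus> (- l) \<star> \<one>) \<approx> x \<otimes> (m \<star> f)"
        using cong_trans[OF lm(3)[OF x]] x d by simp
    qed
    moreover have "d = l \<star> \<one> \<oplus> (d \<oplus> (- l) \<star> \<one>)"
      using d a_comm[of d "(- l) \<star> \<one>"] by (simp add: smul_uminus r_neg2)
    ultimately have "d = l \<star> e \<oplus> (l + m) \<star> f" by (simp add: one smul_distrib smul_add a_assoc)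
    then show ?thesis by blast
  qed
  obtain s t where st: "independent s t" by (rule exists_basis)
  note stc = independent_carrier[OF st]
  \<comment> \<open>Representatives of the plane can be moved into the corner \<open>e R f\<close>:
    \<open>z \<otimes> f\<close> is congruent to \<open>z\<close>, and multiplying by
    \<open>e\<close> from the left only subtracts an element of \<open>D\<close>.\<close>
  define p where "p z = e \<otimes> z \<otimes> f" for z
  have pc [simp]: "p z \<in> carrier R" if "z \<in> carrier R" for z using that by (simp add: p_def)
  have p: "e \<otimes> p z = p z" "p z \<otimes> f = p z" "f \<otimes> p z = \<zero>" "p z \<otimes> e = \<zero>" "p z \<approx> z" if z: "z \<in> carrier R" for z
  proof -
    show 1: "e \<otimes> p z = p z" using z by (simp add: p_def ee flip: m_assoc)
    show 2: "p z \<otimes> f = p z" using z by (simp add: p_def ff m_assoc)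
    show "f \<otimes> p z = \<zero>" using z by (simp add: p_def fe flip: m_assoc)
    show "p z \<otimes> e = \<zero>" using z by (simp add: p_def fe m_assoc)
    have "p z \<ominus> z \<otimes> f = \<ominus> (f \<otimes> (z \<otimes> f))"
      using z by (simp add: p_def e_def minus_eq l_distr l_minus m_assoc a_ac r_neg2 r_neg1 r_neg)
    then have "p z \<approx> z \<otimes> f" using f(2)[of "z \<otimes> f"] z by (simp add: cong_D_def)
    then show "p z \<approx> z" using cong_trans[OF _ f(3)[OF z]] z by simp
  qed
  have pp: "p z \<otimes> p z' = \<zero>" if "z \<in> carrier R" "z' \<in> carrier R" for z z'
  proof -
    have "p z \<otimes> p z' = (p z \<otimes> f) \<otimes> (e \<otimes> p z')" using p that by simp
    also have "\<dots> = p z \<otimes> (f \<otimes> e) \<otimes> p z'" using that by (simp add: m_assoc)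
    finally show ?thesis using that by (simp add: fe)
  qed
  define x where "x = p s"
  define y where "y = p t"
  have xc [simp]: "x \<in> carrier R" and yc [simp]: "y \<in> carrier R" using stc by (simp_all add: x_def y_def)
  have ind: "independent x y"
    using independent_cong[OF st, of x y] stc p by (simp add: x_def y_def)
  have X: "e \<otimes> x = x" "x \<otimes> f = x" "f \<otimes> x = \<zero>" "x \<otimes> e = \<zero>" and Y: "e \<otimes> y = y" "y \<otimes> f = y" "f \<otimes> y = \<zero>" "y \<otimes> e = \<zero>"
    and XY: "x \<otimes> x = \<zero>" "x \<otimes> y = \<zero>" "y \<otimes> x = \<zero>" "y \<otimes> y = \<zero>"
    using p pp stc by (simp_all add: x_def y_def)
  have x0: "x \<noteq> \<zero>" using independent_carrier[OF ind] by auto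
  have f0: "f \<noteq> \<zero>" using X(2) x0 by auto
  have e0: "e \<noteq> \<zero>" using X(1) x0 by auto
  have form: "\<exists>a b c g. r = a \<star> e \<oplus> (b \<star> f \<oplus> (c \<star> x \<oplus> g \<star> y))" if r: "r \<in> carrier R" for r
  proof -
    obtain c g where cg: "r \<approx> c \<star> x \<oplus> g \<star> y" using independent_span[OF ind r] .
    then obtain a b where ab: "r \<ominus> (c \<star> x \<oplus> g \<star> y) = a \<star> e \<oplus> b \<star> f" using D_form unfolding cong_D_def by blast
    have "r = (r \<ominus> (c \<star> x \<oplus> g \<star> y)) \<oplus> (c \<star> x \<oplus> g \<star> y)" using r by (simp add: minus_eq a_assoc l_neg)
    then have "r = a \<star> e \<oplus> (b \<star> f \<oplus> (c \<star> x \<oplus> g \<star> y))" unfolding ab by (simp add: a_assoc)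
    then show ?thesis by blast
  qed
  \<comment> \<open>Modulo \<open>\<one>\<close> and \<open>x\<close> the ring is a plane spanned by
    \<open>e\<close> and \<open>y\<close>. Its four lines are generated by \<open>e\<close>,
    \<open>e + y\<close>, \<open>e + 2 y\<close> and \<open>y\<close>, the choices for
    \<open>u\<close>.\<close>
  define S where "S u = {a \<star> \<one> \<oplus> (b \<star> u \<oplus> c \<star> x) | a b c. True}" for u
  have I: "{n \<star> x | n. True} \<subseteq> S u" if "u \<in> carrier R" for u
  proof clarify
    fix n
    have "n \<star> x = 0 \<star> \<one> \<oplus> (0 \<star> u \<oplus> n \<star> x)" by simp
    then show "n \<star> x \<in> S u" unfolding S_def by blast
  qed
  have Se: "proper_subring (S (e \<oplus> n \<star> y)) R" for n
  proof -
    have "nonunital_subring (S (e \<oplus> n \<star> y)) R" unfolding S_def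
      by (rule span3_subring[where j = 1 and l = 1])
        (simp_all add: l_distr r_distr l_smul r_smul ee X Y XY)
    moreover have "y \<notin> S (e \<oplus> n \<star> y)"
    proof
      assume "y \<in> S (e \<oplus> n \<star> y)"
      then obtain a b c where y: "y = a \<star> \<one> \<oplus> (b \<star> (e \<oplus> n \<star> y) \<oplus> c \<star> x)" unfolding S_def by blast
      have "f \<otimes> y = a \<star> f"
        by (subst y) (simp add: r_distr r_smul fe X Y smul_distrib)
      then have a: "3 dvd a" using Y f0 smul_eq_zeroD[of a f] by simp
      have "y \<otimes> e = (a + b) \<star> e"
        by (subst y) (simp add: l_distr l_smul ee X Y smul_distrib smul_add)
      then have "3 dvd a + b" using Y e0 smul_eq_zeroD[of "a + b" e] by simp
      then have "3 dvd b" using a by presburger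
      then have "y = c \<star> x" using y a by (simp add: smul_dvd)
      then have "y \<approx> c \<star> x" using cong_refl[OF yc] by metis
      then show False using ind unfolding independent_def by blast
    qed
    ultimately show ?thesis using yc unfolding proper_subring_def by blast
  qed
  have Sy: "proper_subring (S y) R"
  proof -
    have "nonunital_subring (S y) R" unfolding S_def
      by (rule span3_subring[where j = 0 and l = 0]) (simp_all add: XY)
    moreover have "e \<notin> S y"
    proof
      assume "e \<in> S y"
      then obtain a b c where e: "e = a \<star> \<one> \<oplus> (b \<star> y \<oplus> c \<star> x)" unfolding S_def by blast
      have "f \<otimes> e = a \<star> f"
        by (subst e) (simp add: r_distr r_smul X Y)
      then have a: "3 dvd a" using fe f0 smul_eq_zeroD[of a f] by simp
      have "e \<otimes> e = a \<star> e"
        by (subst (1) e) (simp add: l_distr l_smul X Y)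
      then show False using ee a e0 by (simp add: smul_dvd)
    qed
    ultimately show ?thesis using ec unfolding proper_subring_def by blast
  qed
  have cov: "r \<in> S (e \<oplus> 0 \<star> y) \<union> S (e \<oplus> 1 \<star> y) \<union> S (e \<oplus> 2 \<star> y) \<union> S y" if r: "r \<in> carrier R" for r
  proof -
    obtain a b c g where abcg: "r = a \<star> e \<oplus> (b \<star> f \<oplus> (c \<star> x \<oplus> g \<star> y))" using form[OF r] by blast
    show ?thesis
    proof (cases "3 dvd a - b")
      case True
      then have "a \<star> e = b \<star> e" by (intro smul_cong) auto
      then have "r = b \<star> \<one> \<oplus> (g \<star> y \<oplus> c \<star> x)"
        using abcg by (simp add: one smul_distrib a_ac)
      then show ?thesis unfolding S_def by blast
    next
      case False
      \<comment> \<open>Writing \<open>a e + b f\<close> as \<open>b + m e\<close> leaves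
        \<open>m e + g y\<close>. Factoring out \<open>m\<close>, its own inverse, turns the
        coefficient of \<open>y\<close> into \<open>m g\<close>.\<close>
      define m where "m = a - b"
      have "m \<star> (m * g) \<star> y = g \<star> y"
        using smul_invertible[of m "g \<star> y"] False by (simp add: m_def smul_smul)
      moreover have "a \<star> e = b \<star> e \<oplus> m \<star> e" using smul_add[of e b m] by (simp add: m_def)
      ultimately have r': "r = b \<star> \<one> \<oplus> (m \<star> (e \<oplus> (m * g) \<star> y) \<oplus> c \<star> x)"
        using abcg by (simp add: one smul_distrib a_ac)
      have "3 dvd m * g - 0 \<or> 3 dvd m * g - 1 \<or> 3 dvd m * g - 2" by presburger
      then have "(m * g) \<star> y = 0 \<star> y \<or> (m * g) \<star> y = 1 \<star> y \<or> (m * g) \<star> y = 2 \<star> y"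
        using smul_cong[OF yc] by blast
      moreover have "r \<in> S (e \<oplus> (m * g) \<star> y)" using r' unfolding S_def by blast
      ultimately show ?thesis by auto
    qed
  qed
  have ideal: "ideal {n \<star> x | n. True} R"
  proof (rule idealI)
    show "subgroup {n \<star> x | n. True} (add_monoid R)"
    proof (rule add.subgroupI)
      show "\<ominus> z \<in> {n \<star> x | n. True}" if "z \<in> {n \<star> x | n. True}" for z
        using that smul_uminus[OF xc, symmetric] by auto
      show "z \<oplus> z' \<in> {n \<star> x | n. True}" if "z \<in> {n \<star> x | n. True}" "z' \<in> {n \<star> x | n. True}" for z z'
        using that smul_add[OF xc, symmetric] by auto
    qed auto
    fix z r assume z: "z \<in> {n \<star> x | n. True}" and r: "r \<in> carrier R"
    obtain n where n: "z = n \<star> x" using z by blast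
    obtain a b c g where abcg: "r = a \<star> e \<oplus> (b \<star> f \<oplus> (c \<star> x \<oplus> g \<star> y))" using form[OF r] by blast
    have "r \<otimes> z = (n * a) \<star> x" "z \<otimes> r = (n * b) \<star> x"
      unfolding n abcg by (simp_all add: l_distr r_distr l_smul r_smul X Y XY smul_smul mult.commute)
    then show "r \<otimes> z \<in> {n \<star> x | n. True}" "z \<otimes> r \<in> {n \<star> x | n. True}" by blast+
  qed (rule ring_axioms)
  show thesis
  proof (rule that[OF ideal xc x0])
    show "proper_subring T R \<and> {n \<star> x | n. True} \<subseteq> T"
      if "T \<in> {S (e \<oplus> 0 \<star> y), S (e \<oplus> 1 \<star> y), S (e \<oplus> 2 \<star> y), S y}" for T
    proof -
      have "proper_subring (S (e \<oplus> n \<star> y)) R \<and> {n \<star> x | n. True} \<subseteq> S (e \<oplus> n \<star> y)" for n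
        using Se I[of "e \<oplus> n \<star> y"] by simp
      moreover have "proper_subring (S y) R \<and> {n \<star> x | n. True} \<subseteq> S y" using Sy I[OF yc] by simp
      ultimately show ?thesis using that by (elim insertE emptyE) (simp_all only:)
    qed
    have "S (e \<oplus> n \<star> y) \<subseteq> carrier R" "S y \<subseteq> carrier R" for n
      unfolding S_def by auto
    then show "S (e \<oplus> 0 \<star> y) \<union> S (e \<oplus> 1 \<star> y) \<union> S (e \<oplus> 2 \<star> y) \<union> S y = carrier R"
      using cov by blast
  qed
qed


section \<open>Three-dimensional algebras over F_3\<close>

lemma scalar_basis:
  assumes D1: "\<And>d. d \<in> D \<Longrightarrow> \<exists>c. d = c \<star> \<one>" and ind: "independent s t" and r: "r \<in> carrier R"
  shows "\<exists>a b c. r = a \<star> \<one> \<oplus> (b \<star> s \<oplus> c \<star> t)"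
proof -
  note c = independent_carrier[OF ind]
  obtain b g where bg: "r \<approx> b \<star> s \<oplus> g \<star> t" using independent_span[OF ind r] .
  then obtain a where a: "r \<ominus> (b \<star> s \<oplus> g \<star> t) = a \<star> \<one>" using D1 unfolding cong_D_def by blast
  have "r = (r \<ominus> (b \<star> s \<oplus> g \<star> t)) \<oplus> (b \<star> s \<oplus> g \<star> t)" using r c by (simp add: minus_eq a_assoc l_neg)
  then show ?thesis unfolding a by blast
qed

lemma one_nonzero: "\<one> \<noteq> \<zero>"
proof
  assume "\<one> = \<zero>"
  then have "x \<in> D" if "x \<in> carrier R" for x using that one_zeroD by fastforce
  then show False using exists_basis independent_carrier by blast
qed

lemma scalar_basis_unique:
  assumes "independent s t" "a \<star> \<one> \<oplus> (b \<star> s \<oplus> c \<star> t) = \<zero>"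
  shows "3 dvd a" "3 dvd b" "3 dvd c"
proof -
  note car = independent_carrier[OF assms(1)]
  have "b \<star> s \<oplus> c \<star> t = \<ominus> (a \<star> \<one>)"
    using assms(2) car minus_equality[of "b \<star> s \<oplus> c \<star> t" "a \<star> \<one>"] by (simp add: a_comm)
  then have "b \<star> s \<oplus> c \<star> t \<in> D" using D_smul[OF one_mem] by simp
  from independentD[OF assms(1) this] show bc: "3 dvd b" "3 dvd c" .
  then have "a \<star> \<one> = \<zero>" using assms(2) car by (simp add: smul_dvd)
  then show "3 dvd a" using smul_eq_zeroD one_nonzero by blast
qed

text \<open>If \<open>w\<close> were independent of \<open>e\<close>, the quadratic equation of
  \<open>w \<oplus> n \<star> f\<close> would make every \<open>n\<close> a root of the quadratic
  polynomial of \<open>w\<close>. The values 0, 1 and -1 are too many.\<close>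

lemma Peirce_corner_scalar:
  assumes quad: "\<And>z. z \<in> carrier R \<Longrightarrow> \<exists>p q. z \<otimes> z = p \<star> z \<oplus> q \<star> \<one>"
    and car: "e \<in> carrier R" "f \<in> carrier R" "w \<in> carrier R"
    and ef: "\<one> = e \<oplus> f" "e \<otimes> e = e" "f \<otimes> f = f" "e \<otimes> f = \<zero>" "f \<otimes> e = \<zero>" "f \<noteq> \<zero>"
    and w: "e \<otimes> w = w" "w \<otimes> e = w"
  shows "\<exists>c. w = c \<star> e"
proof (rule ccontr)
  assume no: "\<nexists>c. w = c \<star> e"
  have wf: "w \<otimes> f = \<zero>" "f \<otimes> w = \<zero>"
    using car ef w m_assoc[of w e f] m_assoc[of f e w] by simp_all
  have e0: "e \<noteq> \<zero>"
  proof
    assume "e = \<zero>"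
    then have "w = 0 \<star> e" using w(1) car by simp
    then show False using no by blast
  qed
  have indep: "3 dvd p" "3 dvd q" if "p \<star> w = q \<star> e" for p q
  proof -
    show p: "3 dvd p"
    proof (rule ccontr)
      assume "\<not> 3 dvd p"
      then have "w = p \<star> q \<star> e" using smul_invertible[of p w] car that by simp
      then have "w = (p * q) \<star> e" using car by (simp add: smul_smul)
      then show False using no by blast
    qed
    then have "q \<star> e = \<zero>" using that smul_dvd car by metis
    then show "3 dvd q" using smul_eq_zeroD car e0 by blast
  qed
  \<comment> \<open>Multiplication by \<open>f\<close> isolates the equation for \<open>n\<close>,
    multiplication by \<open>e\<close> the one for \<open>w\<close>.\<close>
  have rel: "\<exists>p q. (w \<otimes> w = p \<star> w \<oplus> q \<star> e) \<and> 3 dvd n * n - p * n - q" for n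
  proof -
    define z where "z = w \<oplus> n \<star> f"
    have z: "z \<in> carrier R" using car by (simp add: z_def)
    obtain p q where pq: "z \<otimes> z = p \<star> z \<oplus> q \<star> \<one>" using quad[OF z] by blast
    have zz: "z \<otimes> z = w \<otimes> w \<oplus> (n * n) \<star> f"
      using car by (simp add: z_def l_distr r_distr l_smul r_smul wf ef smul_smul)
    have "(z \<otimes> z) \<otimes> f = (n * n) \<star> f"
      unfolding zz using car by (simp add: l_distr l_smul ef m_assoc wf)
    moreover have "(z \<otimes> z) \<otimes> f = (p * n + q) \<star> f"
      unfolding pq using car by (simp add: z_def l_distr l_smul wf ef(3) smul_distrib smul_smul smul_add)
    ultimately have eq: "(n * n) \<star> f = (p * n + q) \<star> f" by simp
    have "n * n - p * n - q = n * n + - (p * n + q)" by simp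
    then have "(n * n - p * n - q) \<star> f = (n * n) \<star> f \<oplus> \<ominus> ((p * n + q) \<star> f)"
      using car by (simp only: smul_add smul_uminus)
    also have "\<dots> = \<zero>" using car by (simp add: eq r_neg)
    finally have "(n * n - p * n - q) \<star> f = \<zero>" .
    then have "3 dvd n * n - p * n - q" using smul_eq_zeroD car ef by blast
    moreover have "(z \<otimes> z) \<otimes> e = w \<otimes> w"
      unfolding zz using car by (simp add: l_distr l_smul ef(5) m_assoc w)
    moreover have "(z \<otimes> z) \<otimes> e = p \<star> w \<oplus> q \<star> e"
      unfolding pq using car by (simp add: z_def l_distr l_smul w ef(5) smul_distrib)
    ultimately show ?thesis by metis
  qed
  obtain p q where pq: "w \<otimes> w = p \<star> w \<oplus> q \<star> e" "3 dvd 0 * 0 - p * 0 - q" using rel[of 0] by blast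
  \<comment> \<open>Modulo 3 the coefficients do not depend on \<open>n\<close>, as \<open>w\<close>
    and \<open>e\<close> are independent.\<close>
  have eqs: "3 dvd p' - p" "3 dvd q' - q" if "w \<otimes> w = p' \<star> w \<oplus> q' \<star> e" for p' q'
  proof -
    have "p' \<star> w \<oplus> q' \<star> e = p \<star> w \<oplus> q \<star> e" using that pq by simp
    then have "p' \<star> w \<ominus> p \<star> w = q \<star> e \<ominus> q' \<star> e" using car by (intro add_eq_imp_minus_eq) auto
    then have "(p' + - p) \<star> w = (q + - q') \<star> e"
      using car by (simp only: smul_add smul_uminus minus_eq)
    from indep[OF this] show "3 dvd p' - p" "3 dvd q' - q" by presburger+
  qed
  obtain p1 q1 where 1: "w \<otimes> w = p1 \<star> w \<oplus> q1 \<star> e" "3 dvd 1 * 1 - p1 * 1 - q1" using rel[of 1] by blast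
  obtain p2 q2 where 2: "w \<otimes> w = p2 \<star> w \<oplus> q2 \<star> e" "3 dvd (- 1) * (- 1) - p2 * (- 1) - q2" using rel[of "- 1"] by blast
  show False using pq(2) 1(2) 2(2) eqs[OF 1(1)] eqs[OF 2(1)] by presburger
qed

text \<open>If both mixed corners of \<open>y\<close> vanished, \<open>Peirce_corner_scalar\<close>
  would put \<open>y\<close> in the span of \<open>e\<close> and \<open>f\<close>, hence of
  \<open>\<one>\<close> and \<open>e\<close>. A nonzero mixed corner is the \<open>u\<close> sought;
  if it lies in \<open>f R e\<close>, then \<open>f\<close> takes the role of the
  idempotent.\<close>

lemma T2_from_idempotent:
  assumes D1: "\<And>d. d \<in> D \<Longrightarrow> \<exists>c. d = c \<star> \<one>"
    and e: "e \<in> carrier R" "e \<notin> D" "e \<otimes> e = e"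
  shows "\<exists>g u. independent g u \<and> g \<otimes> g = g \<and> g \<otimes> u = u \<and> u \<otimes> g = \<zero>"
proof -
  have quad: "\<exists>p q. z \<otimes> z = p \<star> z \<oplus> q \<star> \<one>" if z: "z \<in> carrier R" for z
  proof -
    obtain c where "z \<otimes> z \<ominus> c \<star> z \<in> D" using square[OF z] by blast
    then obtain q where q: "z \<otimes> z \<ominus> c \<star> z = q \<star> \<one>" using D1 by blast
    have "z \<otimes> z = c \<star> z \<oplus> (z \<otimes> z \<ominus> c \<star> z)" using z by (simp add: minus_eq a_ac r_neg r_neg1 r_neg2)
    then show ?thesis unfolding q by blast
  qed
  \<comment> \<open>A combination of \<open>\<one>\<close> and \<open>g\<close> commutes with
    \<open>g\<close>, whereas \<open>g \<otimes> u\<close> is \<open>u\<close> and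
    \<open>u \<otimes> g\<close> is zero.\<close>
  have T2: "independent g u" if g: "g \<in> carrier R" "g \<otimes> g = g" "g \<notin> D" and u: "u \<in> carrier R" "g \<otimes> u = u" "u \<otimes> g = \<zero>" "u \<noteq> \<zero>"
    for g u
  proof -
    have "\<not> u \<approx> c \<star> g" for c
    proof
      assume "u \<approx> c \<star> g"
      then obtain a where a: "u \<ominus> c \<star> g = a \<star> \<one>" using D1 unfolding cong_D_def by blast
      have ua: "u = a \<star> \<one> \<oplus> c \<star> g" unfolding a[symmetric] using g u by (simp add: minus_eq a_assoc l_neg)
      have "u \<otimes> g = a \<star> g \<oplus> c \<star> g" by (subst ua) (use g in \<open>simp add: l_distr l_smul\<close>)
      moreover have "g \<otimes> u = a \<star> g \<oplus> c \<star> g" by (subst ua) (use g in \<open>simp add: r_distr r_smul\<close>)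
      ultimately show False using u by simp
    qed
    then show ?thesis using g u by (simp add: independent_def)
  qed
  define f where "f = \<one> \<ominus> e"
  have fc: "f \<in> carrier R" using e by (simp add: f_def)
  have one: "\<one> = e \<oplus> f" using e a_comm[of \<one> "\<ominus> e"] by (simp add: f_def minus_eq r_neg2)
  have fe: "f \<otimes> e = \<zero>" and ef: "e \<otimes> f = \<zero>"
    using e by (simp_all add: f_def minus_eq r_distr l_distr r_minus l_minus r_neg)
  have "f \<otimes> f = f \<otimes> \<one> \<ominus> f \<otimes> e"
    by (subst (2) f_def) (use e fc in \<open>simp add: minus_eq r_distr r_minus\<close>)
  then have ff: "f \<otimes> f = f" using fc by (simp add: fe minus_eq)
  have fD: "f \<notin> D"
  proof
    assume "f \<in> D"
    then have "\<one> \<ominus> f \<in> D" using one_mem D_minus by blast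
    moreover have "\<one> \<ominus> f = e" using one e fc by (simp add: minus_eq a_assoc r_neg)
    ultimately show False using e by simp
  qed
  obtain y where y: "independent e y" using exists_independent e by blast
  then have yc: "y \<in> carrier R" using independent_carrier by blast
  show ?thesis
  proof (cases "e \<otimes> y \<otimes> f = \<zero> \<and> f \<otimes> y \<otimes> e = \<zero>")
    case False
    then show ?thesis
    proof (cases "e \<otimes> y \<otimes> f = \<zero>")
      case True
      let ?u = "f \<otimes> y \<otimes> e"
      have "f \<otimes> ?u = ?u" using fc yc e ff by (simp flip: m_assoc)
      moreover have "?u \<otimes> f = \<zero>" using fc yc e ef by (simp add: m_assoc)
      ultimately show ?thesis using T2[of f ?u] fc yc e ff fD False True by auto
    next
      case nz: False
      let ?u = "e \<otimes> y \<otimes> f"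
      have "e \<otimes> ?u = ?u" using fc yc e ff by (simp flip: m_assoc)
      moreover have "?u \<otimes> e = \<zero>" using fc yc e fe by (simp add: m_assoc)
      ultimately show ?thesis using T2[of e ?u] fc yc e nz by auto
    qed
  next
    case True
    have e0: "e \<noteq> \<zero>" and f0: "f \<noteq> \<zero>" using e fD by auto
    have "e \<otimes> y = e \<otimes> y \<otimes> (e \<oplus> f)" unfolding one[symmetric] using e yc by simp
    then have 1: "e \<otimes> y \<otimes> e = e \<otimes> y" using True e fc yc by (simp add: r_distr)
    have "f \<otimes> y = f \<otimes> y \<otimes> (e \<oplus> f)" unfolding one[symmetric] using fc yc by simp
    then have 2: "f \<otimes> y \<otimes> f = f \<otimes> y" using True e fc yc by (simp add: r_distr)
    obtain a where a: "e \<otimes> y = a \<star> e"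
      using Peirce_corner_scalar[OF quad e(1) fc _ one e(3) ff ef fe f0, of "e \<otimes> y"] 1 e yc by (auto simp flip: m_assoc)
    have one': "\<one> = f \<oplus> e" using one e fc a_comm by simp
    obtain b where b: "f \<otimes> y = b \<star> f"
      using Peirce_corner_scalar[OF quad fc e(1) _ one' ff e(3) fe ef e0, of "f \<otimes> y"] 2 fc yc ff by (auto simp flip: m_assoc)
    have "y = (e \<oplus> f) \<otimes> y" unfolding one[symmetric] using yc by simp
    then have "y = a \<star> e \<oplus> b \<star> f" using a b e fc yc by (simp add: l_distr)
    then have "y = b \<star> \<one> \<oplus> (a - b) \<star> e"
      using smul_add[of e b "a - b"] e fc by (simp add: one smul_distrib a_ac)
    then have "y \<ominus> (a - b) \<star> e = b \<star> \<one>" using e by (simp add: minus_eq a_assoc r_neg)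
    then have "y \<approx> (a - b) \<star> e" using D_smul[OF one_mem] by (simp add: cong_D_def)
    then show ?thesis using y by (simp add: independent_def)
  qed
qed

lemma scalar_case:
  assumes D1: "\<And>d. d \<in> D \<Longrightarrow> \<exists>c. d = c \<star> \<one>"
  obtains (null) x y where "independent x y" "x \<otimes> x = \<zero>" "x \<otimes> y = \<zero>" "y \<otimes> x = \<zero>" "y \<otimes> y = \<zero>"
    | (T2) e u where "independent e u" "e \<otimes> e = e" "e \<otimes> u = u" "u \<otimes> e = \<zero>"
proof (cases "\<exists>g u. independent g u \<and> g \<otimes> g = g \<and> g \<otimes> u = u \<and> u \<otimes> g = \<zero>")
  case True
  then show thesis using T2 by blast
next
  case False
  then have no: "e \<in> D" if "e \<in> carrier R" "e \<otimes> e = e" for e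
    using T2_from_idempotent[OF D1] that by blast
  \<comment> \<open>Left multiplication by \<open>x\<close> preserves the span of
    \<open>\<one>\<close> and \<open>x\<close>, so it acts on the one-dimensional quotient by a
    scalar \<open>g\<close> with \<open>g^2 = n\<close>. Hence \<open>n\<close> is 0 or 1, and
    \<open>n = 1\<close> would make \<open>2 (1 + x)\<close> an idempotent outside
    \<open>D\<close>.\<close>
  have sq0: "x \<otimes> x = \<zero>" if x: "x \<in> carrier R" "x \<notin> D" "x \<otimes> x = n \<star> \<one>" for x n
  proof -
    obtain y where y: "independent x y" using exists_independent x by blast
    then have yc: "y \<in> carrier R" using independent_carrier by blast
    obtain a b g where xy: "x \<otimes> y = a \<star> \<one> \<oplus> (b \<star> x \<oplus> g \<star> y)"
      using scalar_basis[OF D1 y, of "x \<otimes> y"] x yc by auto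
    have "n \<star> y = x \<otimes> (x \<otimes> y)" using x yc by (simp add: l_smul flip: m_assoc)
    also have "\<dots> = a \<star> x \<oplus> (b \<star> n \<star> \<one> \<oplus> g \<star> (a \<star> \<one> \<oplus> (b \<star> x \<oplus> g \<star> y)))"
      by (subst xy) (use x yc in \<open>simp add: r_distr r_smul xy\<close>)
    also have "\<dots> = (b * n + g * a) \<star> \<one> \<oplus> ((a + g * b) \<star> x \<oplus> (g * g) \<star> y)"
      using x yc by (simp add: smul_distrib smul_smul smul_add a_ac)
    finally have "n \<star> y = (b * n + g * a) \<star> \<one> \<oplus> ((a + g * b) \<star> x \<oplus> (g * g) \<star> y)" .
    then have "(b * n + g * a) \<star> \<one> \<oplus> ((a + g * b) \<star> x \<oplus> (g * g - n) \<star> y) = n \<star> y \<oplus> (- n) \<star> y"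
      using x yc smul_add[of y "g * g" "- n"] by (simp add: a_assoc)
    then have "(b * n + g * a) \<star> \<one> \<oplus> ((a + g * b) \<star> x \<oplus> (g * g - n) \<star> y) = \<zero>"
      using yc by (simp add: smul_uminus r_neg)
    from scalar_basis_unique(3)[OF y this] have "3 dvd g * g - n" .
    moreover have "3 dvd k - n \<Longrightarrow> 3 dvd k \<or> 3 dvd k - 1 \<Longrightarrow> 3 dvd n \<or> 3 dvd n - 1" for k :: int
      by presburger
    ultimately consider "3 dvd n" | "3 dvd n - 1" using square_mod_three[of g] by blast
    then show ?thesis
    proof cases
      case 1
      then show ?thesis using x by (simp add: smul_dvd)
    next
      case 2
      then have xx: "x \<otimes> x = \<one>" using x smul_cong[of \<one> n 1] by simp
      let ?e = "2 \<star> (\<one> \<oplus> x)"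
      have "(\<one> \<oplus> x) \<otimes> (\<one> \<oplus> x) = (\<one> \<oplus> x) \<oplus> (\<one> \<oplus> x)"
        using x(1) xx by (simp add: l_distr r_distr a_comm)
      also have "\<dots> = 2 \<star> (\<one> \<oplus> x)" using x(1) smul_add[of "\<one> \<oplus> x" 1 1] by simp
      finally have sq: "(\<one> \<oplus> x) \<otimes> (\<one> \<oplus> x) = 2 \<star> (\<one> \<oplus> x)" .
      have "?e \<otimes> ?e = 8 \<star> (\<one> \<oplus> x)" using x(1) sq by (simp add: l_smul r_smul smul_smul)
      also have "8 \<star> (\<one> \<oplus> x) = ?e" using x(1) by (intro smul_cong) auto
      finally have "?e \<in> D" using no[of ?e] x(1) by simp
      then have "2 \<star> 2 \<star> (\<one> \<oplus> x) \<in> D" by (rule D_smul)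
      then have "\<one> \<oplus> x \<in> D" using smul_invertible[of 2 "\<one> \<oplus> x"] x(1) by simp
      then have "(\<one> \<oplus> x) \<ominus> \<one> \<in> D" using one_mem D_minus by blast
      moreover have "(\<one> \<oplus> x) \<ominus> \<one> = x" using x(1) by (simp add: a_comm[of \<one> x] minus_eq a_assoc r_neg)
      ultimately show ?thesis using x(1,2) by simp
    qed
  qed
  \<comment> \<open>Here \<open>g^2 = 0\<close>. The coefficient of \<open>x\<close> in the product
    of \<open>x\<close> with \<open>x \<otimes> y\<close> then gives \<open>a = 0\<close>, and
    multiplying by \<open>y\<close> from the right gives \<open>b = 0\<close>.\<close>
  have prod0: "x \<otimes> y = \<zero>" if ind: "independent x y" and xx: "x \<otimes> x = \<zero>" and yy: "y \<otimes> y = \<zero>" for x y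
  proof -
    have c: "x \<in> carrier R" "y \<in> carrier R" using independent_carrier[OF ind] by auto
    obtain a b g where xy: "x \<otimes> y = a \<star> \<one> \<oplus> (b \<star> x \<oplus> g \<star> y)"
      using scalar_basis[OF D1 ind, of "x \<otimes> y"] c by auto
    have "\<zero> = x \<otimes> (x \<otimes> y)" using c xx by (simp flip: m_assoc)
    also have "\<dots> = a \<star> x \<oplus> g \<star> (a \<star> \<one> \<oplus> (b \<star> x \<oplus> g \<star> y))"
      by (subst xy) (use c xx in \<open>simp add: r_distr r_smul xy\<close>)
    also have "\<dots> = (g * a) \<star> \<one> \<oplus> ((a + g * b) \<star> x \<oplus> (g * g) \<star> y)"
      using c by (simp add: smul_distrib smul_smul smul_add a_ac)
    finally have eq: "(g * a) \<star> \<one> \<oplus> ((a + g * b) \<star> x \<oplus> (g * g) \<star> y) = \<zero>" by simp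
    from scalar_basis_unique[OF ind eq] have g2: "3 dvd a + g * b" "3 dvd g * g" by auto
    have g: "3 dvd g"
    proof (rule ccontr)
      assume "\<not> 3 dvd g"
      then have "g \<star> g \<star> x = x" using smul_invertible c by blast
      then have "x = \<zero>" using g2(2) c by (simp add: smul_smul smul_dvd)
      then show False using independent_carrier[OF ind] by simp
    qed
    then have a: "3 dvd a" using g2(1) by (metis dvd_add_left_iff dvd_mult2)
    have xyb: "x \<otimes> y = b \<star> x" using xy a g c by (simp add: smul_dvd)
    have "\<zero> = (x \<otimes> y) \<otimes> y" using c yy by (simp add: m_assoc)
    also have "\<dots> = b \<star> b \<star> x" using c by (simp add: xyb l_smul)
    finally have "b \<star> b \<star> x = \<zero>" by simp
    then have "3 dvd b" using smul_invertible[of b x] c independent_carrier[OF ind] by force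
    then show ?thesis using xyb c by (simp add: smul_dvd)
  qed
  \<comment> \<open>Completing the square: modulo 3 the shift by \<open>- p / 2\<close> is the shift
    by \<open>p\<close>.\<close>
  have shift: "\<exists>p. (s \<oplus> p \<star> \<one>) \<otimes> (s \<oplus> p \<star> \<one>) = \<zero>" if s: "s \<in> carrier R" "s \<notin> D" for s
  proof -
    obtain p where p: "s \<otimes> s \<ominus> p \<star> s \<in> D" using square s by blast
    then obtain q where q: "s \<otimes> s \<ominus> p \<star> s = q \<star> \<one>" using D1 by blast
    have ss: "s \<otimes> s = p \<star> s \<oplus> q \<star> \<one>" unfolding q[symmetric] using s by (simp add: minus_eq a_ac r_neg r_neg1 r_neg2)
    let ?s = "s \<oplus> p \<star> \<one>"
    have "?s \<otimes> ?s = (p \<star> s \<oplus> (p \<star> s \<oplus> p \<star> s)) \<oplus> (q \<star> \<one> \<oplus> (p * p) \<star> \<one>)"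
      using s by (simp add: l_distr r_distr l_smul r_smul ss smul_smul smul_distrib a_ac)
    also have "p \<star> s \<oplus> (p \<star> s \<oplus> p \<star> s) = (p + (p + p)) \<star> s" using s by (simp only: smul_add)
    also have "\<dots> = \<zero>" using s by (intro smul_dvd) auto
    finally have "?s \<otimes> ?s = (q + p * p) \<star> \<one>" using s by (simp add: smul_add)
    moreover have "?s \<notin> D"
    proof
      assume "?s \<in> D"
      then have "?s \<ominus> p \<star> \<one> \<in> D" using D_smul[OF one_mem] D_minus by blast
      moreover have "?s \<ominus> p \<star> \<one> = s" using s by (simp add: minus_eq a_assoc r_neg)
      ultimately show False using s by simp
    qed
    ultimately show ?thesis using sq0[of ?s] s by auto
  qed
  obtain s t where st: "independent s t" by (rule exists_basis)
  have c: "s \<in> carrier R" "t \<in> carrier R" "s \<notin> D" "t \<notin> D"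
    using independent_carrier[OF st] independent_carrier[OF independent_sym[OF st]] by auto
  obtain p q where pq: "(s \<oplus> p \<star> \<one>) \<otimes> (s \<oplus> p \<star> \<one>) = \<zero>" "(t \<oplus> q \<star> \<one>) \<otimes> (t \<oplus> q \<star> \<one>) = \<zero>"
    using shift c by blast
  have near: "r \<oplus> n \<star> \<one> \<approx> r" if "r \<in> carrier R" for r n
  proof -
    have "(r \<oplus> n \<star> \<one>) \<ominus> r = n \<star> \<one>" using that by (simp add: a_comm[of r "n \<star> \<one>"] minus_eq a_assoc r_neg)
    then show ?thesis using D_smul[OF one_mem] by (simp add: cong_D_def)
  qed
  have ind: "independent (s \<oplus> p \<star> \<one>) (t \<oplus> q \<star> \<one>)"
    using independent_cong[OF st near near] c by simp
  show thesis
    using null[OF ind pq(1) prod0[OF ind pq] prod0[OF independent_sym[OF ind] pq(2,1)] pq(2)] .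
qed

end

section \<open>From a cover in odd order to a plane\<close>

lemma (in group) square_mem_imp_mem:
  assumes x: "x \<in> carrier G" and t: "order G = 3 ^ t" and A: "subgroup A G" and xx: "x \<otimes> x \<in> A"
  shows "x \<in> A"
proof -
  interpret A: subgroup A G by fact
  \<comment> \<open>As the order is odd, \<open>x\<close> is the inverse of a power of
    \<open>x \<otimes> x\<close>.\<close>
  have "odd (3 ^ t :: nat)" by simp
  then obtain m :: nat where m: "3 ^ t = 2 * m + 1" by (rule oddE)
  have "x [^] Suc (2 * m) = \<one>" using pow_order_eq_1[OF x] t m by simp
  then have "x [^] (2 * m) \<otimes> x = \<one>" by simp
  moreover have "x [^] (2 * m) = (x \<otimes> x) [^] m"
    using nat_pow_pow[OF x, of 2 m] x by (simp add: numeral_2_eq_2)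
  ultimately have 1: "(x \<otimes> x) [^] m \<otimes> x = \<one>" by simp
  have A: "(x \<otimes> x) [^] m \<in> A" by (induction m) (use xx in auto)
  have "x = inv ((x \<otimes> x) [^] m) \<otimes> ((x \<otimes> x) [^] m \<otimes> x)" using x by (simp flip: m_assoc)
  also have "\<dots> = inv ((x \<otimes> x) [^] m)" using x 1 by simp
  finally show ?thesis using A by (metis A.m_inv_closed)
qed

text \<open>The left cosets of \<open>A\<close> at \<open>\<one>\<close>, \<open>x\<close> and
  \<open>inv x\<close> are distinct because \<open>x \<otimes> x\<close> is outside
  \<open>A\<close>, so by counting they exhaust \<open>B\<close>.\<close>

lemma (in group) index_three_coset:
  assumes fin: "finite (carrier G)" and t: "order G = 3 ^ t"
    and sub: "subgroup A G" "subgroup B G" "A \<subseteq> B" "card B = 3 * card A"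
    and x: "x \<in> B" "x \<notin> A" and b: "b \<in> B"
  shows "b \<in> A \<or> inv x \<otimes> b \<in> A \<or> x \<otimes> b \<in> A"
proof -
  interpret A: subgroup A G by fact
  interpret B: subgroup B G by fact
  have finB: "finite B" and finA: "finite A" using fin finite_subset[OF B.subset] finite_subset[OF A.subset] by auto
  have xc: "x \<in> carrier G" using x by simp
  have xx: "x \<otimes> x \<notin> A" using square_mem_imp_mem[OF xc t sub(1)] x by blast
  let ?f = "\<lambda>g a. g \<otimes> a"
  have cl: "?f g ` A \<subseteq> B" if "g \<in> B" for g using that sub(3) by auto
  have card: "card (?f g ` A) = card A" if "g \<in> B" for g
    using that by (intro card_image inj_onI) (simp add: A.mem_carrier)
  have disj: "?f g ` A \<inter> ?f h ` A = {}" if "g \<in> B" "h \<in> B" "inv h \<otimes> g \<notin> A" for g h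
  proof (rule ccontr)
    assume "?f g ` A \<inter> ?f h ` A \<noteq> {}"
    then obtain a a' where a: "a \<in> A" "a' \<in> A" "g \<otimes> a = h \<otimes> a'" by blast
    have "inv h \<otimes> g = inv h \<otimes> (g \<otimes> a) \<otimes> inv a" using that(1,2) a(1,2) by (simp add: m_assoc A.mem_carrier)
    also have "\<dots> = a' \<otimes> inv a" using that a by (simp add: A.mem_carrier flip: m_assoc)
    also have "\<dots> \<in> A" using a by simp
    finally show False using that by simp
  qed
  have d: "?f \<one> ` A \<inter> ?f x ` A = {}" "?f \<one> ` A \<inter> ?f (inv x) ` A = {}" "?f x ` A \<inter> ?f (inv x) ` A = {}"
  proof -
    have "inv x \<notin> A" using x xc A.m_inv_closed[of "inv x"] by auto
    then show "?f \<one> ` A \<inter> ?f x ` A = {}" using x xc by (intro disj) auto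
    show "?f \<one> ` A \<inter> ?f (inv x) ` A = {}" using x xc by (intro disj) auto
    show "?f x ` A \<inter> ?f (inv x) ` A = {}" using x xc xx by (intro disj) auto
  qed
  have "card (?f \<one> ` A \<union> ?f x ` A \<union> ?f (inv x) ` A) = card B"
    using d finA x card[of \<one>] card[of x] card[of "inv x"] sub(4)
    by (subst card_Un_disjoint; auto simp: card_Un_disjoint Int_Un_distrib2)
  then have "?f \<one> ` A \<union> ?f x ` A \<union> ?f (inv x) ` A = B"
    using finB cl[of \<one>] cl[of x] cl[of "inv x"] x by (intro card_subset_eq) auto
  then obtain a where a: "a \<in> A" "b = \<one> \<otimes> a \<or> b = x \<otimes> a \<or> b = inv x \<otimes> a" using b by blast
  have ac: "a \<in> carrier G" using a by simp
  from a(2) show ?thesis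
    using a(1) xc ac m_assoc[of "inv x" x a] m_assoc[of x "inv x" a] by auto
qed

text \<open>For \<open>x\<close> outside \<open>A\<close>, the only coset left for
  \<open>x \<otimes> x\<close> is that of \<open>inv x\<close>. In the additive group of a ring this
  puts \<open>3 \<star> x\<close> in \<open>A\<close>.\<close>

lemma (in group) index_three_cube:
  assumes fin: "finite (carrier G)" and t: "order G = 3 ^ t" and sub: "subgroup A G" "3 * card A = order G"
    and x: "x \<in> carrier G"
  shows "x \<otimes> (x \<otimes> x) \<in> A"
proof (cases "x \<in> A")
  case True
  then show ?thesis using subgroup.m_closed[OF sub(1)] by blast
next
  case False
  have "x \<otimes> x \<in> A \<or> inv x \<otimes> (x \<otimes> x) \<in> A \<or> x \<otimes> (x \<otimes> x) \<in> A"
    using index_three_coset[OF fin t sub(1) subgroup_self subgroup.subset[OF sub(1)] _ x False, of "x \<otimes> x"] sub(2) x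
    by (simp add: order_def)
  moreover have "inv x \<otimes> (x \<otimes> x) = x" using x by (simp flip: m_assoc)
  moreover have "x \<otimes> x \<notin> A" using square_mem_imp_mem[OF x t sub(1)] False by blast
  ultimately show ?thesis using False by auto
qed

text \<open>The scalar conditions on \<open>D\<close> hold because every element shares with
  \<open>D\<close> a member \<open>S\<close> of the cover, and \<open>S/D\<close> has order
  3.\<close>

theorem (in ring) order_three_power_cases:
  assumes S4: "in_S 4 R" and t: "order R = 3 ^ t"
  obtains D where "plane_cover_ring R D" "\<And>d. d \<in> D \<Longrightarrow> \<exists>c. d = c \<star> \<one>"
proof -
  have fin: "finite (carrier R)" using t by (metis card.infinite order_def power_not_zero zero_neq_numeral)
  have ord: "order (add_monoid R) = order R" by (simp add: order_def)
  note t' = t[folded ord]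
  obtain A B C E where dist: "distinct [A, B, C, E]"
    and proper: "proper_subring A R" "proper_subring B R" "proper_subring C R" "proper_subring E R"
    and cov: "A \<union> B \<union> C \<union> E = carrier R"
    using in_S_4_coverE[OF S4] .
  have sg: "subgroup S (add_monoid R)" "S \<noteq> carrier R" if "proper_subring S R" for S
    using that additive_subgroup_imp_subgroup nonunital_subringD(1) by (auto simp: proper_subring_def)
  define D where "D = A \<inter> B"
  let ?F = "{A, B, C, E}"
  have F: "proper_subring S R" if "S \<in> ?F" for S using that proper by blast
  have "\<Union>?F = carrier R" using cov by blast
  have subr: "nonunital_subring S R" if "S \<in> ?F" for S using F[OF that] by (simp add: proper_subring_def)
  have subc: "S \<subseteq> carrier R" if "S \<in> ?F" for S
    using subr[OF that] nonunital_subringD(1) additive_subgroup.a_subset by blast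
  note cover = add.four_subgroup_cover_order_three_power[of t A B C E, unfolded ord monoid.simps partial_object.simps,
      OF fin t sg(1)[OF proper(1)] sg(1)[OF proper(2)] sg(1)[OF proper(3)] sg(1)[OF proper(4)]
      sg(2)[OF proper(1)] sg(2)[OF proper(2)] sg(2)[OF proper(3)] sg(2)[OF proper(4)] cov]
  have card3: "3 * card S = order R" if "S \<in> ?F" for S using that cover(1-4) by blast
  have DF: "D \<subseteq> S" if "S \<in> ?F" for S using that cover(5-9) unfolding D_def by blast
  have sgD: "subgroup D (add_monoid R)"
    unfolding D_def using add.subgroups_Inter_pair sg(1) proper by blast
  have finF: "finite S" if "S \<in> ?F" for S using finite_subset[OF subc[OF that] fin] .
  \<comment> \<open>The product formula bounds the index of \<open>D\<close> in a member by 3 from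
    above. From below, the parts of the four members outside \<open>D\<close> have to fill the
    complement of \<open>D\<close>.\<close>
  have cardD: "card S = 3 * card D" if S: "S \<in> ?F" for S
  proof -
    have n: "order R > 0" using t by simp
    have "card A * card B \<le> order R * card (A \<inter> B)"
      using add.card_mult_card_le[of A B] fin sg(1) proper ord by simp
    then have "card A * card B \<le> 3 * card A * card D" using card3[of A] by (simp add: D_def)
    then have "card B \<le> 3 * card D" using mult_le_cancel_nat card3[of A] n by (metis gr0I insertI1 mult_0_right)
    moreover have "order R \<le> card D + (card (A - D) + card (B - D) + card (C - D) + card (E - D))"
    proof -
      have "carrier R = D \<union> ((A - D) \<union> (B - D) \<union> (C - D) \<union> (E - D))" using cov D_def by blast
      then have "order R = card (D \<union> ((A - D) \<union> (B - D) \<union> (C - D) \<union> (E - D)))" by (simp add: order_def)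
      also have "\<dots> \<le> card D + card ((A - D) \<union> (B - D) \<union> (C - D) \<union> (E - D))" by (rule card_Un_le)
      also have "card ((A - D) \<union> (B - D) \<union> (C - D) \<union> (E - D)) \<le> card (A - D) + card (B - D) + card (C - D) + card (E - D)"
        using card_Un_le[of "(A - D) \<union> (B - D) \<union> (C - D)" "E - D"] card_Un_le[of "(A - D) \<union> (B - D)" "C - D"]
          card_Un_le[of "A - D" "B - D"] by linarith
      finally show ?thesis by simp
    qed
    moreover have "card (T - D) + card D = card T" if "T \<in> ?F" for T
      using card_Diff_subset[of D T] DF[OF that] finF[OF that] card_mono[of T D] finite_subset[of D T] by simp
    then have "card (A - D) + card D = card A" "card (B - D) + card D = card B" "card (C - D) + card D = card C"
      "card (E - D) + card D = card E" by simp_all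
    ultimately show ?thesis using card3[of A] card3[of B] card3[of C] card3[of E] card3[OF S] by simp
  qed
  have mem: "\<exists>S\<in>?F. x \<in> S" if "x \<in> carrier R" for x using that cov by blast
  have Dsub: "nonunital_subring D R"
    unfolding nonunital_subring_def D_def
    using subr[of A] subr[of B] sgD by (auto simp: nonunital_subring_def D_def additive_subgroup_def)
  interpret D: additive_subgroup D R using Dsub nonunital_subringD(1) by blast
  have core: "d = \<zero>" if d: "d \<in> D" "\<And>s t. s \<in> carrier R \<Longrightarrow> t \<in> carrier R \<Longrightarrow> s \<otimes> d \<otimes> t \<in> D" for d
  proof -
    \<comment> \<open>This ideal is contained in \<open>D\<close>, as seen from
      \<open>s = t = 1\<close>, and hence in all four members.\<close>
    define I where "I = {d \<in> carrier R. \<forall>s\<in>carrier R. \<forall>t\<in>carrier R. s \<otimes> d \<otimes> t \<in> D}"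
    have ideal: "ideal I R"
    proof (rule idealI)
      show "subgroup I (add_monoid R)"
      proof (rule add.subgroupI)
        show "\<ominus> z \<in> I" if "z \<in> I" for z
          using that by (auto simp: I_def l_minus r_minus)
        show "z \<oplus> z' \<in> I" if "z \<in> I" "z' \<in> I" for z z'
          using that by (auto simp: I_def l_distr r_distr)
        show "I \<noteq> {}" using D.zero_closed by (auto simp: I_def intro!: exI[of _ \<zero>])
      qed (auto simp: I_def)
      show "r \<otimes> z \<in> I" if "z \<in> I" "r \<in> carrier R" for z r
        using that by (auto simp: I_def simp flip: m_assoc)
      show "z \<otimes> r \<in> I" if z: "z \<in> I" and r: "r \<in> carrier R" for z r
      proof -
        have zc: "z \<in> carrier R" using z by (simp add: I_def)
        have "s \<otimes> (z \<otimes> r) \<otimes> u = s \<otimes> z \<otimes> (r \<otimes> u)" if "s \<in> carrier R" "u \<in> carrier R" for s u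
          using that zc r by (simp add: m_assoc)
        then show ?thesis using z r zc by (simp add: I_def)
      qed
    qed (rule ring_axioms)
    have ID: "I \<subseteq> D"
    proof
      fix z assume "z \<in> I"
      then have "z \<in> carrier R" "\<one> \<otimes> z \<otimes> \<one> \<in> D" using one_closed unfolding I_def by blast+
      then show "z \<in> D" by simp
    qed
    have "I = {\<zero>}"
    proof (rule in_S_common_ideal[OF S4 ideal])
      show "card ?F \<le> 4" by (simp add: card_insert_if)
      show "\<Union>?F = carrier R" using cov by blast
      show "I \<subseteq> S" if "S \<in> ?F" for S using ID DF[OF that] by blast
    qed (use F in blast)+
    moreover have "d \<in> I" using d D.a_subset by (auto simp: I_def)
    ultimately show ?thesis by blast
  qed
  \<comment> \<open>\<open>3 \<star> y\<close> lies in every member because the members have index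
    3, and \<open>s \<otimes> (3 \<star> x) \<otimes> t\<close> is again a threefold multiple, so
    \<open>core\<close> applies.\<close>
  have three: "3 \<star> x = \<zero>" if x: "x \<in> carrier R" for x
  proof (rule core)
    have *: "3 \<star> y \<in> D" if y: "y \<in> carrier R" for y
    proof -
      have "3 \<star> y = y \<oplus> (y \<oplus> y)" using smul_add[OF y, of 1 2] smul_add[OF y, of 1 1] y by simp
      moreover have "y \<oplus> (y \<oplus> y) \<in> S" if "S \<in> ?F" for S
        using add.index_three_cube[of t S y] fin t' ord sg(1)[OF F[OF that]] card3[OF that] y by simp
      ultimately show ?thesis unfolding D_def by simp
    qed
    show "3 \<star> x \<in> D" using * x by blast
    show "s \<otimes> (3 \<star> x) \<otimes> t \<in> D" if "s \<in> carrier R" "t \<in> carrier R" for s t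
      using *[of "s \<otimes> x \<otimes> t"] that x by (simp add: l_smul r_smul)
  qed
  have conv: "\<exists>c. r \<ominus> c \<star> x \<in> A'"
    if "subgroup A' (add_monoid R)" "subgroup B' (add_monoid R)" "A' \<subseteq> B'" "card B' = 3 * card A'"
      "x \<in> B'" "x \<notin> A'" "r \<in> B'" for A' B' x r
  proof -
    have c: "x \<in> carrier R" "r \<in> carrier R" using that subgroup.mem_carrier by fastforce+
    have "r \<in> A' \<or> \<ominus> x \<oplus> r \<in> A' \<or> x \<oplus> r \<in> A'"
      using add.index_three_coset[of t A' B' x r] fin t' ord that by simp
    moreover have "r \<ominus> 0 \<star> x = r" "r \<ominus> 1 \<star> x = \<ominus> x \<oplus> r" "r \<ominus> (- 1) \<star> x = x \<oplus> r"
      using c by (simp_all add: minus_eq smul_uminus a_comm)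
    ultimately show ?thesis by metis
  qed
  \<comment> \<open>Within one member, elements are proportional modulo \<open>D\<close>; the last
    premise takes care of an \<open>x\<close> that represents zero.\<close>
  have convS: "\<exists>c. r \<ominus> c \<star> x \<in> D" if "S \<in> ?F" "x \<in> S" "r \<in> S" "x \<in> D \<Longrightarrow> r \<in> D" for S x r
  proof (cases "x \<in> D")
    case True
    then have "r \<ominus> 0 \<star> x \<in> D" using that D.a_subset by (auto simp: minus_eq)
    then show ?thesis by blast
  next
    case False
    then show ?thesis using conv[OF sgD sg(1)[OF F[OF that(1)]] DF[OF that(1)] cardD[OF that(1)]] that by blast
  qed
  have minusS: "a \<ominus> b \<in> S" if "subgroup S (add_monoid R)" "a \<in> S" "b \<in> S" for S a b
    using subgroup.m_closed[OF that(1,2) subgroup.m_inv_closed[OF that(1,3)]] by (simp add: minus_eq a_inv_def)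
  have smulS: "n \<star> b \<in> S" if "subgroup S (add_monoid R)" "b \<in> S" for S b n
    using add.subgroup_int_pow_closed that unfolding smul_def by blast
  have pcr: "plane_cover_ring R D"
  proof unfold_locales
    show "x \<in> carrier R \<Longrightarrow> 3 \<star> x = \<zero>" for x by (rule three)
    show "nonunital_subring D R" by (rule Dsub)
    show "\<exists>c. x \<otimes> x \<ominus> c \<star> x \<in> D" if x: "x \<in> carrier R" for x
    proof -
      obtain S where S: "S \<in> ?F" "x \<in> S" using mem[OF x] by blast
      show ?thesis
        by (rule convS[OF S nonunital_subringD(2)[OF subr[OF S(1)] S(2) S(2)]])
          (rule nonunital_subringD(2)[OF Dsub])
    qed
    show "\<exists>c. d \<otimes> x \<ominus> c \<star> x \<in> D" "\<exists>c. x \<otimes> d \<ominus> c \<star> x \<in> D" if d: "d \<in> D" and x: "x \<in> carrier R" for d x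
    proof -
      obtain S where S: "S \<in> ?F" "x \<in> S" using mem[OF x] by blast
      then have "d \<in> S" using DF d by blast
      note m = nonunital_subringD(2)[OF subr[OF S(1)]]
      show "\<exists>c. d \<otimes> x \<ominus> c \<star> x \<in> D"
        by (rule convS[OF S m[OF \<open>d \<in> S\<close> S(2)]]) (rule nonunital_subringD(2)[OF Dsub d])
      show "\<exists>c. x \<otimes> d \<ominus> c \<star> x \<in> D"
        by (rule convS[OF S m[OF S(2) \<open>d \<in> S\<close>]]) (rule nonunital_subringD(2)[OF Dsub _ d])
    qed
    show "\<exists>t\<in>carrier R. \<forall>c. t \<ominus> c \<star> s \<notin> D" if s: "s \<in> carrier R" for s
    proof -
      obtain S where S: "S \<in> ?F" "s \<in> S" using mem[OF s] by blast
      obtain u where u: "u \<in> carrier R" "u \<notin> S" using sg(2)[OF F[OF S(1)]] subc[OF S(1)] by blast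
      have "u \<ominus> c \<star> s \<notin> D" for c
      proof
        assume "u \<ominus> c \<star> s \<in> D"
        then have "u \<ominus> c \<star> s \<in> S" using DF S by blast
        moreover have "\<ominus> (c \<star> s) \<in> S"
          using smulS[OF sg(1)[OF F[OF S(1)]] S(2), of "- c"] s by (simp add: smul_uminus)
        ultimately have "(u \<ominus> c \<star> s) \<ominus> (\<ominus> (c \<star> s)) \<in> S" using minusS sg(1) F S by blast
        moreover have "(u \<ominus> c \<star> s) \<ominus> (\<ominus> (c \<star> s)) = u" using u s by (simp add: minus_eq a_assoc l_neg)
        ultimately show False using u by simp
      qed
      then show ?thesis using u by blast
    qed
    show "\<exists>a b. r \<ominus> (a \<star> s \<oplus> b \<star> u) \<in> D"
      if s: "s \<in> carrier R" "s \<notin> D" and u: "u \<in> carrier R" "\<And>c. u \<ominus> c \<star> s \<notin> D" and r: "r \<in> carrier R" for s u r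
    proof -
      obtain S where S: "S \<in> ?F" "s \<in> S" using mem[OF s(1)] by blast
      \<comment> \<open>\<open>S\<close> has index 3, so a multiple of \<open>u\<close> moves
        \<open>r\<close> into \<open>S\<close>; what remains is a multiple of \<open>s\<close>
        modulo \<open>D\<close>.\<close>
      have "u \<notin> S" using convS[OF S, of u] s u by blast
      then obtain b where b: "r \<ominus> b \<star> u \<in> S"
        using conv[OF sg(1)[OF F[OF S(1)]] add.subgroup_self, of u r] subc[OF S(1)] card3[OF S(1)] u r
        by (auto simp: order_def)
      obtain a where a: "(r \<ominus> b \<star> u) \<ominus> a \<star> s \<in> D" using convS[OF S b] s by blast
      have "(r \<ominus> b \<star> u) \<ominus> a \<star> s = r \<ominus> (a \<star> s \<oplus> b \<star> u)"
        using r s u by (simp add: minus_eq minus_add a_ac)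
      then show ?thesis using a by metis
    qed
    show "d = \<zero>" if "d \<in> D" "\<And>s t. s \<in> carrier R \<Longrightarrow> t \<in> carrier R \<Longrightarrow> s \<otimes> d \<otimes> t \<in> D" for d
      using core that by blast
  qed
  interpret plane_cover_ring R D by (rule pcr)
  have "\<forall>d\<in>D. \<exists>c. d = c \<star> \<one>"
  proof (rule ccontr)
    assume "\<not> ?thesis"
    then obtain f where f: "f \<in> D" "\<And>x. x \<in> carrier R \<Longrightarrow> f \<otimes> x \<in> D" "\<And>x. x \<in> carrier R \<Longrightarrow> cong_D (x \<otimes> f) x"
      using scalar_or_idempotent by blast
    show False
    proof (rule idempotent_case[OF f])
      fix x S1 S2 S3 S4
      assume I: "ideal {n \<star> x | n. True} R" "x \<in> carrier R" "x \<noteq> \<zero>"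
        and S: "\<And>S. S \<in> {S1, S2, S3, S4} \<Longrightarrow> proper_subring S R \<and> {n \<star> x | n. True} \<subseteq> S"
        and un: "S1 \<union> S2 \<union> S3 \<union> S4 = carrier R"
      have "{n \<star> x | n. True} = {\<zero>}"
      proof (rule in_S_common_ideal[OF S4 I(1)])
        show "card {S1, S2, S3, S4} \<le> 4" by (simp add: card_insert_if)
        show "\<Union>{S1, S2, S3, S4} = carrier R" using un by blast
      qed (use S in blast)+
      moreover have "1 \<star> x \<in> {n \<star> x | n. True}" by blast
      ultimately show False using I by simp
    qed
  qed
  then show thesis using that[OF pcr] by blast
qed

section \<open>The two rings of characteristic three\<close>

text \<open>The integers \<open>\<rho> u\<close> represent the elements \<open>u\<close> of the field, which therefore acts on every ring of
  characteristic \<open>3\<close> through integer multiples.\<close>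

locale GF3_representatives = field F for F (structure) +
  fixes \<rho> :: "'a \<Rightarrow> int"
  assumes rep_add: "\<lbrakk>u \<in> carrier F; v \<in> carrier F\<rbrakk> \<Longrightarrow> 3 dvd \<rho> (u \<oplus> v) - (\<rho> u + \<rho> v)"
    and rep_mult: "\<lbrakk>u \<in> carrier F; v \<in> carrier F\<rbrakk> \<Longrightarrow> 3 dvd \<rho> (u \<otimes> v) - \<rho> u * \<rho> v"
    and rep_one: "3 dvd \<rho> \<one> - 1" and rep_zero: "3 dvd \<rho> \<zero>"
    and rep_inj: "\<lbrakk>u \<in> carrier F; v \<in> carrier F; 3 dvd \<rho> u - \<rho> v\<rbrakk> \<Longrightarrow> u = v"
    and rep_surj: "\<exists>u\<in>carrier F. 3 dvd n - \<rho> u"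

text \<open>The elements are the multiples of \<open>\<one>\<close> by 0, 1 and 2, and
  \<open>\<rho>\<close> picks a multiplier for each. The congruences hold because only integers
  divisible by 3 annihilate \<open>\<one>\<close>.\<close>

lemma exists_GF3_representatives:
  fixes F (structure)
  assumes "is_GF 3 F"
  shows "\<exists>\<rho>. GF3_representatives F \<rho>"
proof -
  interpret F: field F using assms by (simp add: is_GF_def)
  have card: "card (carrier F) = 3" using assms by (simp add: is_GF_def order_def)
  then have fin: "finite (carrier F)" by (metis card.infinite zero_neq_numeral)
  interpret F: ring_char_three F
  proof
    fix x assume x: "x \<in> carrier F"
    have "[(3::nat)] \<cdot> x = \<zero>"
      using F.add.pow_order_eq_1[OF x] card by (simp add: order_def)
    then show "F.smul 3 x = \<zero>" by (simp add: F.smul_def add_pow_int_ge)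
  qed
  let ?c = "\<lambda>n. F.smul n \<one>"
  have zero: "3 dvd n" if "?c n = \<zero>" for n
    using F.smul_eq_zeroD[OF that] by simp
  have eq: "3 dvd m - n" if "?c m = ?c n" for m n
  proof (rule zero)
    show "?c (m - n) = \<zero>"
      using F.smul_add[of "\<one>" m "- n"] that by (simp add: F.smul_uminus F.r_neg)
  qed
  have "card {?c 0, ?c 1, ?c 2} = 3"
    using eq[of 0 1] eq[of 0 2] eq[of 1 2] by (auto simp: card_insert_if)
  then have "{?c 0, ?c 1, ?c 2} = carrier F" using fin card by (intro card_subset_eq) auto
  then have ex: "\<exists>n. u = ?c n" if "u \<in> carrier F" for u using that by blast
  define \<rho> where "\<rho> u = (SOME n. u = ?c n)" for u
  have \<rho>: "?c (\<rho> u) = u" if "u \<in> carrier F" for u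
    unfolding \<rho>_def using someI_ex[OF ex[OF that]] by simp
  have "GF3_representatives F \<rho>"
  proof unfold_locales
    fix u v assume u: "u \<in> carrier F" and v: "v \<in> carrier F"
    show "3 dvd \<rho> (u \<oplus> v) - (\<rho> u + \<rho> v)"
      by (rule eq) (simp add: \<rho> u v F.smul_add)
    have "?c (\<rho> u * \<rho> v) = ?c (\<rho> u) \<otimes> ?c (\<rho> v)"
      by (simp add: F.l_smul F.r_smul F.smul_smul mult.commute)
    then show "3 dvd \<rho> (u \<otimes> v) - \<rho> u * \<rho> v"
      by (intro eq) (simp add: \<rho> u v)
    show "u = v" if "3 dvd \<rho> u - \<rho> v"
      using F.smul_cong[OF F.one_closed that] u v by (simp add: \<rho>)
  next
    show "3 dvd \<rho> \<one> - 1" by (rule eq) (simp add: \<rho>)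
    show "3 dvd \<rho> \<zero>" by (rule zero) (simp add: \<rho>)
    show "\<exists>u\<in>carrier F. 3 dvd n - \<rho> u" for n
      by (rule bexI[of _ "?c n"], rule eq) (simp_all add: \<rho>)
  qed
  then show ?thesis by blast
qed

lemma (in abelian_monoid) finsum_mem:
  assumes "finite A" "\<And>i. i \<in> A \<Longrightarrow> f i \<in> J" "J \<subseteq> carrier G" "\<zero> \<in> J"
    "\<And>x y. x \<in> J \<Longrightarrow> y \<in> J \<Longrightarrow> x \<oplus> y \<in> J"
  shows "finsum G f A \<in> J"
  using assms(1,2)
proof (induction A rule: finite_induct)
  case (insert a A)
  then have "finsum G f (insert a A) = f a \<oplus> finsum G f A"
    using assms(3) by (intro finsum_insert) auto
  then show ?case using insert assms(5) by simp
qed (simp add: assms(4))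

lemma upper_triangular_ring_2:
  fixes F (structure)
  assumes "cring F"
  defines "T \<equiv> upper_triangular_ring 2 F"
  shows "A \<in> carrier T \<Longrightarrow> A (0, 0) \<in> carrier F" "A \<in> carrier T \<Longrightarrow> A (0, 1) \<in> carrier F"
    "A \<in> carrier T \<Longrightarrow> A (1, 1) \<in> carrier F"
    "A \<in> carrier T \<Longrightarrow> B \<in> carrier T \<Longrightarrow> A \<oplus>\<^bsub>T\<^esub> B \<in> carrier T"
    "A \<in> carrier T \<Longrightarrow> B \<in> carrier T \<Longrightarrow> A \<otimes>\<^bsub>T\<^esub> B \<in> carrier T"
    "\<one>\<^bsub>T\<^esub> \<in> carrier T"
    "A \<in> carrier T \<Longrightarrow> B \<in> carrier T \<Longrightarrow> (A \<oplus>\<^bsub>T\<^esub> B) (0, 0) = A (0, 0) \<oplus> B (0, 0)"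
    "A \<in> carrier T \<Longrightarrow> B \<in> carrier T \<Longrightarrow> (A \<oplus>\<^bsub>T\<^esub> B) (0, 1) = A (0, 1) \<oplus> B (0, 1)"
    "A \<in> carrier T \<Longrightarrow> B \<in> carrier T \<Longrightarrow> (A \<oplus>\<^bsub>T\<^esub> B) (1, 1) = A (1, 1) \<oplus> B (1, 1)"
    "A \<in> carrier T \<Longrightarrow> B \<in> carrier T \<Longrightarrow> (A \<otimes>\<^bsub>T\<^esub> B) (0, 0) = A (0, 0) \<otimes> B (0, 0)"
    "A \<in> carrier T \<Longrightarrow> B \<in> carrier T \<Longrightarrow>
      (A \<otimes>\<^bsub>T\<^esub> B) (0, 1) = A (0, 0) \<otimes> B (0, 1) \<oplus> A (0, 1) \<otimes> B (1, 1)"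
    "A \<in> carrier T \<Longrightarrow> B \<in> carrier T \<Longrightarrow> (A \<otimes>\<^bsub>T\<^esub> B) (1, 1) = A (1, 1) \<otimes> B (1, 1)"
    "\<one>\<^bsub>T\<^esub> (0, 0) = \<one>" "\<one>\<^bsub>T\<^esub> (0, 1) = \<zero>" "\<one>\<^bsub>T\<^esub> (1, 1) = \<one>"
    "A \<in> carrier T \<Longrightarrow> B \<in> carrier T \<Longrightarrow> A (0, 0) = B (0, 0) \<Longrightarrow> A (0, 1) = B (0, 1) \<Longrightarrow>
      A (1, 1) = B (1, 1) \<Longrightarrow> A = B"
    "a \<in> carrier F \<Longrightarrow> b \<in> carrier F \<Longrightarrow> c \<in> carrier F \<Longrightarrow>
      \<exists>A\<in>carrier T. A (0, 0) = a \<and> A (0, 1) = b \<and> A (1, 1) = c"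
proof -
  interpret cring F by fact
  have lt: "i < 2 \<longleftrightarrow> i = 0 \<or> i = 1" for i :: nat by auto
  have car: "A \<in> carrier T \<longleftrightarrow> A \<in> ({..<2} \<times> {..<2}) \<rightarrow>\<^sub>E carrier F \<and> A (1, 0) = \<zero>" for A
    by (auto simp: T_def upper_triangular_ring_def matrix_ring_def lt)
  have plus: "A \<oplus>\<^bsub>T\<^esub> B = (\<lambda>(i, j) \<in> {..<2} \<times> {..<2}. A (i, j) \<oplus> B (i, j))" for A B
    by (simp add: T_def upper_triangular_ring_def matrix_ring_def)
  have times: "A \<otimes>\<^bsub>T\<^esub> B = (\<lambda>(i, j) \<in> {..<2} \<times> {..<2}. \<Oplus>k\<in>{..<2}. A (i, k) \<otimes> B (k, j))" for A B
    by (simp add: T_def upper_triangular_ring_def matrix_ring_def)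
  have one: "\<one>\<^bsub>T\<^esub> = (\<lambda>(i, j) \<in> {..<2} \<times> {..<2}. if i = j then \<one> else \<zero>)"
    by (simp add: T_def upper_triangular_ring_def matrix_ring_def)
  have entry: "A (i, j) \<in> carrier F" if "A \<in> carrier T" "i < 2" "j < 2" for A i j
    using that by (auto simp: car)
  have low: "A (1, 0) = \<zero>" if "A \<in> carrier T" for A using that by (simp add: car)
  have prod: "(A \<otimes>\<^bsub>T\<^esub> B) (i, j) = A (i, 0) \<otimes> B (0, j) \<oplus> A (i, 1) \<otimes> B (1, j)"
    if "A \<in> carrier T" "B \<in> carrier T" "i < 2" "j < 2" for A B i j
    using that entry[of A] entry[of B] by (simp add: times finsum_lessThan_two)
  show "A (0, 0) \<in> carrier F" "A (0, 1) \<in> carrier F" "A (1, 1) \<in> carrier F" if "A \<in> carrier T"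
    using entry[OF that] by simp_all
  show "\<one>\<^bsub>T\<^esub> \<in> carrier T" by (auto simp: car one)
  show "\<one>\<^bsub>T\<^esub> (0, 0) = \<one>" "\<one>\<^bsub>T\<^esub> (0, 1) = \<zero>" "\<one>\<^bsub>T\<^esub> (1, 1) = \<one>" by (simp_all add: one)
  show "\<exists>A\<in>carrier T. A (0, 0) = a \<and> A (0, 1) = b \<and> A (1, 1) = c"
    if "a \<in> carrier F" "b \<in> carrier F" "c \<in> carrier F"
  proof (rule bexI, intro conjI)
    let ?A = "\<lambda>(i, j) \<in> {..<2} \<times> {..<2}. if j < i then \<zero> else if i < j then b else if i = (0::nat) then a else c"
    show "?A \<in> carrier T" using that by (auto simp: car)
    show "?A (0, 0) = a" "?A (0, 1) = b" "?A (1, 1) = c" by simp_all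
  qed
  assume A: "A \<in> carrier T" and B: "B \<in> carrier T"
  show "A \<oplus>\<^bsub>T\<^esub> B \<in> carrier T"
    using entry[OF A] entry[OF B] low[OF A] low[OF B] by (auto simp: car plus)
  show "(A \<oplus>\<^bsub>T\<^esub> B) (0, 0) = A (0, 0) \<oplus> B (0, 0)" "(A \<oplus>\<^bsub>T\<^esub> B) (0, 1) = A (0, 1) \<oplus> B (0, 1)"
    "(A \<oplus>\<^bsub>T\<^esub> B) (1, 1) = A (1, 1) \<oplus> B (1, 1)"
    by (simp_all add: plus)
  show 00: "(A \<otimes>\<^bsub>T\<^esub> B) (0, 0) = A (0, 0) \<otimes> B (0, 0)"
    and 01: "(A \<otimes>\<^bsub>T\<^esub> B) (0, 1) = A (0, 0) \<otimes> B (0, 1) \<oplus> A (0, 1) \<otimes> B (1, 1)"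
    and 11: "(A \<otimes>\<^bsub>T\<^esub> B) (1, 1) = A (1, 1) \<otimes> B (1, 1)"
    using prod[OF A B] entry[OF A] entry[OF B] low[OF A] low[OF B] by simp_all
  have "(A \<otimes>\<^bsub>T\<^esub> B) (1, 0) = \<zero>"
    using prod[OF A B] entry[OF A] entry[OF B] low[OF A] low[OF B] by simp
  moreover have "A \<otimes>\<^bsub>T\<^esub> B \<in> ({..<2} \<times> {..<2}) \<rightarrow>\<^sub>E carrier F"
    unfolding times using entry[OF A] entry[OF B] by (auto intro!: finsum_closed)
  ultimately show "A \<otimes>\<^bsub>T\<^esub> B \<in> carrier T" by (simp add: car)
  assume eq: "A (0, 0) = B (0, 0)" "A (0, 1) = B (0, 1)" "A (1, 1) = B (1, 1)"
  show "A = B"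
  proof (rule PiE_ext)
    show "A \<in> ({..<2} \<times> {..<2}) \<rightarrow>\<^sub>E carrier F" "B \<in> ({..<2} \<times> {..<2}) \<rightarrow>\<^sub>E carrier F" using A B by (simp_all add: car)
    show "A z = B z" if "z \<in> {..<2} \<times> {..<2}" for z
      using that eq low[OF A] low[OF B] by (auto simp: lt)
  qed
qed

locale GF3_scalars = plane_cover_ring R D + F: GF3_representatives F \<rho>
  for R (structure) and D and F :: "('c, 'k) ring_scheme" and \<rho> :: "'c \<Rightarrow> int" +
  assumes scalar: "d \<in> D \<Longrightarrow> \<exists>c. d = c \<star> \<one>"
begin

lemma rep_add_smul:
  "p \<in> carrier F \<Longrightarrow> q \<in> carrier F \<Longrightarrow> x \<in> carrier R \<Longrightarrow> \<rho> (p \<oplus>\<^bsub>F\<^esub> q) \<star> x = \<rho> p \<star> x \<oplus> \<rho> q \<star> x"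
  using smul_cong[OF _ F.rep_add] by (simp add: smul_add)

lemma rep_mult_smul:
  "p \<in> carrier F \<Longrightarrow> q \<in> carrier F \<Longrightarrow> x \<in> carrier R \<Longrightarrow> \<rho> (p \<otimes>\<^bsub>F\<^esub> q) \<star> x = (\<rho> p * \<rho> q) \<star> x"
  using smul_cong[OF _ F.rep_mult] by simp

lemma rep_one_smul: "x \<in> carrier R \<Longrightarrow> \<rho> \<one>\<^bsub>F\<^esub> \<star> x = x"
  using smul_cong[OF _ F.rep_one] by simp

lemma rep_smulE:
  obtains u where "u \<in> carrier F" "\<And>x. x \<in> carrier R \<Longrightarrow> \<rho> u \<star> x = n \<star> x"
  using F.rep_surj[of n] smul_cong by metis

text \<open>\<open>e\<close>, \<open>f\<close> and \<open>u\<close> multiply like the matrix units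
  at (0,0), (1,1) and (0,1).\<close>

lemma T2_iso:
  assumes eu: "independent e u" "e \<otimes> e = e" "e \<otimes> u = u" "u \<otimes> e = \<zero>"
  shows "R \<simeq> upper_triangular_ring 2 F"
proof -
  let ?T = "upper_triangular_ring 2 F"
  note T = upper_triangular_ring_2[OF F.is_cring]
  note T' = T[unfolded One_nat_def]
  have c [simp]: "e \<in> carrier R" "u \<in> carrier R" using independent_carrier[OF eu(1)] by auto
  define f where "f = \<one> \<oplus> (- 1) \<star> e"
  have fc [simp]: "f \<in> carrier R" by (simp add: f_def)
  have cancel: "x \<oplus> (- 1) \<star> x = \<zero>" if "x \<in> carrier R" for x using that by (simp add: smul_uminus r_neg)
  have one: "\<one> = e \<oplus> f" using a_comm[of \<one> "(- 1) \<star> e"] by (simp add: f_def smul_uminus r_neg2)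
  have fe: "f \<otimes> e = \<zero>" and ef: "e \<otimes> f = \<zero>" and fu: "f \<otimes> u = \<zero>" and uf: "u \<otimes> f = u"
    by (simp_all add: f_def l_distr r_distr l_smul r_smul eu cancel)
  have ff: "f \<otimes> f = f"
    by (subst (2) f_def) (simp add: r_distr r_smul fe)
  have uu: "u \<otimes> u = \<zero>"
    using m_assoc[of u e u] eu by simp
  define h where "h A = \<rho> (A (0, 0)) \<star> e \<oplus> (\<rho> (A (1, 1)) \<star> f \<oplus> \<rho> (A (0, 1)) \<star> u)" for A :: "nat \<times> nat \<Rightarrow> 'c"
  have hc: "h A \<in> carrier R" for A by (simp add: h_def)
  \<comment> \<open>Passage to the basis \<open>\<one>\<close>, \<open>e\<close>, \<open>u\<close>,
    for which spanning and uniqueness are known.\<close>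
  have form: "a \<star> e \<oplus> (b \<star> f \<oplus> d \<star> u) = b \<star> \<one> \<oplus> ((a - b) \<star> e \<oplus> d \<star> u)" for a b d
    using smul_add[of e b "a - b"] by (simp add: one smul_distrib a_ac)
  show ?thesis
  proof (rule ring_iso_flip)
    show "h \<one>\<^bsub>?T\<^esub> = \<one>"
      by (simp add: h_def T'(13-15) smul_dvd F.rep_zero rep_one_smul one)
    fix A B assume A: "A \<in> carrier ?T" and B: "B \<in> carrier ?T"
    show "A \<otimes>\<^bsub>?T\<^esub> B \<in> carrier ?T" "A \<oplus>\<^bsub>?T\<^esub> B \<in> carrier ?T" using T(4,5) A B by auto
    note Ac = T'(1-3)[OF A] and Bc = T'(1-3)[OF B]
    show "h (A \<oplus>\<^bsub>?T\<^esub> B) = h A \<oplus> h B"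
      using Ac Bc by (simp add: h_def T'(7-9)[OF A B] rep_add_smul a_ac)
    show "h (A \<otimes>\<^bsub>?T\<^esub> B) = h A \<otimes> h B"
      using Ac Bc by (simp add: h_def T'(10-12)[OF A B] rep_add_smul rep_mult_smul l_distr r_distr l_smul r_smul
          smul_smul eu fe ef fu uf ff uu smul_distrib a_ac mult.commute)
  next
    show "\<one>\<^bsub>?T\<^esub> \<in> carrier ?T" by (rule T(6))
    show "bij_betw h (carrier ?T) (carrier R)"
    proof (rule bij_betwI')
      fix A B assume A: "A \<in> carrier ?T" and B: "B \<in> carrier ?T"
      note Ac = T'(1-3)[OF A] and Bc = T'(1-3)[OF B]
      show "h A = h B \<longleftrightarrow> A = B"
      proof
        assume eq: "h A = h B"
        define a b d where "a = \<rho> (A (0, 0)) - \<rho> (B (0, 0))" and "b = \<rho> (A (1, 1)) - \<rho> (B (1, 1))"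
          and "d = \<rho> (A (0, 1)) - \<rho> (B (0, 1))"
        have diff: "(m - n) \<star> x = m \<star> x \<oplus> \<ominus> (n \<star> x)" if "x \<in> carrier R" for m n x
          using smul_add[OF that, of m "- n"] that by (simp add: smul_uminus)
        have "a \<star> e \<oplus> (b \<star> f \<oplus> d \<star> u) = h A \<ominus> h B"
          by (simp add: a_def b_def d_def h_def diff minus_eq minus_add a_ac)
        also have "\<dots> = \<zero>" using eq hc by (simp add: minus_eq r_neg)
        finally have "b \<star> \<one> \<oplus> ((a - b) \<star> e \<oplus> d \<star> u) = \<zero>" unfolding form .
        from scalar_basis_unique[OF eu(1) this] have "3 dvd b" "3 dvd a - b" "3 dvd d" .
        then have "3 dvd a" "3 dvd b" "3 dvd d" by presburger+
        then have "A (0, 0) = B (0, 0)" "A (1, 1) = B (1, 1)" "A (0, 1) = B (0, 1)"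
          using F.rep_inj Ac Bc by (simp_all add: a_def b_def d_def)
        then show "A = B" using T(16) A B by blast
      qed simp
      show "h A \<in> carrier R" by (rule hc)
    next
      fix r assume "r \<in> carrier R"
      then obtain a b d where r: "r = a \<star> \<one> \<oplus> (b \<star> e \<oplus> d \<star> u)" using scalar_basis[OF scalar eu(1)] by blast
      obtain p where p: "p \<in> carrier F" "\<And>x. x \<in> carrier R \<Longrightarrow> \<rho> p \<star> x = (a + b) \<star> x" using rep_smulE[of "(a + b)"] by blast
      obtain q where q: "q \<in> carrier F" "\<And>x. x \<in> carrier R \<Longrightarrow> \<rho> q \<star> x = a \<star> x" using rep_smulE[of "a"] by blast
      obtain s where s: "s \<in> carrier F" "\<And>x. x \<in> carrier R \<Longrightarrow> \<rho> s \<star> x = d \<star> x" using rep_smulE[of "d"] by blast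
      obtain A where A: "A \<in> carrier ?T" "A (0, 0) = p" "A (0, 1) = s" "A (1, 1) = q"
        using T(17)[OF p(1) s(1) q(1)] by blast
      have "h A = (a + b) \<star> e \<oplus> (a \<star> f \<oplus> d \<star> u)"
        using A(2-4) by (simp add: h_def p q s)
      also have "\<dots> = r" unfolding form r by simp
      finally show "\<exists>A\<in>carrier ?T. r = h A" using A(1) by blast
    qed
  qed
qed

end

text \<open>The coefficient of \<open>x\<^sup>i y\<^sup>j\<close>.\<close>

definition poly2_coeff :: "('a, 'm) ring_scheme \<Rightarrow> (nat \<Rightarrow> nat \<Rightarrow> 'a) \<Rightarrow> nat \<Rightarrow> nat \<Rightarrow> 'a" where
  "poly2_coeff F p i j = coeff (UP F) (coeff (UP (UP F)) p j) i"

section \<open>Polynomials in two variables up to degree one\<close>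

context
  fixes F (structure)
  assumes F: "cring F"
begin

interpretation F: cring F by (rule F)

interpretation P: UP_cring F "UP F"
  by unfold_locales

interpretation Q: UP_cring "UP F" "UP (UP F)"
  by unfold_locales

lemma ring_poly2: "ring (poly2 F)"
  unfolding poly2_def by (rule Q.UP_ring)

lemma poly2_coeff_closed: "p \<in> carrier (poly2 F) \<Longrightarrow> poly2_coeff F p i j \<in> carrier F"
  by (simp add: poly2_def poly2_coeff_def)

lemma poly2_coeff_add:
  "p \<in> carrier (poly2 F) \<Longrightarrow> q \<in> carrier (poly2 F) \<Longrightarrow>
    poly2_coeff F (p \<oplus>\<^bsub>poly2 F\<^esub> q) i j = poly2_coeff F p i j \<oplus> poly2_coeff F q i j"
  by (simp add: poly2_def poly2_coeff_def)

lemma poly2_coeff_one: "poly2_coeff F \<one>\<^bsub>poly2 F\<^esub> i j = (if i = 0 \<and> j = 0 then \<one> else \<zero>)"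
  by (simp add: poly2_def poly2_coeff_def)

lemma atMost_Suc_0: "{..Suc 0} = {1, 0}"
  by auto

text \<open>Up to degree one a product involves no coefficients of higher degree; this makes
  evaluation at two elements with zero products multiplicative.\<close>

lemma poly2_coeff_mult:
  assumes p: "p \<in> carrier (poly2 F)" and q: "q \<in> carrier (poly2 F)"
  shows "poly2_coeff F (p \<otimes>\<^bsub>poly2 F\<^esub> q) 0 0 = poly2_coeff F p 0 0 \<otimes> poly2_coeff F q 0 0"
    "poly2_coeff F (p \<otimes>\<^bsub>poly2 F\<^esub> q) 1 0 =
      poly2_coeff F p 0 0 \<otimes> poly2_coeff F q 1 0 \<oplus> poly2_coeff F p 1 0 \<otimes> poly2_coeff F q 0 0"
    "poly2_coeff F (p \<otimes>\<^bsub>poly2 F\<^esub> q) 0 1 =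
      poly2_coeff F p 0 0 \<otimes> poly2_coeff F q 0 1 \<oplus> poly2_coeff F p 0 1 \<otimes> poly2_coeff F q 0 0"
  using p q by (simp_all add: poly2_def poly2_coeff_def atMost_Suc_0 Pi_def F.a_comm)

lemma monom2_closed: "c \<in> carrier F \<Longrightarrow> monom (UP (UP F)) (monom (UP F) c i) j \<in> carrier (poly2 F)"
  by (simp add: poly2_def)

lemma poly2_coeff_monom:
  "c \<in> carrier F \<Longrightarrow> poly2_coeff F (monom (UP (UP F)) (monom (UP F) c i) j) i' j' =
    (if i = i' \<and> j = j' then c else \<zero>)"
  by (simp add: poly2_coeff_def)

lemma poly2_x_y_closed: "poly2_x F \<in> carrier (poly2 F)" "poly2_y F \<in> carrier (poly2 F)"
  by (simp_all add: poly2_def poly2_x_def poly2_y_def)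

lemma poly2_squares:
  "poly2_x F [^]\<^bsub>poly2 F\<^esub> (2::nat) = monom (UP (UP F)) (monom (UP F) \<one> 2) 0"
  "poly2_x F \<otimes>\<^bsub>poly2 F\<^esub> poly2_y F = monom (UP (UP F)) (monom (UP F) \<one> 1) 1"
  "poly2_y F [^]\<^bsub>poly2 F\<^esub> (2::nat) = monom (UP (UP F)) (monom (UP F) \<one> 0) 2"
proof -
  interpret R: ring "poly2 F" by (rule ring_poly2)
  have sq: "r [^]\<^bsub>poly2 F\<^esub> (2::nat) = r \<otimes>\<^bsub>poly2 F\<^esub> r" if "r \<in> carrier (poly2 F)" for r
    using that by (simp add: numeral_2_eq_2)
  let ?X = "monom (UP F) \<one> 1"
  have X: "?X \<in> carrier (UP F)" by simp
  have XX: "?X \<otimes>\<^bsub>UP F\<^esub> ?X = monom (UP F) \<one> 2"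
    using P.monom_mult[of "\<one>" "\<one>" 1 1] by (simp add: numeral_2_eq_2 del: P.monom_mult)
  show "poly2_x F [^]\<^bsub>poly2 F\<^esub> (2::nat) = monom (UP (UP F)) (monom (UP F) \<one> 2) 0"
    using Q.monom_mult[OF X X, of 0 0] sq[OF poly2_x_y_closed(1)]
    by (simp add: poly2_x_def poly2_def XX[unfolded One_nat_def] del: Q.monom_mult)
  show "poly2_x F \<otimes>\<^bsub>poly2 F\<^esub> poly2_y F = monom (UP (UP F)) (monom (UP F) \<one> 1) 1"
    using Q.monom_mult[OF X P.UP_one_closed, of 0 1]
    by (simp add: poly2_x_def poly2_y_def poly2_def del: Q.monom_mult)
  show "poly2_y F [^]\<^bsub>poly2 F\<^esub> (2::nat) = monom (UP (UP F)) (monom (UP F) \<one> 0) 2"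
    using Q.monom_mult[OF P.UP_one_closed P.UP_one_closed, of 1 1] sq[OF poly2_x_y_closed(2)]
    by (simp add: poly2_y_def poly2_def numeral_2_eq_2 del: Q.monom_mult)
qed

abbreviation (input) "squares_ideal \<equiv> Idl\<^bsub>poly2 F\<^esub> {poly2_x F [^]\<^bsub>poly2 F\<^esub> (2::nat),
  poly2_x F \<otimes>\<^bsub>poly2 F\<^esub> poly2_y F, poly2_y F [^]\<^bsub>poly2 F\<^esub> (2::nat)}"

lemma squares_ideal: "ideal squares_ideal (poly2 F)"
proof -
  interpret R: ring "poly2 F" by (rule ring_poly2)
  show ?thesis using poly2_x_y_closed by (intro R.genideal_ideal) auto
qed

text \<open>According to its exponents, such a monomial is a multiple of \<open>x^2\<close>,
  \<open>x y\<close> or \<open>y^2\<close>.\<close>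

lemma monom2_mem_squares_ideal:
  assumes c: "c \<in> carrier F" and ij: "i + j \<ge> 2"
  shows "monom (UP (UP F)) (monom (UP F) c i) j \<in> squares_ideal"
proof -
  interpret R: ring "poly2 F" by (rule ring_poly2)
  interpret I: ideal squares_ideal "poly2 F" by (rule squares_ideal)
  have gens: "{poly2_x F [^]\<^bsub>poly2 F\<^esub> (2::nat), poly2_x F \<otimes>\<^bsub>poly2 F\<^esub> poly2_y F, poly2_y F [^]\<^bsub>poly2 F\<^esub> (2::nat)} \<subseteq> squares_ideal"
    using poly2_x_y_closed by (intro R.genideal_self) auto
  have step: "monom (UP (UP F)) (monom (UP F) c (i' + k)) (j' + l) \<in> squares_ideal"
    if "monom (UP (UP F)) (monom (UP F) \<one> k) l \<in> squares_ideal" for i' j' k l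
  proof -
    have "monom (UP F) c (i' + k) = monom (UP F) c i' \<otimes>\<^bsub>UP F\<^esub> monom (UP F) \<one> k"
      using P.monom_mult[OF c F.one_closed, of i' k] c by (simp del: P.monom_mult)
    then have "monom (UP (UP F)) (monom (UP F) c (i' + k)) (j' + l) =
        monom (UP (UP F)) (monom (UP F) c i') j' \<otimes>\<^bsub>poly2 F\<^esub> monom (UP (UP F)) (monom (UP F) \<one> k) l"
      using Q.monom_mult[of "monom (UP F) c i'" "monom (UP F) \<one> k" j' l] c
      by (simp add: poly2_def del: Q.monom_mult)
    then show ?thesis using I.I_l_closed[OF that monom2_closed[OF c]] by simp
  qed
  have g: "monom (UP (UP F)) (monom (UP F) \<one> 2) 0 \<in> squares_ideal"
    "monom (UP (UP F)) (monom (UP F) \<one> 1) 1 \<in> squares_ideal"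
    "monom (UP (UP F)) (monom (UP F) \<one> 0) 2 \<in> squares_ideal"
    unfolding poly2_squares[symmetric] using gens by blast+
  consider "i \<ge> 2" | "i \<ge> 1" "j \<ge> 1" | "j \<ge> 2" using ij by linarith
  then show ?thesis
  proof cases
    case 1
    then show ?thesis using step[OF g(1), of "i - 2" j] by (simp only: le_add_diff_inverse2 add_0_right)
  next
    case 2
    then show ?thesis using step[OF g(2), of "i - 1" "j - 1"] by (simp only: le_add_diff_inverse2)
  next
    case 3
    then show ?thesis using step[OF g(3), of i "j - 2"] by (simp only: le_add_diff_inverse2 add_0_right)
  qed
qed

text \<open>The polynomials without constant and linear terms form an ideal \<open>K\<close> that
  contains the generators. Conversely, each of them is a sum of monomials of degree at least
  2.\<close>

lemma squares_ideal_iff: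
  "p \<in> squares_ideal \<longleftrightarrow> p \<in> carrier (poly2 F) \<and> poly2_coeff F p 0 0 = \<zero> \<and>
    poly2_coeff F p 1 0 = \<zero> \<and> poly2_coeff F p 0 1 = \<zero>"
proof -
  interpret R: ring "poly2 F" by (rule ring_poly2)
  interpret I: ideal squares_ideal "poly2 F" by (rule squares_ideal)
  define K where "K = {p \<in> carrier (poly2 F). poly2_coeff F p 0 0 = \<zero> \<and>
    poly2_coeff F p 1 0 = \<zero> \<and> poly2_coeff F p 0 1 = \<zero>}"
  have neg: "poly2_coeff F (\<ominus>\<^bsub>poly2 F\<^esub> p) i j = \<ominus> poly2_coeff F p i j" if "p \<in> carrier (poly2 F)" for p i j
    using that by (simp add: poly2_def poly2_coeff_def)
  have "ideal K (poly2 F)"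
  proof (rule idealI[OF ring_poly2])
    show "subgroup K (add_monoid (poly2 F))"
    proof (rule R.add.subgroupI)
      have "\<zero>\<^bsub>poly2 F\<^esub> \<in> K" by (simp add: K_def) (simp add: poly2_def poly2_coeff_def)
      then show "K \<noteq> {}" by blast
    qed (auto simp: K_def poly2_coeff_add neg)
  qed (auto simp: K_def poly2_coeff_mult poly2_coeff_closed poly2_coeff_mult[unfolded One_nat_def] poly2_coeff_closed[of _ _ "Suc 0"])
  moreover have "{poly2_x F [^]\<^bsub>poly2 F\<^esub> (2::nat), poly2_x F \<otimes>\<^bsub>poly2 F\<^esub> poly2_y F, poly2_y F [^]\<^bsub>poly2 F\<^esub> (2::nat)} \<subseteq> K"
    unfolding poly2_squares K_def by (auto simp: poly2_coeff_def poly2_def)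
  ultimately have IK: "squares_ideal \<subseteq> K" by (rule R.genideal_minimal)
  have I0: "\<zero>\<^bsub>UP (UP F)\<^esub> \<in> squares_ideal"
    unfolding poly2_def by (rule I.zero_closed[unfolded poly2_def])
  have I_add: "a \<oplus>\<^bsub>UP (UP F)\<^esub> b \<in> squares_ideal" if "a \<in> squares_ideal" "b \<in> squares_ideal" for a b
    using that unfolding poly2_def by (rule I.a_closed[unfolded poly2_def])
  have "p \<in> squares_ideal" if "p \<in> K" for p
  proof -
    have p: "p \<in> carrier (UP (UP F))" using \<open>p \<in> K\<close> by (simp add: K_def poly2_def)
    have zero: "poly2_coeff F p i j = \<zero>" if "i + j < 2" for i j
    proof -
      have "i = 0 \<and> j = 0 \<or> i = 1 \<and> j = 0 \<or> i = 0 \<and> j = 1" using that by presburger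
      then show ?thesis using \<open>p \<in> K\<close> by (elim disjE) (simp_all add: K_def)
    qed
    have row: "monom (UP (UP F)) (coeff (UP (UP F)) p j) j \<in> squares_ideal" for j
    proof -
      let ?q = "coeff (UP (UP F)) p j"
      \<comment> \<open>\<open>J\<close> carries membership in the ideal over to coefficients of the
        \<open>j\<close>-th power of \<open>y\<close>, so that the expansion of \<open>?q\<close> in
        powers of \<open>x\<close> can be summed inside \<open>UP F\<close>.\<close>
      define J where "J = {q \<in> carrier (UP F). monom (UP (UP F)) q j \<in> squares_ideal}"
      have q: "?q \<in> carrier (UP F)" using p by simp
      have "(\<Oplus>\<^bsub>UP F\<^esub> i \<in> {..deg F ?q}. monom (UP F) (coeff (UP F) ?q i) i) \<in> J"
      proof (rule P.P.finsum_mem)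
        show "\<zero>\<^bsub>UP F\<^esub> \<in> J" using I0 by (simp add: J_def)
        show "q \<oplus>\<^bsub>UP F\<^esub> q' \<in> J" if "q \<in> J" "q' \<in> J" for q q'
          using that I_add by (simp add: J_def)
        fix i
        show "monom (UP F) (coeff (UP F) ?q i) i \<in> J"
        proof (cases "i + j < 2")
          case True
          then have "coeff (UP F) ?q i = \<zero>" using zero by (simp add: poly2_coeff_def)
          then show ?thesis using I0 by (simp add: J_def)
        next
          case False
          then show ?thesis using q monom2_mem_squares_ideal[of "coeff (UP F) ?q i" i j] by (simp add: J_def)
        qed
      qed (auto simp: J_def)
      then have "?q \<in> J" by (simp only: P.up_repr[OF q])
      then show ?thesis by (simp add: J_def)
    qed
    have "(\<Oplus>\<^bsub>UP (UP F)\<^esub> j \<in> {..deg (UP F) p}. monom (UP (UP F)) (coeff (UP (UP F)) p j) j) \<in> squares_ideal"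
    proof (rule Q.P.finsum_mem)
      show "squares_ideal \<subseteq> carrier (UP (UP F))" unfolding poly2_def by (rule I.a_subset[unfolded poly2_def])
      show "\<zero>\<^bsub>UP (UP F)\<^esub> \<in> squares_ideal" by (rule I0)
      show "a \<oplus>\<^bsub>UP (UP F)\<^esub> b \<in> squares_ideal" if "a \<in> squares_ideal" "b \<in> squares_ideal" for a b
        using that by (rule I_add)
    qed (use row in auto)
    then show ?thesis using Q.up_repr[OF p] by simp
  qed
  then show ?thesis using IK unfolding K_def by blast
qed

end

context GF3_scalars
begin

text \<open>As all products of \<open>x\<close> and \<open>y\<close> vanish, evaluation at them
  involves only constant and linear coefficients; its kernel is therefore the ideal described by
  \<open>squares_ideal_iff\<close>.\<close>

lemma null_iso:
  assumes xy: "independent x y" "x \<otimes> x = \<zero>" "x \<otimes> y = \<zero>" "y \<otimes> x = \<zero>" "y \<otimes> y = \<zero>"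
  shows "R \<simeq> poly2_mod_squares F"
proof -
  let ?Q = "poly2 F"
  interpret Q: ring ?Q by (rule ring_poly2[OF F.is_cring])
  note co [simp] = poly2_coeff_closed[OF F.is_cring]
  have c [simp]: "x \<in> carrier R" "y \<in> carrier R" using independent_carrier[OF xy(1)] by auto
  define h where "h p = \<rho> (poly2_coeff F p 0 0) \<star> \<one> \<oplus>
    (\<rho> (poly2_coeff F p 1 0) \<star> x \<oplus> \<rho> (poly2_coeff F p 0 1) \<star> y)" for p
  note mult = poly2_coeff_mult[OF F.is_cring] poly2_coeff_mult[OF F.is_cring, unfolded One_nat_def]
  have hom: "h \<in> ring_hom ?Q R"
  proof (rule ring_hom_memI)
    show "h p \<in> carrier R" for p by (simp add: h_def)
    show "h \<one>\<^bsub>?Q\<^esub> = \<one>"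
      by (simp add: h_def poly2_coeff_one[OF F.is_cring] smul_dvd F.rep_zero rep_one_smul)
    fix p q assume p: "p \<in> carrier ?Q" and q: "q \<in> carrier ?Q"
    show "h (p \<oplus>\<^bsub>?Q\<^esub> q) = h p \<oplus> h q"
      using p q by (simp add: h_def poly2_coeff_add[OF F.is_cring] rep_add_smul a_ac)
    show "h (p \<otimes>\<^bsub>?Q\<^esub> q) = h p \<otimes> h q"
      using p q by (simp add: h_def mult rep_add_smul rep_mult_smul l_distr r_distr l_smul r_smul smul_smul xy
          smul_distrib a_ac mult.commute)
  qed
  interpret h: ring_hom_ring ?Q R h by (rule ring_hom_ringI2[OF Q.ring_axioms ring_axioms hom])
  have "h ` carrier ?Q = carrier R"
  proof
    show "h ` carrier ?Q \<subseteq> carrier R" by auto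
    show "carrier R \<subseteq> h ` carrier ?Q"
    proof
      fix r assume "r \<in> carrier R"
      then obtain a b d where r: "r = a \<star> \<one> \<oplus> (b \<star> x \<oplus> d \<star> y)" using scalar_basis[OF scalar xy(1)] by blast
      obtain p where p: "p \<in> carrier F" "\<And>x. x \<in> carrier R \<Longrightarrow> \<rho> p \<star> x = a \<star> x" using rep_smulE[of "a"] by blast
      obtain q where q: "q \<in> carrier F" "\<And>x. x \<in> carrier R \<Longrightarrow> \<rho> q \<star> x = b \<star> x" using rep_smulE[of "b"] by blast
      obtain s where s: "s \<in> carrier F" "\<And>x. x \<in> carrier R \<Longrightarrow> \<rho> s \<star> x = d \<star> x" using rep_smulE[of "d"] by blast
      let ?m = "\<lambda>c i j. monom (UP (UP F)) (monom (UP F) c i) j"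
      let ?p = "?m p 0 0 \<oplus>\<^bsub>?Q\<^esub> (?m q 1 0 \<oplus>\<^bsub>?Q\<^esub> ?m s 0 1)"
      have m: "?m p 0 0 \<in> carrier ?Q" "?m q 1 0 \<in> carrier ?Q" "?m s 0 1 \<in> carrier ?Q"
        using monom2_closed[OF F.is_cring] p q s by auto
      then have pc: "?p \<in> carrier ?Q" by simp
      have "poly2_coeff F ?p 0 0 = p" "poly2_coeff F ?p 1 0 = q" "poly2_coeff F ?p 0 1 = s"
        using m p q s by (simp_all add: poly2_coeff_add[OF F.is_cring] poly2_coeff_monom[OF F.is_cring])
      then have "h ?p = r"
        by (simp add: h_def r p q s)
      then show "r \<in> h ` carrier ?Q" using pc by blast
    qed
  qed
  then have iso: "?Q Quot (a_kernel ?Q R h) \<simeq> R" by (rule h.FactRing_iso)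
  have "a_kernel ?Q R h = {p \<in> carrier ?Q. poly2_coeff F p 0 0 = \<zero>\<^bsub>F\<^esub> \<and>
    poly2_coeff F p 1 0 = \<zero>\<^bsub>F\<^esub> \<and> poly2_coeff F p 0 1 = \<zero>\<^bsub>F\<^esub>}"
  proof -
    have "h p = \<zero> \<longleftrightarrow> poly2_coeff F p 0 0 = \<zero>\<^bsub>F\<^esub> \<and> poly2_coeff F p 1 0 = \<zero>\<^bsub>F\<^esub> \<and> poly2_coeff F p 0 1 = \<zero>\<^bsub>F\<^esub>"
      if p: "p \<in> carrier ?Q" for p
    proof
      assume "h p = \<zero>"
      from scalar_basis_unique[OF xy(1) this[unfolded h_def]]
      have "3 dvd \<rho> (poly2_coeff F p 0 0)" "3 dvd \<rho> (poly2_coeff F p 1 0)" "3 dvd \<rho> (poly2_coeff F p 0 1)" .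
      then show "poly2_coeff F p 0 0 = \<zero>\<^bsub>F\<^esub> \<and> poly2_coeff F p 1 0 = \<zero>\<^bsub>F\<^esub> \<and> poly2_coeff F p 0 1 = \<zero>\<^bsub>F\<^esub>"
        using F.rep_inj[OF _ F.zero_closed] F.rep_zero p by (metis co dvd_diff)
    next
      assume "poly2_coeff F p 0 0 = \<zero>\<^bsub>F\<^esub> \<and> poly2_coeff F p 1 0 = \<zero>\<^bsub>F\<^esub> \<and> poly2_coeff F p 0 1 = \<zero>\<^bsub>F\<^esub>"
      then show "h p = \<zero>" by (simp add: h_def smul_dvd F.rep_zero)
    qed
    then show ?thesis unfolding a_kernel_def' by (intro Collect_cong) blast
  qed
  also have "\<dots> = Idl\<^bsub>?Q\<^esub> {poly2_x F [^]\<^bsub>?Q\<^esub> (2::nat), poly2_x F \<otimes>\<^bsub>?Q\<^esub> poly2_y F, poly2_y F [^]\<^bsub>?Q\<^esub> (2::nat)}"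
    by (rule Set.set_eqI) (simp only: squares_ideal_iff[OF F.is_cring] mem_Collect_eq)
  finally have "poly2_mod_squares F \<simeq> R" using iso by (simp add: poly2_mod_squares_def)
  moreover have "ring (poly2_mod_squares F)"
    unfolding poly2_mod_squares_def by (rule ideal.quotient_is_ring[OF squares_ideal[OF F.is_cring]])
  ultimately show ?thesis by (rule ring_iso_sym[rotated])
qed

end

theorem theorem3p11:
  fixes R :: "('a, 'm) ring_scheme"
    and F2 :: "('b, 'n) ring_scheme"
    and F3 :: "('c, 'k) ring_scheme"
    and F4 :: "('d, 'l) ring_scheme"
  assumes "is_GF 2 F2" and "is_GF 3 F3" and "is_GF 4 F4"
    and "in_S 4 R"
  shows "(\<forall>t::nat. t \<ge> 1 \<and> order R = 3 ^ t \<longrightarrow>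
            R \<simeq> poly2_mod_squares F3 \<or> R \<simeq> upper_triangular_ring 2 F3)
       \<and> (\<forall>t::nat. t \<ge> 1 \<and> order R = 2 ^ t \<longrightarrow>
            R \<simeq> RDirProd F4 F4 \<or> R \<simeq> matrix_ring 2 F2)"
proof (intro conjI allI impI)
  interpret ring R using assms(4) by (simp add: in_S_def)
  fix t :: nat
  assume "t \<ge> 1 \<and> order R = 3 ^ t"
  then obtain D where pcr: "plane_cover_ring R D" and scalar: "\<And>d. d \<in> D \<Longrightarrow> \<exists>c. d = smul c \<one>\<^bsub>R\<^esub>"
    using order_three_power_cases[OF assms(4)] by blast
  interpret plane_cover_ring R D by (rule pcr)
  obtain \<rho> where "GF3_representatives F3 \<rho>" using exists_GF3_representatives[OF assms(2)] by blast
  then interpret F: GF3_representatives F3 \<rho> .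
  interpret GF3_scalars R D F3 \<rho> by unfold_locales (rule scalar)
  show "R \<simeq> poly2_mod_squares F3 \<or> R \<simeq> upper_triangular_ring 2 F3"
    by (rule scalar_case[OF scalar]) (use null_iso T2_iso in blast)+
next
  fix t :: nat
  assume "t \<ge> 1 \<and> order R = 2 ^ t"
  then have "R \<simeq> RDirProd GF4 GF4 \<or> R \<simeq> M2_bool"
    using in_S_4_order_two_power[OF assms(4)] by blast
  then show "R \<simeq> RDirProd F4 F4 \<or> R \<simeq> matrix_ring 2 F2"
    using ring_iso_trans[OF _ RDirProd_GF4_iso[OF assms(3)]] ring_iso_trans[OF _ M2_bool_iso_matrix_ring[OF assms(1)]]
    by blast
qed

end
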